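(* A second order ordinary differential equation $\mathcal{E}_f:\ y''=f(x,y,y')$ can be mapped to the second Painlevé equation $\bar y''=2\bar y^3+\bar x\bar y+\bar\alpha$ by a fiber-preserving transformation $(x,y)\mapsto(\bar x,\bar y)$ if and only if this transformation (written together with $\bar p=d\bar y/d\bar x$) is given by the following formulas, in which the differential invariants of $f$ defined in the context are taken, in both cases, with the normalization $$I_1=-12,\qquad I_{1;3}=-12,\qquad I_{1;31}=0 .$$ If $\bar\alpha\neq0$: $$\bar p=\frac16\left(\frac{I_{1;33311}\,(I_{1;3331}+4032)}{I_{1;33311}I_{1;33}-3096576-4032\,I_{1;331}}\right)\bar y^2\,\bar\alpha,$$ $$\bar x=-\left(16+\frac{1}{72}I_{1;331}\right)\bar y^2,$$ $$\bar y^3=48384\,\frac{\bar\alpha}{I_{1;33311}I_{1;33}-3096576-4032\,I_{1;331}},$$ $$\bar\alpha^2=-\frac{1}{112\,I_{1;33311}\left(16257024+8064\,I_{1;3331}+I_{1;3331}^2\right)}\Big(I_{1;33311}^2I_{1;33}^2-8064\,I_{1;33311}I_{1;33}I_{1;331}-6193152\,I_{1;33311}I_{1;33}+9588782923776+24970788864\,I_{1;331}+16257024\,I_{1;331}^2\Big).$$ If $\bar\alpha=0$: $$\bar p=\frac{1}{290304}\,\bar y^5\,I_{1;33311}\,(4032+I_{1;3331}),$$ $$\bar x=-\frac{1}{72}\,\bar y^2\,(1152+I_{1;331}),$$ $$\bar y^6=-20901888\,\frac{1}{I_{1;33311}\,(4032+I_{1;3331})^2}.$$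
   Context: Everything is complex analytic and local. A fiber-preserving transformation is a locally invertible analytic transformation $(x,y)\mapsto(\bar x(x),\bar y(x,y))$ of $\mathbb{C}^2$, i.e. $\bar x_y=0$ and $\bar x_x\bar y_y\neq 0$. The coordinates on the first jet space $J^1=J^1(\mathbb{C},\mathbb{C})$ are $(x,y,p)$ with $p=y'$. A fiber-preserving transformation $\varphi$ maps $\mathcal{E}_f: y''=f(x,y,y')$ to $\mathcal{E}_{\bar f}:\bar y''=\bar f(\bar x,\bar y,\bar y')$ if its first prolongation satisfies $$\varphi^*\begin{pmatrix} d\bar y-\bar p\,d\bar x \\ d\bar p-\bar f\,d\bar x \\ d\bar x \end{pmatrix}=\begin{pmatrix} a_1 & 0 & 0 \\ a_2 & a_3 & 0 \\ 0 & 0 & a_4 \end{pmatrix}\begin{pmatrix} dy-p\,dx \\ dp-f\,dx \\ dx \end{pmatrix}$$ for some functions $a_i:J^1\to\mathbb{C}$ with the matrix invertible. Let $\tilde M$ be the manifold fibred over $J^1$ with local coordinates $(x,y,p,a_1,a_2,a_4)$. Subscripts $x,y,p$ on $f=f(x,y,p)$ denote partial derivatives, and $D_x=\partial_x+p\,\partial_y+f\,\partial_p$. The fundamental invariants of the fiber-preserving equivalence problem on $\tilde M$ are $$I_{1}= \frac{(2 f_{yy} - D_{x}f_{yp} - f_{pp} f_{y} + f_{yp} f_{p})\, a_{1} + ( - f_{yp} + D_{x}f_{pp})\, a_{4} a_{2}}{2a_{1}^{2} a_{4}^{2}},$$ $$I_{2}= \frac{f_{yp} - D_{x}f_{pp}}{2a_{1}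 a_{4}},\qquad I_3=-\frac{f_{ppp}\,a_4}{2a_1^2}.$$ On the Painlevé equations $I_2=I_3=0$; on this branch the two invariant derivations that can produce new invariants are $$X_1=\frac{1}{a_{1}}\partial_y - \frac{a_{2} a_{4}}{a_{1}^{2}}\,\partial_p - \frac{1}{2}f_{pp}\, \partial_{a_{1}} - \frac{1}{2}\frac{f_{py}}{a_{4}}\,\partial_{a_{2}},$$ $$X_3=\frac{1}{a_{4}}\partial_x + \frac{p}{a_{4}}\partial_y + \frac{f}{a_{4}}\partial_p + a_{2}\,\partial_{a_{1}} - \frac{f_{y} a_{1}}{a_{4}^{2}}\,\partial_{a_{2}} + \frac{2 a_{2} a_{4} + f_{p} a_{1}}{a_{1}}\,\partial_{a_{4}}.$$ Notation: $I_{1;j\cdots k}=X_k\cdots X_j(I_1)$, so for instance $I_{1;31}=X_1X_3(I_1)$, $I_{1;331}=X_1X_3X_3(I_1)$ and $I_{1;33311}=X_1X_1X_3X_3X_3(I_1)$. Taking the invariants with the normalization means: compute them on $\tilde M$, then use the three normalization equations to eliminate the parameters $a_1,a_2,a_4$, so that the invariants no longer depend on these parameters. The theorem is used as follows: specialize the formulas on the given equation to obtain candidate transformations, then test by substitution whether a candidate is a fiber-preserving transformation mapping the given equation to the second Painlevé equation.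
   Formalization: Signs are corrected: the printed formulas fail for the identity map of Painlevé II (x̄ would be −32y²−x). For ᾱ=0 the ᾱ² formula is also required, since the other three hold for y''=2y³+xy+c(x). I₂=I₃=0 joins the condition; formulas are required where ȳ,p̄≠0. *)

theory Defs
  imports "HOL-Complex_Analysis.Complex_Analysis"
begin

text \<open>
  Analyticity in two and three complex variables: on an open set it is the same as complex
  Frechet differentiability at every point. The complex linearity of the derivative is made
  explicit by writing it with complex coefficients.
\<close>

definition analytic2_on :: "(complex \<Rightarrow> complex \<Rightarrow> complex) \<Rightarrow> (complex \<times> complex) set \<Rightarrow> bool" where
  "analytic2_on h W \<longleftrightarrow> (\<forall>(x, y)\<in>W. \<exists>A B.
     ((\<lambda>(x, y). h x y) has_derivative (\<lambda>(u, v). A * u + B * v)) (at (x, y)))"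

definition analytic3_on ::
    "(complex \<Rightarrow> complex \<Rightarrow> complex \<Rightarrow> complex) \<Rightarrow> (complex \<times> complex \<times> complex) set \<Rightarrow> bool" where
  "analytic3_on h U \<longleftrightarrow> (\<forall>(x, y, p)\<in>U. \<exists>A B C.
     ((\<lambda>(x, y, p). h x y p) has_derivative (\<lambda>(u, v, w). A * u + B * v + C * w)) (at (x, y, p)))"

text \<open>A transformation \<open>(x, y) \<mapsto> (xb x, yb x y)\<close>; that \<open>xb\<close> does not depend on \<open>y\<close> is built
  into its type.\<close>

definition fiber_preserving ::
    "(complex \<Rightarrow> complex) \<Rightarrow> (complex \<Rightarrow> complex \<Rightarrow> complex) \<Rightarrow> (complex \<times> complex) set \<Rightarrow> bool" where
  "fiber_preserving xb yb W \<longleftrightarrow>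
     xb analytic_on fst ` W \<and> analytic2_on yb W \<and>
     (\<forall>(x, y)\<in>W. deriv xb x \<noteq> 0 \<and> deriv (yb x) y \<noteq> 0)"

text \<open>\<open>pbar = d yb / d xb\<close>, and the first prolongation to the jet space.\<close>

definition pbar ::
    "(complex \<Rightarrow> complex) \<Rightarrow> (complex \<Rightarrow> complex \<Rightarrow> complex) \<Rightarrow> complex \<Rightarrow> complex \<Rightarrow> complex \<Rightarrow> complex" where
  "pbar xb yb x y p = (deriv (\<lambda>t. yb t y) x + p * deriv (yb x) y) / deriv xb x"

definition prolong ::
    "(complex \<Rightarrow> complex) \<Rightarrow> (complex \<Rightarrow> complex \<Rightarrow> complex) \<Rightarrow>
     complex \<times> complex \<times> complex \<Rightarrow> complex \<times> complex \<times> complex" where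
  "prolong xb yb = (\<lambda>(x, y, p). (xb x, yb x y, pbar xb yb x y p))"

text \<open>The forms \<open>dy - p dx\<close>, \<open>dp - f dx\<close>, \<open>dx\<close> at a point, evaluated on a tangent vector.\<close>

definition coframe ::
    "(complex \<Rightarrow> complex \<Rightarrow> complex \<Rightarrow> complex) \<Rightarrow> complex \<times> complex \<times> complex \<Rightarrow>
     complex \<times> complex \<times> complex \<Rightarrow> complex ^ 3" where
  "coframe f = (\<lambda>(x, y, p) (dx, dy, dp). vector [dy - p * dx, dp - f x y p * dx, dx])"

definition structure_matrix :: "complex \<Rightarrow> complex \<Rightarrow> complex \<Rightarrow> complex \<Rightarrow> complex ^ 3 ^ 3" where
  "structure_matrix a1 a2 a3 a4 =
     vector [vector [a1, 0, 0], vector [a2, a3, 0], vector [0, 0, a4]]"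

text \<open>\<open>(xb, yb)\<close> maps \<open>y'' = f(x, y, y')\<close> to \<open>y'' = g(x, y, y')\<close> over the open set \<open>U\<close> of the
  jet space.\<close>

definition maps_ode ::
    "(complex \<Rightarrow> complex) \<Rightarrow> (complex \<Rightarrow> complex \<Rightarrow> complex) \<Rightarrow> (complex \<times> complex \<times> complex) set \<Rightarrow>
     (complex \<Rightarrow> complex \<Rightarrow> complex \<Rightarrow> complex) \<Rightarrow> (complex \<Rightarrow> complex \<Rightarrow> complex \<Rightarrow> complex) \<Rightarrow> bool" where
  "maps_ode xb yb U f g \<longleftrightarrow> (\<exists>a1 a2 a3 a4. \<forall>z\<in>U.
     invertible (structure_matrix (a1 z) (a2 z) (a3 z) (a4 z)) \<and>
     (\<forall>v. coframe g (prolong xb yb z) (frechet_derivative (prolong xb yb) (at z) v) =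
          structure_matrix (a1 z) (a2 z) (a3 z) (a4 z) *v coframe f z v))"

definition painleve2 :: "complex \<Rightarrow> complex \<Rightarrow> complex \<Rightarrow> complex \<Rightarrow> complex" where
  "painleve2 \<alpha> x y p = 2 * y ^ 3 + x * y + \<alpha>"

definition Px ::
    "(complex \<Rightarrow> complex \<Rightarrow> complex \<Rightarrow> complex) \<Rightarrow> complex \<Rightarrow> complex \<Rightarrow> complex \<Rightarrow> complex" where
  "Px h x y p = deriv (\<lambda>t. h t y p) x"

definition Py ::
    "(complex \<Rightarrow> complex \<Rightarrow> complex \<Rightarrow> complex) \<Rightarrow> complex \<Rightarrow> complex \<Rightarrow> complex \<Rightarrow> complex" where
  "Py h x y p = deriv (\<lambda>t. h x t p) y"

definition Pp ::
    "(complex \<Rightarrow> complex \<Rightarrow> complex \<Rightarrow> complex) \<Rightarrow> complex \<Rightarrow> complex \<Rightarrow> complex \<Rightarrow> complex" where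
  "Pp h x y p = deriv (\<lambda>t. h x y t) p"

definition Dx ::
    "(complex \<Rightarrow> complex \<Rightarrow> complex \<Rightarrow> complex) \<Rightarrow>
     (complex \<Rightarrow> complex \<Rightarrow> complex \<Rightarrow> complex) \<Rightarrow> complex \<Rightarrow> complex \<Rightarrow> complex \<Rightarrow> complex" where
  "Dx f h x y p = Px h x y p + p * Py h x y p + f x y p * Pp h x y p"

text \<open>Functions of the local coordinates \<open>x, y, p, a1, a2, a4\<close> of the bundle over the jet space.\<close>

type_synonym bundle_fun = "complex \<Rightarrow> complex \<Rightarrow> complex \<Rightarrow> complex \<Rightarrow> complex \<Rightarrow> complex \<Rightarrow> complex"

definition I1 :: "(complex \<Rightarrow> complex \<Rightarrow> complex \<Rightarrow> complex) \<Rightarrow> bundle_fun" where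
  "I1 f x y p a1 a2 a4 =
     ((2 * Py (Py f) x y p - Dx f (Pp (Py f)) x y p - Pp (Pp f) x y p * Py f x y p
         + Pp (Py f) x y p * Pp f x y p) * a1
       + (- Pp (Py f) x y p + Dx f (Pp (Pp f)) x y p) * a4 * a2)
     / (2 * a1 ^ 2 * a4 ^ 2)"

definition I2 :: "(complex \<Rightarrow> complex \<Rightarrow> complex \<Rightarrow> complex) \<Rightarrow> bundle_fun" where
  "I2 f x y p a1 a2 a4 = (Pp (Py f) x y p - Dx f (Pp (Pp f)) x y p) / (2 * a1 * a4)"

definition I3 :: "(complex \<Rightarrow> complex \<Rightarrow> complex \<Rightarrow> complex) \<Rightarrow> bundle_fun" where
  "I3 f x y p a1 a2 a4 = - (Pp (Pp (Pp f)) x y p * a4) / (2 * a1 ^ 2)"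

definition X1 :: "(complex \<Rightarrow> complex \<Rightarrow> complex \<Rightarrow> complex) \<Rightarrow> bundle_fun \<Rightarrow> bundle_fun" where
  "X1 f F x y p a1 a2 a4 =
     1 / a1 * deriv (\<lambda>t. F x t p a1 a2 a4) y
     - a2 * a4 / a1 ^ 2 * deriv (\<lambda>t. F x y t a1 a2 a4) p
     - 1 / 2 * Pp (Pp f) x y p * deriv (\<lambda>t. F x y p t a2 a4) a1
     - 1 / 2 * (Py (Pp f) x y p / a4) * deriv (\<lambda>t. F x y p a1 t a4) a2"

definition X3 :: "(complex \<Rightarrow> complex \<Rightarrow> complex \<Rightarrow> complex) \<Rightarrow> bundle_fun \<Rightarrow> bundle_fun" where
  "X3 f F x y p a1 a2 a4 =
     1 / a4 * deriv (\<lambda>t. F t y p a1 a2 a4) x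
     + p / a4 * deriv (\<lambda>t. F x t p a1 a2 a4) y
     + f x y p / a4 * deriv (\<lambda>t. F x y t a1 a2 a4) p
     + a2 * deriv (\<lambda>t. F x y p t a2 a4) a1
     - Py f x y p * a1 / a4 ^ 2 * deriv (\<lambda>t. F x y p a1 t a4) a2
     + (2 * a2 * a4 + Pp f x y p * a1) / a1 * deriv (\<lambda>t. F x y p a1 a2 t) a4"

text \<open>The indices of a derived invariant are applied from left to right, e.g.
  \<open>I1_331 f = X1 (X3 (X3 I1))\<close>.\<close>

definition "I1_3 f = X3 f (I1 f)"
definition "I1_31 f = X1 f (I1_3 f)"
definition "I1_33 f = X3 f (I1_3 f)"
definition "I1_331 f = X1 f (I1_33 f)"
definition "I1_333 f = X3 f (I1_33 f)"
definition "I1_3331 f = X1 f (I1_333 f)"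
definition "I1_33311 f = X1 f (I1_3331 f)"

text \<open>The branch on which \<open>X1\<close> and \<open>X3\<close> are invariant derivations.\<close>

definition painleve_branch ::
    "(complex \<Rightarrow> complex \<Rightarrow> complex \<Rightarrow> complex) \<Rightarrow> (complex \<times> complex \<times> complex) set \<Rightarrow> bool" where
  "painleve_branch f U \<longleftrightarrow> (\<forall>(x, y, p)\<in>U. \<forall>a1 a2 a4. a1 \<noteq> 0 \<longrightarrow> a4 \<noteq> 0 \<longrightarrow>
     I2 f x y p a1 a2 a4 = 0 \<and> I3 f x y p a1 a2 a4 = 0)"

definition normalized ::
    "(complex \<Rightarrow> complex \<Rightarrow> complex \<Rightarrow> complex) \<Rightarrow> complex \<Rightarrow> complex \<Rightarrow> complex \<Rightarrow>
     complex \<times> complex \<times> complex \<Rightarrow> bool" where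
  "normalized f x y p = (\<lambda>(a1, a2, a4). a1 \<noteq> 0 \<and> a4 \<noteq> 0 \<and>
     I1 f x y p a1 a2 a4 = -12 \<and> I1_3 f x y p a1 a2 a4 = -12 \<and> I1_31 f x y p a1 a2 a4 = 0)"

text \<open>
  The formulas for the transformation; \<open>J33\<close>, ..., \<open>J33311\<close> stand for the normalized invariants
  \<open>I1_33\<close>, ..., \<open>I1_33311\<close>. Division is total, so that the denominators do not vanish is stated
  separately.

  The signs are those that go with the vector field \<open>X1\<close> and the normalization as defined above. For
  \<open>f = painleve2 \<alpha>\<close> the normalization gives \<open>a2 = 0\<close>, \<open>a4 = p / y\<close>, \<open>a1 = - y^3 / p^2\<close>, hence
  \<open>J33 = - y (384 y^3 + 72 x y + 12 \<alpha>) / p^2\<close>, \<open>J331 = 1152 + 72 x / y^2\<close>,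
  \<open>J3331 = 4032 + 72 / (y p)\<close>, \<open>J33311 = - 4032 p^2 / y^4\<close>, and the formulas hold for the identity
  transformation. These formulas
  are also found in print with \<open>16 + J331 / 72\<close>, \<open>1152 + J331\<close>, \<open>4032 + J3331\<close>,
  \<open>16257024 + 8064 J3331 + J3331^2\<close>, \<open>- 3096576\<close>, \<open>- 6193152\<close> and \<open>+ 24970788864\<close>; with those
  signs they fail for the identity transformation of \<open>painleve2 \<alpha>\<close>.

  The formula for \<open>\<alpha>^2\<close> is needed for \<open>\<alpha> = 0\<close> as well: the three other formulas for \<open>\<alpha> = 0\<close> do not
  involve \<open>J33\<close>, and they hold for the identity transformation of \<open>y'' = 2 y^3 + x y + c(x)\<close>
  for every function \<open>c\<close>.
\<close>

definition pII_alpha_formula ::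
    "complex \<Rightarrow> complex \<Rightarrow> complex \<Rightarrow> complex \<Rightarrow> complex \<Rightarrow> bool" where
  "pII_alpha_formula \<alpha> J33 J331 J3331 J33311 \<longleftrightarrow>
     112 * J33311 * (16257024 - 8064 * J3331 + J3331 ^ 2) \<noteq> 0 \<and>
     \<alpha> ^ 2 = - (1 / (112 * J33311 * (16257024 - 8064 * J3331 + J3331 ^ 2))) *
       (J33311 ^ 2 * J33 ^ 2 - 8064 * J33311 * J33 * J331 + 6193152 * J33311 * J33
        + 9588782923776 - 24970788864 * J331 + 16257024 * J331 ^ 2)"

definition pII_formulas_nonzero ::
    "complex \<Rightarrow> complex \<Rightarrow> complex \<Rightarrow> complex \<Rightarrow> complex \<Rightarrow> complex \<Rightarrow> complex \<Rightarrow> complex \<Rightarrow> bool" where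
  "pII_formulas_nonzero \<alpha> X Y P J33 J331 J3331 J33311 \<longleftrightarrow>
     J33311 * J33 + 3096576 - 4032 * J331 \<noteq> 0 \<and>
     P = 1 / 6 * (J33311 * (4032 - J3331) / (J33311 * J33 + 3096576 - 4032 * J331)) * Y ^ 2 * \<alpha> \<and>
     X = - (16 - 1 / 72 * J331) * Y ^ 2 \<and>
     Y ^ 3 = 48384 * (\<alpha> / (J33311 * J33 + 3096576 - 4032 * J331))"

definition pII_formulas_zero ::
    "complex \<Rightarrow> complex \<Rightarrow> complex \<Rightarrow> complex \<Rightarrow> complex \<Rightarrow> complex \<Rightarrow> bool" where
  "pII_formulas_zero X Y P J331 J3331 J33311 \<longleftrightarrow>
     P = 1 / 290304 * Y ^ 5 * J33311 * (4032 - J3331) \<and>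
     X = - (1 / 72) * Y ^ 2 * (1152 - J331) \<and>
     J33311 * (4032 - J3331) ^ 2 \<noteq> 0 \<and>
     Y ^ 6 = - 20901888 * (1 / (J33311 * (4032 - J3331) ^ 2))"

text \<open>
  At the point \<open>(x, y, p)\<close>, the normalization equations determine \<open>a1, a2, a4\<close>, so that the
  normalized invariants are functions on the jet space, and the transformation is given by the
  formulas in these invariants.
\<close>

definition given_by_pII_formulas ::
    "complex \<Rightarrow> (complex \<Rightarrow> complex) \<Rightarrow> (complex \<Rightarrow> complex \<Rightarrow> complex) \<Rightarrow>
     (complex \<Rightarrow> complex \<Rightarrow> complex \<Rightarrow> complex) \<Rightarrow> complex \<Rightarrow> complex \<Rightarrow> complex \<Rightarrow> bool" where
  "given_by_pII_formulas \<alpha> xb yb f x y p \<longleftrightarrow>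
     (\<exists>!a. normalized f x y p a) \<and>
     (\<forall>a1 a2 a4. normalized f x y p (a1, a2, a4) \<longrightarrow>
        pII_alpha_formula \<alpha>
          (I1_33 f x y p a1 a2 a4) (I1_331 f x y p a1 a2 a4)
          (I1_3331 f x y p a1 a2 a4) (I1_33311 f x y p a1 a2 a4) \<and>
        (\<alpha> \<noteq> 0 \<longrightarrow> pII_formulas_nonzero \<alpha> (xb x) (yb x y) (pbar xb yb x y p)
          (I1_33 f x y p a1 a2 a4) (I1_331 f x y p a1 a2 a4)
          (I1_3331 f x y p a1 a2 a4) (I1_33311 f x y p a1 a2 a4)) \<and>
        (\<alpha> = 0 \<longrightarrow> pII_formulas_zero (xb x) (yb x y) (pbar xb yb x y p)
          (I1_331 f x y p a1 a2 a4)
          (I1_3331 f x y p a1 a2 a4) (I1_33311 f x y p a1 a2 a4)))"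

end

theory Submission
  imports Defs
begin

text \<open>
  On the branch \<open>I2 = I3 = 0\<close> the equation has locally the form \<open>y'' = A + B y' + C y'^2\<close> with
  \<open>B_y = 2 C_x\<close>, so that its data are functions of \<open>(x, y)\<close> alone. Which triples \<open>(A, B, C)\<close>
  belong to equations that the transformation \<open>(X, Y)\<close> maps to the second Painleve equation is an
  explicit law (\<open>A\<^sub>0\<close>, \<open>B\<^sub>0\<close>, \<open>C\<^sub>0\<close>; lemma \<open>maps_ode_iff_law\<close>). The theorem compares this law with
  the values of four normalized invariants; at points with \<open>Y \<noteq> 0\<close> and \<open>P \<noteq> 0\<close> the formulas are
  nothing but these values, namely those of the second Painleve equation at \<open>(X, Y, P)\<close> (lemma
  \<open>pII_formulas_iff\<close>).

  High derivatives are avoided by a commutator relation. With \<open>\<sigma> = a2 a4 / a1 + f_p / 2\<close> the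
  derivations \<open>X1\<close> and \<open>X3\<close> act on polynomials in \<open>p\<close>, \<open>\<sigma>\<close>, \<open>1 / a1\<close>, \<open>1 / a4\<close> over the functions
  of \<open>(x, y)\<close>, and \<open>[X1, X3] = - I1 X5\<close> with \<open>X5 = a1 \<partial>/\<partial>a2\<close> (lemma \<open>X1_X3_commutator\<close>). Hence the
  derived invariants are obtained by applying \<open>X3\<close> to \<open>I1 = k / (a1 a4^2)\<close>,
  \<open>X1 I1 = u / (a1^2 a4^2)\<close> and \<open>X1 (X1 I1) = v / (a1^3 a4^2)\<close>, where \<open>k\<close>, \<open>u\<close>, \<open>v\<close> are functions
  of \<open>(x, y)\<close>; for instance \<open>I1_33311 = X3^3 X1^2 I1 + 28 (X1 I1) I1_3 + 42 I1 I1_31\<close>.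

  If the law holds, then \<open>k = 12 Y X'^2 Y_y\<close>, \<open>u = 12 X'^2 Y_y^2\<close> and \<open>v = 0\<close>. The normalization
  equations have exactly one solution and the invariants follow (\<open>invariants_of_law\<close>).

  Conversely, let the four invariants have these values. For fixed \<open>(x, y)\<close> they are identities of
  polynomials in \<open>p\<close>, whose coefficients can be compared. The identity for \<open>I1_331\<close> shows that
  \<open>X1 (X1 I1)\<close> behaves under \<open>X3\<close> like \<open>(X1 I1)^(7/6)\<close>. This turns the expression for \<open>I1_33311\<close>
  into a cubic identity in \<open>P\<close>, which forces \<open>v = 0\<close> and one relation between \<open>k\<close> and \<open>u\<close>.
  Differentiation of the remaining coefficient of \<open>I1_331\<close> along \<open>y\<close> gives \<open>k Y_y = u Y\<close>, so \<open>k\<close>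
  and \<open>u\<close> are the functions above. Then \<open>C\<close> is read off from \<open>u_y\<close>, \<open>B\<close> from the cubic identity,
  and \<open>A\<close> from \<open>I1_331\<close> and \<open>I1_33\<close> (\<open>law_of_invariants\<close>). Points at which \<open>X\<close>, \<open>Y\<close> or \<open>P\<close>
  vanishes are reached by continuity.
\<close>

section \<open>Partial derivatives of analytic functions of two variables\<close>

definition px :: "(complex \<Rightarrow> complex \<Rightarrow> complex) \<Rightarrow> complex \<Rightarrow> complex \<Rightarrow> complex" where
  "px c x y = deriv (\<lambda>t. c t y) x"

definition py :: "(complex \<Rightarrow> complex \<Rightarrow> complex) \<Rightarrow> complex \<Rightarrow> complex \<Rightarrow> complex" where
  "py c x y = deriv (c x) y"

lemma analytic2_on_partials:
  assumes "analytic2_on c W" "(x, y) \<in> W"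
  shows "((\<lambda>t. c t y) has_field_derivative px c x y) (at x)"
    and "(c x has_field_derivative py c x y) (at y)"
    and "((\<lambda>(x, y). c x y) has_derivative (\<lambda>(u, v). px c x y * u + py c x y * v)) (at (x, y))"
proof -
  obtain A B where AB:
    "((\<lambda>(x, y). c x y) has_derivative (\<lambda>(u, v). A * u + B * v)) (at (x, y))"
    using assms unfolding analytic2_on_def by blast
  have "((\<lambda>t. (t, y)) has_derivative (\<lambda>u. (u, 0))) (at x)"
    by (auto intro!: derivative_eq_intros)
  from has_derivative_compose[OF this AB]
  have A: "((\<lambda>t. c t y) has_field_derivative A) (at x)"
    by (simp add: has_field_derivative_def)
  have "((\<lambda>t. (x, t)) has_derivative (\<lambda>u. (0, u))) (at y)"
    by (auto intro!: derivative_eq_intros)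
  from has_derivative_compose[OF this AB]
  have B: "(c x has_field_derivative B) (at y)"
    by (simp add: has_field_derivative_def)
  have "A = px c x y" "B = py c x y"
    using A B by (simp_all add: px_def py_def DERIV_imp_deriv)
  with A B AB show "((\<lambda>t. c t y) has_field_derivative px c x y) (at x)"
    "(c x has_field_derivative py c x y) (at y)"
    "((\<lambda>(x, y). c x y) has_derivative (\<lambda>(u, v). px c x y * u + py c x y * v)) (at (x, y))"
    by simp_all
qed

lemma analytic2_on_continuous:
  assumes "analytic2_on c W"
  shows "continuous_on W (\<lambda>(x, y). c x y)"
proof (rule continuous_at_imp_continuous_on, rule ballI)
  fix z assume z: "z \<in> W"
  obtain x y where xy: "z = (x, y)" by fastforce
  show "isCont (\<lambda>(x, y). c x y) z"
    using analytic2_on_partials(3)[OF assms z[unfolded xy]] unfolding xy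
    by (rule has_derivative_continuous)
qed

lemma open_contains_polydisc:
  fixes x y :: complex
  assumes "open W" "(x, y) \<in> W"
  obtains r where "r > 0" "cball x r \<times> cball y r \<subseteq> W"
proof -
  obtain A B where AB: "open A" "open B" "x \<in> A" "y \<in> B" "A \<times> B \<subseteq> W"
    using assms by (rule open_prod_elim) auto
  obtain r1 where "r1 > 0" "cball x r1 \<subseteq> A" using AB open_contains_cball by metis
  moreover obtain r2 where "r2 > 0" "cball y r2 \<subseteq> B" using AB open_contains_cball by metis
  ultimately have "cball x (min r1 r2) \<times> cball y (min r1 r2) \<subseteq> A \<times> B" "min r1 r2 > 0"
    by (auto simp: subset_iff)
  hence "cball x (min r1 r2) \<times> cball y (min r1 r2) \<subseteq> W" "min r1 r2 > 0" using AB(5) by auto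
  with that show thesis by blast
qed

text \<open>
  When \<open>(a, b)\<close> tends to \<open>(x, y)\<close>, the functions \<open>e \<mapsto> c a (b + e)\<close> converge uniformly on a disc,
  because \<open>c\<close> is uniformly continuous on compact sets. For holomorphic functions the derivatives
  then converge as well.
\<close>

lemma continuous_on_py_holomorphic:
  assumes "open W" and cont_c: "continuous_on W (\<lambda>(x, y). c x y)"
    and dc: "\<And>x y. (x, y) \<in> W \<Longrightarrow> (c x has_field_derivative py c x y) (at y)"
  shows "continuous_on W (\<lambda>(x, y). py c x y)"
proof (rule continuous_at_imp_continuous_on, rule ballI)
  fix z assume z: "z \<in> W"
  obtain x y where z_eq: "z = (x, y)" by fastforce
  with z have xy: "(x, y) \<in> W" by simp
  obtain r where r: "r > 0" "cball x r \<times> cball y r \<subseteq> W"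
    using open_contains_polydisc[OF assms(1) xy] .
  define d where "d = r / 2"
  have d: "d > 0" using r by (simp add: d_def)
  define U where "U = ball x d \<times> ball y d"
  have U: "open U" "(x, y) \<in> U" using d by (auto simp: U_def open_Times)
  have inW: "(a, b + e) \<in> W" if "(a, b) \<in> U" "e \<in> cball 0 d" for a b e
  proof -
    have "norm (b + e - y) \<le> norm (b - y) + norm e"
      using norm_triangle_ineq[of "b - y" e] by (simp add: algebra_simps)
    thus ?thesis using that r by (auto simp: U_def d_def dist_norm norm_minus_commute)
  qed
  have cont: "continuous_on (U \<times> cball 0 d) (\<lambda>((a, b), e). c a (b + e))"
  proof -
    have "continuous_on (U \<times> cball 0 d) (\<lambda>w. (fst (fst w), snd (fst w) + snd w))"
      by (intro continuous_intros)
    moreover have "(\<lambda>w. (fst (fst w), snd (fst w) + snd w)) ` (U \<times> cball 0 d) \<subseteq> W"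
      using inW by auto
    ultimately have "continuous_on (U \<times> cball 0 d)
        (\<lambda>w. (\<lambda>(x, y). c x y) (fst (fst w), snd (fst w) + snd w))"
      using cont_c continuous_on_compose2 by blast
    thus ?thesis by (simp add: case_prod_unfold)
  qed
  let ?F = "at (x, y)"
  have ev: "\<forall>\<^sub>F z in ?F. z \<in> U"
    using U by (intro eventually_at_in_open') auto
  have dv: "((\<lambda>e. c a (b + e)) has_field_derivative py c a (b + e)) (at e)"
    if "(a, b) \<in> U" "e \<in> cball 0 d" for a b e
  proof -
    have "((\<lambda>e. b + e) has_field_derivative 1) (at e)" by (auto intro!: derivative_eq_intros)
    from DERIV_chain2[OF dc[OF inW[OF that]] this]
    show ?thesis by simp
  qed
  have ul: "uniform_limit (cball 0 d) (\<lambda>(a, b) e. c a (b + e)) (\<lambda>e. c x (y + e)) ?F"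
    unfolding uniform_limit_iff
  proof safe
    fix e :: real assume "e > 0"
    obtain X0 where X0: "(x, y) \<in> X0" "open X0"
      "\<forall>z\<in>X0 \<inter> U. \<forall>t\<in>cball 0 d. dist ((\<lambda>((a, b), e). c a (b + e)) (z, t))
          ((\<lambda>((a, b), e). c a (b + e)) ((x, y), t)) \<le> e / 2"
      using continuous_on_prod_compactE[OF cont compact_cball, of "(x, y)" "e / 2"] U \<open>e > 0\<close> 
      by (metis half_gt_zero_iff)
    have "\<forall>\<^sub>F z in ?F. z \<in> X0 \<inter> U"
      using U X0 by (intro eventually_at_in_open') auto
    thus "\<forall>\<^sub>F n in ?F. \<forall>t\<in>cball 0 d. dist ((case n of (a, b) \<Rightarrow> \<lambda>e. c a (b + e)) t) (c x (y + t)) < e"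
    proof (rule eventually_mono)
      fix z assume z: "z \<in> X0 \<inter> U"
      show "\<forall>t\<in>cball 0 d. dist ((case z of (a, b) \<Rightarrow> \<lambda>e. c a (b + e)) t) (c x (y + t)) < e"
        using X0(3) z \<open>e > 0\<close> by (force simp: case_prod_unfold)
    qed
  qed
  have cev: "\<forall>\<^sub>F n in ?F. continuous_on (cball 0 d) ((\<lambda>(a, b) e. c a (b + e)) n) \<and>
      (\<forall>w\<in>ball 0 d. ((\<lambda>(a, b) e. c a (b + e)) n has_field_derivative
         (\<lambda>(a, b) e. py c a (b + e)) n w) (at w))"
    using ev
  proof (rule eventually_mono)
    fix n assume n: "n \<in> U"
    obtain a b where ab: "n = (a, b)" by fastforce
    show "continuous_on (cball 0 d) ((\<lambda>(a, b) e. c a (b + e)) n) \<and>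
      (\<forall>w\<in>ball 0 d. ((\<lambda>(a, b) e. c a (b + e)) n has_field_derivative
         (\<lambda>(a, b) e. py c a (b + e)) n w) (at w))"
    proof
      have "continuous_on (cball 0 d) (\<lambda>e. c a (b + e))"
        by (rule DERIV_continuous_on[where D = "\<lambda>e. py c a (b + e)"],
            rule has_field_derivative_at_within, rule dv) (use n ab in auto)
      thus "continuous_on (cball 0 d) ((\<lambda>(a, b) e. c a (b + e)) n)" by (simp add: ab)
      show "\<forall>w\<in>ball 0 d. ((\<lambda>(a, b) e. c a (b + e)) n has_field_derivative
         (\<lambda>(a, b) e. py c a (b + e)) n w) (at w)"
        using dv[of a b] n by (simp add: ab)
    qed
  qed
  obtain g' where g': "\<And>w. w \<in> ball 0 d \<Longrightarrow> ((\<lambda>e. c x (y + e)) has_field_derivative g' w) (at w) \<and>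
      ((\<lambda>n. (\<lambda>(a, b) e. py c a (b + e)) n w) \<longlongrightarrow> g' w) ?F"
    using has_complex_derivative_uniform_limit[OF cev ul _ d] by (metis trivial_limit_at)
  have "g' 0 = py c x (y + 0)"
    using g'[of 0] dv[of x y 0] U d DERIV_unique by (metis centre_in_ball centre_in_cball less_imp_le)
  with g'[of 0] d have "((\<lambda>(a, b). py c a b) \<longlongrightarrow> py c x y) ?F"
    by (simp add: case_prod_unfold)
  thus "isCont (\<lambda>(x, y). py c x y) z"
    by (simp add: isCont_def z_eq)
qed

lemma continuous_on_py:
  assumes "open W" "analytic2_on c W"
  shows "continuous_on W (\<lambda>(x, y). py c x y)"
  by (rule continuous_on_py_holomorphic)
    (use assms in \<open>auto intro: analytic2_on_continuous analytic2_on_partials(2)\<close>)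

text \<open>
  The difference quotients of \<open>c\<close> in the second variable are holomorphic in the first one and
  converge locally uniformly to \<open>py c\<close>. Hence \<open>py c\<close> is holomorphic in the first variable, and the
  derivatives of the quotients converge to \<open>px (py c)\<close>. But these derivatives are the difference
  quotients of \<open>px c\<close>, so one limit yields both claims.
\<close>

lemma mixed_partial_derivatives:
  assumes "open W" "analytic2_on c W" "(x, y) \<in> W"
  shows "((\<lambda>t. py c t y) has_field_derivative px (py c) x y) (at x)"
    and "(px c x has_field_derivative px (py c) x y) (at y)"
proof -
  obtain r where r: "r > 0" "cball x r \<times> cball y r \<subseteq> W"
    using open_contains_polydisc[OF assms(1,3)] .
  let ?F = "at (0::complex)"
  let ?q = "\<lambda>h t. (c t (y + h) - c t y) / h"
  let ?q' = "\<lambda>h t. (px c t (y + h) - px c t y) / h"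
  have inW: "(t, y + h) \<in> W" if "t \<in> cball x r" "norm h \<le> r" for t h
    using that r by (auto simp: dist_norm)
  have ev: "\<forall>\<^sub>F h in ?F. h \<in> ball 0 r - {0}"
    using r by (intro eventually_at_in_open) auto
  have dq: "(?q h has_field_derivative ?q' h t) (at t)" if "t \<in> cball x r" "norm h < r" for h t
    by (intro DERIV_cdivide DERIV_diff analytic2_on_partials(1)[OF assms(2)])
      (use inW[of t h] inW[of t 0] that r in auto)
  have ul: "uniform_limit (cball x r) ?q (\<lambda>t. py c t y) ?F"
    unfolding uniform_limit_iff
  proof safe
    fix e :: real assume e: "e > 0"
    have "continuous_on (ball 0 r \<times> cball x r) (\<lambda>w. (snd w, y + fst w))"
      by (intro continuous_intros)
    moreover have "(\<lambda>w. (snd w, y + fst w)) ` (ball 0 r \<times> cball x r) \<subseteq> W"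
      using inW by (auto simp: less_imp_le)
    ultimately have cont: "continuous_on (ball 0 r \<times> cball x r)
        (\<lambda>w. (\<lambda>(x, y). py c x y) (snd w, y + fst w))"
      using continuous_on_py[OF assms(1,2)] continuous_on_compose2 by blast
    have "(0::complex) \<in> ball 0 r" using r by simp
    from continuous_on_prod_compactE[OF cont compact_cball this, of "e / 2"] e
    obtain X0 where X0: "0 \<in> X0" "open X0"
      "\<forall>h\<in>X0 \<inter> ball 0 r. \<forall>t\<in>cball x r. dist (py c t (y + h)) (py c t y) \<le> e / 2"
      by auto
    have "open (X0 \<inter> ball 0 r)" "0 \<in> X0 \<inter> ball 0 r" using X0 r by auto
    then obtain d where d: "d > 0" "ball 0 d \<subseteq> X0 \<inter> ball 0 r"
      by (rule openE)
    have evd: "\<forall>\<^sub>F h in ?F. h \<in> ball 0 d - {0}"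
      using d by (intro eventually_at_in_open) auto
    show "\<forall>\<^sub>F h in ?F. \<forall>t\<in>cball x r. dist (?q h t) (py c t y) < e"
    proof (rule eventually_mono[OF evd], rule ballI)
      fix h t :: complex assume h: "h \<in> ball 0 d - {0}" and t: "t \<in> cball x r"
      let ?f = "\<lambda>\<eta>. c t (y + \<eta>) - \<eta> * py c t y"
      have "norm (?f h - ?f 0) \<le> e / 2 * norm (h - 0)"
      proof (rule field_differentiable_bound[where S = "ball 0 d"])
        fix z :: complex assume z: "z \<in> ball 0 d"
        have zr: "z \<in> ball 0 r" "z \<in> X0" using z d by auto
        have "((\<lambda>\<eta>. y + \<eta>) has_field_derivative 1) (at z)" by (auto intro!: derivative_eq_intros)
        from DERIV_chain2[OF analytic2_on_partials(2)[OF assms(2) inW] this]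
        have "((\<lambda>\<eta>. c t (y + \<eta>)) has_field_derivative py c t (y + z)) (at z)"
          using zr t by simp
        from DERIV_diff[OF this DERIV_cmult_right[OF DERIV_ident, of "py c t y"]]
        have "(?f has_field_derivative py c t (y + z) - py c t y) (at z)"
          by simp
        thus "(?f has_field_derivative py c t (y + z) - py c t y) (at z within ball 0 d)"
          by (rule has_field_derivative_at_within)
        show "norm (py c t (y + z) - py c t y) \<le> e / 2"
          using X0(3) zr t by (auto simp: dist_norm)
      qed (use h d in auto)
      hence "norm (c t (y + h) - c t y - h * py c t y) \<le> e / 2 * norm h"
        by (simp add: algebra_simps)
      moreover have "c t (y + h) - c t y - h * py c t y = h * (?q h t - py c t y)"
        using h by (simp add: field_simps)
      ultimately have "norm h * norm (?q h t - py c t y) \<le> e / 2 * norm h"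
        by (simp add: norm_mult)
      hence "norm (?q h t - py c t y) \<le> e / 2" using h by (simp add: mult.commute)
      thus "dist (?q h t) (py c t y) < e" using e by (simp add: dist_norm)
    qed
  qed
  have cev: "\<forall>\<^sub>F h in ?F. continuous_on (cball x r) (?q h) \<and>
      (\<forall>w\<in>ball x r. (?q h has_field_derivative ?q' h w) (at w))"
    using ev
  proof (rule eventually_mono)
    fix h :: complex assume "h \<in> ball 0 r - {0}"
    hence h: "norm h < r" by simp
    have "continuous_on (cball x r) (?q h)"
      by (rule DERIV_continuous_on[where D = "?q' h"], rule has_field_derivative_at_within, rule dq[OF _ h])
    thus "continuous_on (cball x r) (?q h) \<and> (\<forall>w\<in>ball x r. (?q h has_field_derivative ?q' h w) (at w))"
      using dq[OF _ h] by auto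
  qed
  obtain g' where g': "\<And>w. w \<in> ball x r \<Longrightarrow> ((\<lambda>t. py c t y) has_field_derivative g' w) (at w) \<and>
      ((\<lambda>h. ?q' h w) \<longlongrightarrow> g' w) ?F"
    using has_complex_derivative_uniform_limit[OF cev ul trivial_limit_at r(1)] by blast
  have g: "((\<lambda>t. py c t y) has_field_derivative g' x) (at x)" "((\<lambda>h. ?q' h x) \<longlongrightarrow> g' x) ?F"
    using g'[of x] r by auto
  have eq: "g' x = px (py c) x y"
    unfolding px_def[of "py c"] by (rule DERIV_imp_deriv[OF g(1), symmetric])
  show "((\<lambda>t. py c t y) has_field_derivative px (py c) x y) (at x)"
    using g(1) unfolding eq .
  show "(px c x has_field_derivative px (py c) x y) (at y)"
    using g(2) unfolding eq DERIV_def .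
qed

text \<open>
  Exchanging the variables carries results on \<open>py\<close> over to \<open>px\<close>.
\<close>

lemma analytic2_on_swap:
  assumes "analytic2_on c W"
  shows "analytic2_on (\<lambda>y x. c x y) (prod.swap ` W)"
  unfolding analytic2_on_def
proof (clarsimp)
  fix x y assume "(x, y) \<in> W"
  from analytic2_on_partials(3)[OF assms this]
  have *: "((\<lambda>(x, y). c x y) has_derivative (\<lambda>(u, v). px c x y * u + py c x y * v)) (at (prod.swap (y, x)))"
    by simp
  have "(prod.swap has_derivative (\<lambda>w. prod.swap w)) (at (y, x))"
    unfolding prod.swap_def by (auto intro!: derivative_eq_intros)
  from has_derivative_compose[OF this *]
  show "\<exists>A B. ((\<lambda>(y, x). c x y) has_derivative (\<lambda>(u, v). A * u + B * v)) (at (y, x))"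
    by (intro exI[of _ "py c x y"] exI[of _ "px c x y"])
      (simp add: case_prod_unfold add.commute)
qed

lemma open_swap: "open (prod.swap ` W)" if "open (W :: (complex \<times> complex) set)"
proof -
  have "prod.swap ` W = prod.swap -` W" by force
  moreover have "open (prod.swap -` W)"
    using that by (intro open_vimage continuous_intros) (auto simp: prod.swap_def intro!: continuous_intros)
  ultimately show ?thesis by simp
qed

text \<open>
  Continuity of the derivative in the second variable is what makes the increment in that variable
  linear uniformly near the point, hence the two partial derivatives combine to a Frechet
  derivative.
\<close>

lemma analytic2_onI_partials:
  assumes "open W"
    and dx: "\<And>x y. (x, y) \<in> W \<Longrightarrow> ((\<lambda>t. h t y) has_field_derivative A x y) (at x)"
    and dy: "\<And>x y. (x, y) \<in> W \<Longrightarrow> (h x has_field_derivative B x y) (at y)"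
    and contB: "continuous_on W (\<lambda>(x, y). B x y)"
  shows "analytic2_on h W"
  unfolding analytic2_on_def
proof safe
  fix x y assume xy: "(x, y) \<in> W"
  obtain r where r: "r > 0" "cball x r \<times> cball y r \<subseteq> W"
    using open_contains_polydisc[OF assms(1) xy] .
  let ?X = "ball x r" and ?Y = "ball y r"
  have sub: "?X \<times> ?Y \<subseteq> W" using r by auto
  have "((\<lambda>(x, y). h x y) has_derivative
      (\<lambda>(tx, ty). A x y * tx + blinfun_mult_right (B x y) ty)) (at (x, y) within ?X \<times> ?Y)"
  proof (rule has_derivative_partialsI[where fy = "\<lambda>a b. blinfun_mult_right (B a b)"])
    show "((\<lambda>x. h x y) has_derivative (*) (A x y)) (at x within ?X)"
      using dx[OF xy] unfolding has_field_derivative_def by (rule has_derivative_at_withinI)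
    show "(h a has_derivative blinfun_apply (blinfun_mult_right (B a b))) (at b within ?Y)"
      if "a \<in> ?X" "b \<in> ?Y" for a b
    proof -
      have "(a, b) \<in> W" using that sub by auto
      from dy[OF this] show ?thesis
        unfolding has_field_derivative_def blinfun_mult_right.rep_eq by (rule has_derivative_at_withinI)
    qed
    have "continuous_on (?X \<times> ?Y) (\<lambda>z. blinfun_mult_right ((\<lambda>(a, b). B a b) z))"
      using continuous_on_subset[OF contB sub]
      by (rule bounded_linear.continuous_on[OF bounded_linear_blinfun_mult_right])
    thus "continuous (at (x, y) within ?X \<times> ?Y) (\<lambda>(a, b). blinfun_mult_right (B a b))"
      using r by (simp add: continuous_on_eq_continuous_within case_prod_unfold)
  qed (use r in auto)
  moreover have "at (x, y) within ?X \<times> ?Y = at (x, y)"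
    using r by (intro at_within_open open_Times) auto
  ultimately show "\<exists>A B. ((\<lambda>(x, y). h x y) has_derivative (\<lambda>(u, v). A * u + B * v)) (at (x, y))"
    by (auto simp: blinfun_mult_right.rep_eq)
qed

lemma px_py_commute:
  assumes "open W" "analytic2_on c W" "(x, y) \<in> W"
  shows "py (px c) x y = px (py c) x y"
  using mixed_partial_derivatives(2)[OF assms] by (simp add: py_def DERIV_imp_deriv)

text \<open>
  The derived invariants contain iterated partial derivatives of the coefficients of the equation.
  All of these exist because the analytic functions are closed under \<open>py\<close> and \<open>px\<close>.
\<close>

lemma analytic2_on_py:
  assumes "open W" "analytic2_on c W"
  shows "analytic2_on (py c) W"
proof (rule analytic2_onI_partials[OF assms(1)])
  show "((\<lambda>t. py c t y) has_field_derivative px (py c) x y) (at x)" if "(x, y) \<in> W" for x y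
    using mixed_partial_derivatives(1)[OF assms that] .
  show dyy: "(py c x has_field_derivative py (py c) x y) (at y)" if xy: "(x, y) \<in> W" for x y
  proof -
    obtain r where r: "r > 0" "cball x r \<times> cball y r \<subseteq> W"
      by (rule open_contains_polydisc[OF assms(1) xy])
    have "(c x has_field_derivative py c x z) (at z)" if "z \<in> ball y r" for z
    proof -
      have "(x, z) \<in> W" using r that by auto
      from analytic2_on_partials(2)[OF assms(2) this] show ?thesis .
    qed
    hence "c x holomorphic_on ball y r"
      unfolding holomorphic_on_def field_differentiable_def
      using has_field_derivative_at_within by blast
    hence "deriv (c x) holomorphic_on ball y r" by (rule holomorphic_deriv) simp
    hence "deriv (c x) field_differentiable at y"
      using r by (auto simp: holomorphic_on_open field_differentiable_def)
    moreover have "deriv (c x) = py c x" by (simp add: py_def fun_eq_iff)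
    ultimately show ?thesis by (simp add: field_differentiable_derivI py_def)
  qed
  show "continuous_on W (\<lambda>(x, y). py (py c) x y)"
    using assms by (intro continuous_on_py_holomorphic continuous_on_py dyy)
qed

lemma analytic2_on_px:
  assumes "open W" "analytic2_on c W"
  shows "analytic2_on (px c) W"
proof -
  have "analytic2_on (py (\<lambda>y x. c x y)) (prod.swap ` W)"
    by (intro analytic2_on_py open_swap analytic2_on_swap assms)
  from analytic2_on_swap[OF this] have "analytic2_on (\<lambda>x y. py (\<lambda>y x. c x y) y x) W"
    by (simp add: image_image)
  moreover have "(\<lambda>x y. py (\<lambda>y x. c x y) y x) = px c"
    by (simp add: px_def py_def fun_eq_iff)
  ultimately show ?thesis by simp
qed

lemma eventually_slices2:
  assumes "open W" "(x, y) \<in> W"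
  shows "\<forall>\<^sub>F t in nhds x. (t, y) \<in> W" "\<forall>\<^sub>F t in nhds y. (x, t) \<in> W"
proof -
  have "open ((\<lambda>t. (t, y)) -` W)" "open ((\<lambda>t. (x, t)) -` W)"
    using assms(1) by (intro open_vimage continuous_intros; assumption)+
  from eventually_nhds_in_open[OF this(1), of x] eventually_nhds_in_open[OF this(2), of y] assms(2)
  show "\<forall>\<^sub>F t in nhds x. (t, y) \<in> W" "\<forall>\<^sub>F t in nhds y. (x, t) \<in> W" by auto
qed

lemma partials_cong:
  assumes "open W" "(x, y) \<in> W" "\<And>x y. (x, y) \<in> W \<Longrightarrow> c x y = d x y"
  shows "px c x y = px d x y" "py c x y = py d x y"
  unfolding px_def py_def using eventually_slices2[OF assms(1,2)] assms(3)
  by (auto intro!: deriv_cong_ev elim!: eventually_mono)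

lemma analytic2_on_const [simp]: "analytic2_on (\<lambda>x y. c) W"
  unfolding analytic2_on_def by (auto intro!: exI[of _ 0] simp: case_prod_unfold)

lemma analytic2_on_add [intro, simp]:
  assumes "analytic2_on g W" "analytic2_on h W"
  shows "analytic2_on (\<lambda>x y. g x y + h x y) W"
  unfolding analytic2_on_def
proof (rule ballI, clarify)
  fix x y assume xy: "(x, y) \<in> W"
  from has_derivative_add[OF analytic2_on_partials(3)[OF assms(1) xy] analytic2_on_partials(3)[OF assms(2) xy]]
  show "\<exists>A B. ((\<lambda>(x, y). g x y + h x y) has_derivative (\<lambda>(u, v). A * u + B * v)) (at (x, y))"
    by (intro exI[of _ "px g x y + px h x y"] exI[of _ "py g x y + py h x y"])
      (simp add: case_prod_unfold algebra_simps)
qed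

lemma analytic2_on_mult [intro, simp]:
  assumes "analytic2_on g W" "analytic2_on h W"
  shows "analytic2_on (\<lambda>x y. g x y * h x y) W"
  unfolding analytic2_on_def
proof (rule ballI, clarify)
  fix x y assume xy: "(x, y) \<in> W"
  from has_derivative_mult[OF analytic2_on_partials(3)[OF assms(1) xy] analytic2_on_partials(3)[OF assms(2) xy]]
  show "\<exists>A B. ((\<lambda>(x, y). g x y * h x y) has_derivative (\<lambda>(u, v). A * u + B * v)) (at (x, y))"
    by (intro exI[of _ "g x y * px h x y + px g x y * h x y"] exI[of _ "g x y * py h x y + py g x y * h x y"])
      (simp add: case_prod_unfold algebra_simps)
qed

lemma analytic2_on_inverse:
  assumes "analytic2_on g W" "\<And>x y. (x, y) \<in> W \<Longrightarrow> g x y \<noteq> 0"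
  shows "analytic2_on (\<lambda>x y. inverse (g x y)) W"
  unfolding analytic2_on_def
proof (rule ballI, clarify)
  fix x y assume xy: "(x, y) \<in> W"
  have *: "(inverse has_derivative (\<lambda>h. - (inverse (g x y) * h * inverse (g x y)))) (at ((\<lambda>(x, y). g x y) (x, y)))"
    using assms(2)[OF xy] by (auto intro!: derivative_eq_intros)
  from has_derivative_compose[OF analytic2_on_partials(3)[OF assms(1) xy] *]
  show "\<exists>A B. ((\<lambda>(x, y). inverse (g x y)) has_derivative (\<lambda>(u, v). A * u + B * v)) (at (x, y))"
    by (intro exI[of _ "- px g x y * inverse (g x y) ^ 2"] exI[of _ "- py g x y * inverse (g x y) ^ 2"])
      (simp add: case_prod_unfold algebra_simps power2_eq_square)
qed

lemma analytic2_on_uminus [intro, simp]: "analytic2_on g W \<Longrightarrow> analytic2_on (\<lambda>x y. - g x y) W"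
  using analytic2_on_mult[OF analytic2_on_const[of "-1"], of g W] by simp

lemma analytic2_on_diff [intro, simp]:
  "analytic2_on g W \<Longrightarrow> analytic2_on h W \<Longrightarrow> analytic2_on (\<lambda>x y. g x y - h x y) W"
  using analytic2_on_add[OF _ analytic2_on_uminus, of g W h] by simp

lemma analytic2_on_divide [intro]:
  assumes "analytic2_on g W" "analytic2_on h W" "\<And>x y. (x, y) \<in> W \<Longrightarrow> h x y \<noteq> 0"
  shows "analytic2_on (\<lambda>x y. g x y / h x y) W"
  using analytic2_on_mult[OF assms(1) analytic2_on_inverse[OF assms(2,3)]] by (simp add: field_simps)

lemma analytic2_on_divide_const [intro, simp]:
  "analytic2_on g W \<Longrightarrow> analytic2_on (\<lambda>x y. g x y / c) W"
  using analytic2_on_mult[OF _ analytic2_on_const[of "inverse c"], of g W] by (simp add: field_simps)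

lemma analytic2_on_power [intro, simp]: "analytic2_on g W \<Longrightarrow> analytic2_on (\<lambda>x y. g x y ^ n) W"
  by (induction n) auto

text \<open>
  With the open set fixed, the rules of differentiation can serve as conditional rewrite rules:
  their side conditions mention no set that the term to be rewritten leaves undetermined.
\<close>

locale open_plane_set =
  fixes W :: "(complex \<times> complex) set"
  assumes open_W [simp]: "open W"
begin

abbreviation "analytic c \<equiv> analytic2_on c W"

lemmas analytic_px [intro, simp] = analytic2_on_px[OF open_W]
lemmas analytic_py [intro, simp] = analytic2_on_py[OF open_W]
lemmas py_px = px_py_commute[OF open_W]

lemma px_const [simp]: "px (\<lambda>x y. c) x y = 0" and py_const [simp]: "py (\<lambda>x y. c) x y = 0"
  by (simp_all add: px_def py_def)

context
  fixes g h x y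
  assumes g: "analytic g" and h: "analytic h" and xy: "(x, y) \<in> W"
begin

lemma px_add: "px (\<lambda>x y. g x y + h x y) x y = px g x y + px h x y"
  and py_add: "py (\<lambda>x y. g x y + h x y) x y = py g x y + py h x y"
  and px_diff: "px (\<lambda>x y. g x y - h x y) x y = px g x y - px h x y"
  and py_diff: "py (\<lambda>x y. g x y - h x y) x y = py g x y - py h x y"
  and px_mult: "px (\<lambda>x y. g x y * h x y) x y = px g x y * h x y + g x y * px h x y"
  and py_mult: "py (\<lambda>x y. g x y * h x y) x y = py g x y * h x y + g x y * py h x y"
  using DERIV_add[OF analytic2_on_partials(1)[OF g xy] analytic2_on_partials(1)[OF h xy]]
    DERIV_add[OF analytic2_on_partials(2)[OF g xy] analytic2_on_partials(2)[OF h xy]]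
    DERIV_diff[OF analytic2_on_partials(1)[OF g xy] analytic2_on_partials(1)[OF h xy]]
    DERIV_diff[OF analytic2_on_partials(2)[OF g xy] analytic2_on_partials(2)[OF h xy]]
    DERIV_mult[OF analytic2_on_partials(1)[OF g xy] analytic2_on_partials(1)[OF h xy]]
    DERIV_mult[OF analytic2_on_partials(2)[OF g xy] analytic2_on_partials(2)[OF h xy]]
  by (simp_all add: px_def[of "\<lambda>x y. _ x y"] py_def[of "\<lambda>x y. _ x y"] DERIV_imp_deriv algebra_simps)

lemma px_divide:
  assumes "h x y \<noteq> 0"
  shows "px (\<lambda>x y. g x y / h x y) x y = (px g x y * h x y - g x y * px h x y) / (h x y * h x y)"
  using DERIV_divide[OF analytic2_on_partials(1)[OF g xy] analytic2_on_partials(1)[OF h xy]] assms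
  by (simp add: px_def[of "\<lambda>x y. _ x y"] DERIV_imp_deriv)

lemma py_divide:
  assumes "h x y \<noteq> 0"
  shows "py (\<lambda>x y. g x y / h x y) x y = (py g x y * h x y - g x y * py h x y) / (h x y * h x y)"
  using DERIV_divide[OF analytic2_on_partials(2)[OF g xy] analytic2_on_partials(2)[OF h xy]] assms
  by (simp add: py_def[of "\<lambda>x y. _ x y"] DERIV_imp_deriv)

end

lemma px_power: "px (\<lambda>x y. g x y ^ n) x y = of_nat n * g x y ^ (n - 1) * px g x y"
  if "analytic g" "(x, y) \<in> W"
  using DERIV_power[OF analytic2_on_partials(1)[OF that], of n]
  by (simp add: px_def[of "\<lambda>x y. _ x y ^ _"] DERIV_imp_deriv ac_simps)

lemma py_power: "py (\<lambda>x y. g x y ^ n) x y = of_nat n * g x y ^ (n - 1) * py g x y"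
  if "analytic g" "(x, y) \<in> W"
  using DERIV_power[OF analytic2_on_partials(2)[OF that], of n]
  by (simp add: py_def[of "\<lambda>x y. _ x y ^ _"] DERIV_imp_deriv ac_simps)

lemma px_uminus: "px (\<lambda>x y. - g x y) x y = - px g x y"
  and py_uminus: "py (\<lambda>x y. - g x y) x y = - py g x y" if "analytic g" "(x, y) \<in> W"
  using px_diff[OF analytic2_on_const[of 0] that] py_diff[OF analytic2_on_const[of 0] that] by simp_all

lemma px_divide_const: "px (\<lambda>x y. g x y / c) x y = px g x y / c"
  and py_divide_const: "py (\<lambda>x y. g x y / c) x y = py g x y / c" if "analytic g" "(x, y) \<in> W"
  using px_mult[OF that(1) analytic2_on_const[of "inverse c"] that(2)]
    py_mult[OF that(1) analytic2_on_const[of "inverse c"] that(2)] by (simp_all add: field_simps)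

lemmas partial_rules = px_divide_const py_divide_const px_add py_add px_diff py_diff px_mult py_mult
  px_power py_power px_uminus py_uminus

end

section \<open>Vector fields on the bundle over the jet space\<close>

lemma eventually_slices3:
  assumes "open U" "(x, y, p) \<in> U"
  shows "\<forall>\<^sub>F t in nhds x. (t, y, p) \<in> U" "\<forall>\<^sub>F t in nhds y. (x, t, p) \<in> U"
    "\<forall>\<^sub>F t in nhds p. (x, y, t) \<in> U"
proof -
  have "open ((\<lambda>t. (t, y, p)) -` U)" "open ((\<lambda>t. (x, t, p)) -` U)" "open ((\<lambda>t. (x, y, t)) -` U)"
    using assms(1) by (intro open_vimage continuous_intros; assumption)+
  from eventually_nhds_in_open[OF this(1), of x] eventually_nhds_in_open[OF this(2), of y]
    eventually_nhds_in_open[OF this(3), of p] assms(2)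
  show "\<forall>\<^sub>F t in nhds x. (t, y, p) \<in> U" "\<forall>\<^sub>F t in nhds y. (x, t, p) \<in> U"
    "\<forall>\<^sub>F t in nhds p. (x, y, t) \<in> U" by auto
qed

lemma jet_partials_cong:
  assumes "open U" "(x, y, p) \<in> U" "\<And>x y p. (x, y, p) \<in> U \<Longrightarrow> g x y p = h x y p"
  shows "Px g x y p = Px h x y p" "Py g x y p = Py h x y p" "Pp g x y p = Pp h x y p"
  unfolding Px_def Py_def Pp_def using eventually_slices3[OF assms(1,2)] assms(3)
  by (auto intro!: deriv_cong_ev elim!: eventually_mono)

text \<open>
  A multiple of the generator of the translations of \<open>a2\<close>. It measures how far \<open>X1\<close> and \<open>X3\<close> are
  from commuting.
\<close>

definition X5 :: "bundle_fun \<Rightarrow> bundle_fun" where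
  "X5 F x y p a1 a2 a4 = a1 * deriv (\<lambda>t. F x y p a1 t a4) a2"

definition partially_differentiable ::
    "bundle_fun \<Rightarrow> complex \<Rightarrow> complex \<Rightarrow> complex \<Rightarrow> complex \<Rightarrow> complex \<Rightarrow> complex \<Rightarrow> bool" where
  "partially_differentiable F x y p a1 a2 a4 \<longleftrightarrow>
     (\<lambda>t. F t y p a1 a2 a4) field_differentiable at x \<and>
     (\<lambda>t. F x t p a1 a2 a4) field_differentiable at y \<and>
     (\<lambda>t. F x y t a1 a2 a4) field_differentiable at p \<and>
     (\<lambda>t. F x y p t a2 a4) field_differentiable at a1 \<and>
     (\<lambda>t. F x y p a1 t a4) field_differentiable at a2 \<and>
     (\<lambda>t. F x y p a1 a2 t) field_differentiable at a4"

lemma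
  assumes "partially_differentiable F x y p a1 a2 a4" "partially_differentiable G x y p a1 a2 a4"
  shows partially_differentiable_add:
      "partially_differentiable (\<lambda>x y p a1 a2 a4. F x y p a1 a2 a4 + G x y p a1 a2 a4) x y p a1 a2 a4"
    and partially_differentiable_mult:
      "partially_differentiable (\<lambda>x y p a1 a2 a4. F x y p a1 a2 a4 * G x y p a1 a2 a4) x y p a1 a2 a4"
    and partially_differentiable_diff:
      "partially_differentiable (\<lambda>x y p a1 a2 a4. F x y p a1 a2 a4 - G x y p a1 a2 a4) x y p a1 a2 a4"
    and X1_diff: "X1 f (\<lambda>x y p a1 a2 a4. F x y p a1 a2 a4 - G x y p a1 a2 a4) x y p a1 a2 a4 =
      X1 f F x y p a1 a2 a4 - X1 f G x y p a1 a2 a4"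
    and X3_diff: "X3 f (\<lambda>x y p a1 a2 a4. F x y p a1 a2 a4 - G x y p a1 a2 a4) x y p a1 a2 a4 =
      X3 f F x y p a1 a2 a4 - X3 f G x y p a1 a2 a4"
    and X5_diff: "X5 (\<lambda>x y p a1 a2 a4. F x y p a1 a2 a4 - G x y p a1 a2 a4) x y p a1 a2 a4 =
      X5 F x y p a1 a2 a4 - X5 G x y p a1 a2 a4"
    and X1_add: "X1 f (\<lambda>x y p a1 a2 a4. F x y p a1 a2 a4 + G x y p a1 a2 a4) x y p a1 a2 a4 =
      X1 f F x y p a1 a2 a4 + X1 f G x y p a1 a2 a4"
    and X3_add: "X3 f (\<lambda>x y p a1 a2 a4. F x y p a1 a2 a4 + G x y p a1 a2 a4) x y p a1 a2 a4 =
      X3 f F x y p a1 a2 a4 + X3 f G x y p a1 a2 a4"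
    and X5_add: "X5 (\<lambda>x y p a1 a2 a4. F x y p a1 a2 a4 + G x y p a1 a2 a4) x y p a1 a2 a4 =
      X5 F x y p a1 a2 a4 + X5 G x y p a1 a2 a4"
    and X1_mult: "X1 f (\<lambda>x y p a1 a2 a4. F x y p a1 a2 a4 * G x y p a1 a2 a4) x y p a1 a2 a4 =
      X1 f F x y p a1 a2 a4 * G x y p a1 a2 a4 + F x y p a1 a2 a4 * X1 f G x y p a1 a2 a4"
    and X3_mult: "X3 f (\<lambda>x y p a1 a2 a4. F x y p a1 a2 a4 * G x y p a1 a2 a4) x y p a1 a2 a4 =
      X3 f F x y p a1 a2 a4 * G x y p a1 a2 a4 + F x y p a1 a2 a4 * X3 f G x y p a1 a2 a4"
    and X5_mult: "X5 (\<lambda>x y p a1 a2 a4. F x y p a1 a2 a4 * G x y p a1 a2 a4) x y p a1 a2 a4 =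
      X5 F x y p a1 a2 a4 * G x y p a1 a2 a4 + F x y p a1 a2 a4 * X5 G x y p a1 a2 a4"
  using assms
  by (simp_all add: partially_differentiable_def X1_def X3_def X5_def field_differentiable_add
      field_differentiable_mult field_differentiable_diff deriv_mult deriv_add deriv_diff
      algebra_simps add_divide_distrib diff_divide_distrib)

text \<open>
  Invariants have poles at \<open>a1 = 0\<close> and \<open>a4 = 0\<close>, so equations between them hold off these loci
  only. As what remains over an open set \<open>U\<close> is open, the vector fields respect this relation.
\<close>

definition bundle_eq :: "(complex \<times> complex \<times> complex) set \<Rightarrow> bundle_fun \<Rightarrow> bundle_fun \<Rightarrow> bool" where
  "bundle_eq U F G \<longleftrightarrow> (\<forall>x y p a1 a2 a4. (x, y, p) \<in> U \<longrightarrow> a1 \<noteq> 0 \<longrightarrow> a4 \<noteq> 0 \<longrightarrow>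
     F x y p a1 a2 a4 = G x y p a1 a2 a4)"

lemma bundle_eq_cong:
  assumes U: "open U" and eq: "bundle_eq U F G"
    and z: "(x, y, p) \<in> U" "a1 \<noteq> 0" "a4 \<noteq> 0"
  shows "X1 f F x y p a1 a2 a4 = X1 f G x y p a1 a2 a4"
    and "X3 f F x y p a1 a2 a4 = X3 f G x y p a1 a2 a4"
    and "X5 F x y p a1 a2 a4 = X5 G x y p a1 a2 a4"
    and "partially_differentiable G x y p a1 a2 a4 \<Longrightarrow> partially_differentiable F x y p a1 a2 a4"
proof -
  note sl = eventually_slices3[OF U z(1)]
  have nz: "\<forall>\<^sub>F t in nhds a1. t \<noteq> 0" "\<forall>\<^sub>F t in nhds a4. t \<noteq> 0"
    using z by (auto intro!: t1_space_nhds)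
  have ev:
    "\<forall>\<^sub>F t in nhds x. F t y p a1 a2 a4 = G t y p a1 a2 a4"
    "\<forall>\<^sub>F t in nhds y. F x t p a1 a2 a4 = G x t p a1 a2 a4"
    "\<forall>\<^sub>F t in nhds p. F x y t a1 a2 a4 = G x y t a1 a2 a4"
    "\<forall>\<^sub>F t in nhds a1. F x y p t a2 a4 = G x y p t a2 a4"
    "\<forall>\<^sub>F t in nhds a2. F x y p a1 t a4 = G x y p a1 t a4"
    "\<forall>\<^sub>F t in nhds a4. F x y p a1 a2 t = G x y p a1 a2 t"
    using eq z unfolding bundle_eq_def
    by (auto intro: eventually_mono[OF sl(1)] eventually_mono[OF sl(2)] eventually_mono[OF sl(3)]
      eventually_mono[OF nz(1)] eventually_mono[OF nz(2)])
  note d = ev[THEN deriv_cong_ev, OF refl]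
  show "X1 f F x y p a1 a2 a4 = X1 f G x y p a1 a2 a4"
    and "X3 f F x y p a1 a2 a4 = X3 f G x y p a1 a2 a4"
    and "X5 F x y p a1 a2 a4 = X5 G x y p a1 a2 a4"
    unfolding X1_def X3_def X5_def d by simp_all
  show "partially_differentiable G x y p a1 a2 a4 \<Longrightarrow> partially_differentiable F x y p a1 a2 a4"
    unfolding partially_differentiable_def field_differentiable_def
    using ev[THEN DERIV_cong_ev[OF refl _ refl]] by simp
qed

section \<open>Equations of second degree in the derivative\<close>

text \<open>
  The shape of the equation on the branch: \<open>I3 = 0\<close> says that \<open>f\<close> is of second degree in \<open>p\<close>, and
  \<open>I2 = 0\<close> is then the relation \<open>B_y = 2 C_x\<close>, which is added in the locale \<open>quadratic_ode\<close>.
\<close>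

locale quadratic_in_p = open_plane_set W for W +
  fixes U :: "(complex \<times> complex \<times> complex) set"
    and f :: "complex \<Rightarrow> complex \<Rightarrow> complex \<Rightarrow> complex"
    and A B C :: "complex \<Rightarrow> complex \<Rightarrow> complex"
  assumes open_U: "open U"
    and U_W: "(x, y, p) \<in> U \<Longrightarrow> (x, y) \<in> W"
    and f_eq: "(x, y, p) \<in> U \<Longrightarrow> f x y p = A x y + B x y * p + C x y * p ^ 2"
    and analytic_ABC [simp, intro]: "analytic A" "analytic B" "analytic C"
begin

lemma jet_partials:
  assumes "(x, y) \<in> W" "analytic a" "analytic b" "analytic c"
  shows "Px (\<lambda>x y p. a x y + b x y * p + c x y * p ^ 2) x y p = px a x y + px b x y * p + px c x y * p ^ 2"
    and "Py (\<lambda>x y p. a x y + b x y * p + c x y * p ^ 2) x y p = py a x y + py b x y * p + py c x y * p ^ 2"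
    and "Pp (\<lambda>x y p. a x y + b x y * p + c x y * p ^ 2) x y p = b x y + 2 * c x y * p"
proof -
  have "Px (\<lambda>x y p. a x y + b x y * p + c x y * p ^ 2) x y p =
      px (\<lambda>x y. a x y + b x y * p + c x y * p ^ 2) x y" by (simp add: Px_def px_def)
  thus "Px (\<lambda>x y p. a x y + b x y * p + c x y * p ^ 2) x y p = px a x y + px b x y * p + px c x y * p ^ 2"
    using assms by (simp add: partial_rules)
  have "Py (\<lambda>x y p. a x y + b x y * p + c x y * p ^ 2) x y p =
      py (\<lambda>x y. a x y + b x y * p + c x y * p ^ 2) x y" by (simp add: Py_def py_def)
  thus "Py (\<lambda>x y p. a x y + b x y * p + c x y * p ^ 2) x y p = py a x y + py b x y * p + py c x y * p ^ 2"
    using assms by (simp add: partial_rules)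
  show "Pp (\<lambda>x y p. a x y + b x y * p + c x y * p ^ 2) x y p = b x y + 2 * c x y * p"
    unfolding Pp_def by (rule DERIV_imp_deriv) (auto intro!: derivative_eq_intros)
qed

lemma jet_partials_eq:
  assumes "(x, y, p) \<in> U" "analytic a" "analytic b" "analytic c"
    and "\<And>x y p. (x, y, p) \<in> U \<Longrightarrow> h x y p = a x y + b x y * p + c x y * p ^ 2"
  shows "Px h x y p = px a x y + px b x y * p + px c x y * p ^ 2"
    and "Py h x y p = py a x y + py b x y * p + py c x y * p ^ 2"
    and "Pp h x y p = b x y + 2 * c x y * p"
  using jet_partials_cong[OF open_U assms(1) assms(5)] jet_partials[OF U_W[OF assms(1)] assms(2-4)]
  by simp_all

lemma f_partials:
  assumes "(x, y, p) \<in> U"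
  shows "Py f x y p = py A x y + py B x y * p + py C x y * p ^ 2"
    and "Pp f x y p = B x y + 2 * C x y * p"
    and "Pp (Pp f) x y p = 2 * C x y"
    and "Py (Pp f) x y p = py B x y + 2 * py C x y * p"
    and "Pp (Py f) x y p = py B x y + 2 * py C x y * p"
    and "Py (Py f) x y p = py (py A) x y + py (py B) x y * p + py (py C) x y * p ^ 2"
    and "Pp (Pp (Pp f)) x y p = 0"
    and "Dx f (Pp (Pp f)) x y p = 2 * px C x y + 2 * p * py C x y"
    and "Dx f (Pp (Py f)) x y p = px (py B) x y + 2 * p * px (py C) x y
      + p * (py (py B) x y + 2 * p * py (py C) x y) + f x y p * (2 * py C x y)"
proof -
  note f = jet_partials_eq[of _ _ _ A B C f, OF _ _ _ _ f_eq, simplified]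
  have fy: "Py f x y p = py A x y + py B x y * p + py C x y * p ^ 2" if "(x, y, p) \<in> U" for x y p
    using f(2)[OF that] .
  have fp: "Pp f x y p = B x y + 2 * C x y * p + 0 * p ^ 2" if "(x, y, p) \<in> U" for x y p
    using f(3)[OF that] by simp
  note fy' = jet_partials_eq[of _ _ _ "py A" "py B" "py C", OF _ _ _ _ fy, simplified]
  note fp' = jet_partials_eq[of _ _ _ "B" "\<lambda>x y. 2 * C x y" "\<lambda>x y. 0", OF _ _ _ _ fp, simplified]
  have two: "px (\<lambda>x y. 2 * c x y) x y = 2 * px c x y" "py (\<lambda>x y. 2 * c x y) x y = 2 * py c x y"
    if "analytic c" "(x, y) \<in> W" for c x y
    using that by (simp_all add: partial_rules)
  have fpp: "Pp (Pp f) x y p = 2 * C x y + 0 * p + 0 * p ^ 2" if "(x, y, p) \<in> U" for x y p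
    using fp'(3)[OF that] by simp
  note fpp' = jet_partials_eq[of _ _ _ "\<lambda>x y. 2 * C x y" "\<lambda>x y. 0" "\<lambda>x y. 0", OF _ _ _ _ fpp, simplified]
  have fyp: "Pp (Py f) x y p = py B x y + 2 * py C x y * p + 0 * p ^ 2" if "(x, y, p) \<in> U" for x y p
    using fy'(3)[OF that] by simp
  note fyp' = jet_partials_eq[of _ _ _ "py B" "\<lambda>x y. 2 * py C x y" "\<lambda>x y. 0", OF _ _ _ _ fyp, simplified]
  show "Py f x y p = py A x y + py B x y * p + py C x y * p ^ 2"
    "Pp f x y p = B x y + 2 * C x y * p"
    "Pp (Pp f) x y p = 2 * C x y"
    "Pp (Py f) x y p = py B x y + 2 * py C x y * p"
    "Py (Py f) x y p = py (py A) x y + py (py B) x y * p + py (py C) x y * p ^ 2"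
    "Pp (Pp (Pp f)) x y p = 0"
    using fy[OF assms] fp[OF assms] fpp[OF assms] fyp[OF assms] fy'(2)[OF assms] fpp'(3)[OF assms] by simp_all
  show "Py (Pp f) x y p = py B x y + 2 * py C x y * p"
    using fp'(2)[OF assms] two U_W[OF assms] by simp
  show "Dx f (Pp (Pp f)) x y p = 2 * px C x y + 2 * p * py C x y"
    using fpp'[OF assms] two U_W[OF assms] by (simp add: Dx_def)
  show "Dx f (Pp (Py f)) x y p = px (py B) x y + 2 * p * px (py C) x y
      + p * (py (py B) x y + 2 * p * py (py C) x y) + f x y p * (2 * py C x y)"
    using fyp'[OF assms] two U_W[OF assms] by (simp add: Dx_def algebra_simps)
qed

end

locale quadratic_ode = quadratic_in_p +
  assumes branch: "(x, y) \<in> W \<Longrightarrow> py B x y = 2 * px C x y"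
begin

text \<open>
  The relative invariants, functions of \<open>(x, y)\<close> of which the numerators of all invariants are
  made. For \<open>B = C = 0\<close> one has \<open>\<Psi> = A_y\<close>; then \<open>k\<close>, \<open>u\<close>, \<open>v\<close>, \<open>w\<close> are the successive derivatives
  of \<open>\<Psi>\<close> along \<open>y\<close>, and \<open>\<kappa>\<close>, \<open>\<kappa>'\<close>, \<open>\<mu>\<close>, \<open>\<mu>'\<close>, \<open>\<nu>\<close> are \<open>k_x\<close>, \<open>k_xx\<close>, \<open>u_x\<close>, \<open>u_xx\<close>, \<open>v_x\<close>. In
  general the terms with \<open>B\<close> and \<open>C\<close> replace the partial derivatives by covariant ones, with
  multiples that depend on the weight.
\<close>

definition "\<Psi> = (\<lambda>x y. py A x y + B x y ^ 2 / 4 - px B x y / 2 - A x y * C x y)"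
definition "k = py \<Psi>"
definition "u = (\<lambda>x y. py k x y + C x y * k x y)"
definition "v = (\<lambda>x y. py u x y + 2 * C x y * u x y)"
definition "w = (\<lambda>x y. py v x y + 3 * C x y * v x y)"
definition "\<kappa> = (\<lambda>x y. px k x y + B x y * k x y / 2)"
definition "\<kappa>' = (\<lambda>x y. px \<kappa> x y + B x y * \<kappa> x y / 2)"
definition "\<mu> = (\<lambda>x y. px u x y + B x y * u x y)"
definition "\<mu>' = (\<lambda>x y. px \<mu> x y + B x y * \<mu> x y)"
definition "\<nu> = (\<lambda>x y. px v x y + 3 / 2 * B x y * v x y)"

lemma analytic_coeffs [simp, intro]:
  "analytic \<Psi>" "analytic k" "analytic u" "analytic v" "analytic w" "analytic \<kappa>" "analytic \<kappa>'"
  "analytic \<mu>" "analytic \<mu>'" "analytic \<nu>"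
proof -
  show 1: "analytic \<Psi>" unfolding \<Psi>_def by simp
  show 2: "analytic k" unfolding k_def using 1 by simp
  show 3: "analytic u" unfolding u_def using 2 by simp
  show 4: "analytic v" unfolding v_def using 3 by simp
  show 5: "analytic w" unfolding w_def using 4 by simp
  show 6: "analytic \<kappa>" unfolding \<kappa>_def using 2 by simp
  show "analytic \<kappa>'" unfolding \<kappa>'_def using 6 by simp
  show 7: "analytic \<mu>" unfolding \<mu>_def using 3 by simp
  show "analytic \<mu>'" unfolding \<mu>'_def using 7 by simp
  show "analytic \<nu>" unfolding \<nu>_def using 4 by simp
qed

lemma x_partials:
  "px k x y = \<kappa> x y - B x y * k x y / 2" "px u x y = \<mu> x y - B x y * u x y"
  "px v x y = \<nu> x y - 3 / 2 * B x y * v x y" "px \<kappa> x y = \<kappa>' x y - B x y * \<kappa> x y / 2"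
  "px \<mu> x y = \<mu>' x y - B x y * \<mu> x y"
  by (simp_all add: \<kappa>_def \<mu>_def \<nu>_def \<kappa>'_def \<mu>'_def)

lemma y_partials:
  "py \<Psi> x y = k x y" "py k x y = u x y - C x y * k x y" "py u x y = v x y - 2 * C x y * u x y"
  "py v x y = w x y - 3 * C x y * v x y"
  "py A x y = \<Psi> x y - B x y ^ 2 / 4 + px B x y / 2 + A x y * C x y"
  by (simp_all add: u_def v_def w_def \<Psi>_def k_def)

lemma py_px_rules:
  assumes xy: "(x, y) \<in> W"
  shows "py (px k) x y = px u x y - px C x y * k x y - C x y * px k x y"
    and "py (px u) x y = px v x y - 2 * px C x y * u x y - 2 * C x y * px u x y"
proof -
  have "py (px k) x y = px (py k) x y" by (rule py_px) (simp_all add: xy)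
  also have "py k = (\<lambda>x y. u x y - C x y * k x y)" by (simp add: fun_eq_iff y_partials)
  also have "px (\<lambda>x y. u x y - C x y * k x y) x y = px u x y - px C x y * k x y - C x y * px k x y"
    using xy by (simp add: partial_rules)
  finally show "py (px k) x y = px u x y - px C x y * k x y - C x y * px k x y" .
  have "py (px u) x y = px (py u) x y" by (rule py_px) (simp_all add: xy)
  also have "py u = (\<lambda>x y. v x y - 2 * C x y * u x y)" by (simp add: fun_eq_iff y_partials)
  also have "px (\<lambda>x y. v x y - 2 * C x y * u x y) x y = px v x y - 2 * px C x y * u x y - 2 * C x y * px u x y"
    using xy by (simp add: partial_rules)
  finally show "py (px u) x y = px v x y - 2 * px C x y * u x y - 2 * C x y * px u x y" .
qed

text \<open>
  The covariant derivatives along \<open>x\<close> and \<open>y\<close> commute up to multiples of \<open>B\<close> and its derivatives;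
  this rests on \<open>B_y = 2 C_x\<close>.
\<close>

lemma mixed_partials:
  assumes xy: "(x, y) \<in> W"
  shows "py \<kappa> x y = \<mu> x y - B x y * u x y / 2 - C x y * \<kappa> x y"
    and "py \<mu> x y = \<nu> x y - B x y * v x y / 2 - 2 * C x y * \<mu> x y"
    and "py \<kappa>' x y = \<mu>' x y - B x y * \<mu> x y - (px B x y / 2 - B x y ^ 2 / 4) * u x y - C x y * \<kappa>' x y"
proof -
  have \<kappa>: "py \<kappa> x y = \<mu> x y - B x y * u x y / 2 - C x y * \<kappa> x y" if xy: "(x, y) \<in> W" for x y
    unfolding \<kappa>_def using xy
    by (simp add: partial_rules py_px_rules branch) (simp add: x_partials y_partials field_simps)
  show "py \<kappa> x y = \<mu> x y - B x y * u x y / 2 - C x y * \<kappa> x y" by (rule \<kappa>[OF xy])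
  show "py \<mu> x y = \<nu> x y - B x y * v x y / 2 - 2 * C x y * \<mu> x y"
    unfolding \<mu>_def using xy
    by (simp add: partial_rules py_px_rules branch) (simp add: x_partials y_partials field_simps)
  have "py (px \<kappa>) x y = px (py \<kappa>) x y" by (rule py_px) (simp_all add: xy)
  also have "\<dots> = px (\<lambda>x y. \<mu> x y - B x y * u x y / 2 - C x y * \<kappa> x y) x y"
    by (rule partials_cong[OF open_W xy \<kappa>])
  finally have "py (px \<kappa>) x y = px \<mu> x y - (px B x y * u x y + B x y * px u x y) / 2
      - (px C x y * \<kappa> x y + C x y * px \<kappa> x y)"
    using xy px_mult[of "\<lambda>x y. B x y * u x y" "\<lambda>x y. 1/2" x y] by (simp add: partial_rules)
  thus "py \<kappa>' x y = \<mu>' x y - B x y * \<mu> x y - (px B x y / 2 - B x y ^ 2 / 4) * u x y - C x y * \<kappa>' x y"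
    unfolding \<kappa>'_def using xy py_mult[of "\<lambda>x y. B x y * \<kappa> x y" "\<lambda>x y. 1/2" x y]
    by (simp add: partial_rules \<kappa> branch) (simp add: x_partials field_simps power2_eq_square)
qed

lemma painleve_branch_f: "painleve_branch f U"
  unfolding painleve_branch_def I2_def I3_def
  using f_partials(5,7,8) branch[OF U_W] by auto

text \<open>
  The coefficient of \<open>a2\<close> in the numerator of \<open>I1\<close> is a multiple of the numerator of \<open>I2\<close> and
  vanishes. The coefficient of \<open>a1\<close> is \<open>2 k\<close>: its terms with \<open>p\<close> and \<open>p^2\<close> cancel because of
  \<open>B_y = 2 C_x\<close>.
\<close>

lemma I1_eq:
  assumes z: "(x, y, p) \<in> U" and "a1 \<noteq> 0" "a4 \<noteq> 0"
  shows "I1 f x y p a1 a2 a4 = k x y / (a1 * a4 ^ 2)"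
proof -
  note xy = U_W[OF z]
  have B: "py B x y = 2 * px C x y" if "(x, y) \<in> W" for x y using branch[OF that] .
  have pyB: "px (py B) x y = 2 * px (px C) x y" "py (py B) x y = 2 * px (py C) x y"
    using partials_cong[OF open_W xy branch] px_mult[OF analytic2_on_const[of 2 W] analytic_px xy]
      py_mult[OF analytic2_on_const[of 2 W] analytic_px xy] py_px[OF analytic_ABC(3) xy] by simp_all
  have "py (px B) x y = px (py B) x y" by (rule py_px) (simp_all add: xy)
  moreover have "py (\<lambda>x y. B x y ^ 2 / 4) x y = B x y * py B x y / 2"
    using py_mult[of "\<lambda>x y. B x y ^ 2" "\<lambda>x y. 1/4" x y] xy by (simp add: partial_rules)
  moreover have "py (\<lambda>x y. px B x y / 2) x y = py (px B) x y / 2"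
    using py_mult[of "\<lambda>x y. px B x y" "\<lambda>x y. 1/2" x y] xy by (simp add: partial_rules)
  ultimately have k: "2 * k x y = 2 * py (py A) x y + B x y * py B x y - px (py B) x y
      - 2 * py A x y * C x y - 2 * A x y * py C x y"
    unfolding k_def \<Psi>_def using xy by (simp add: partial_rules algebra_simps)
  have "2 * Py (Py f) x y p - Dx f (Pp (Py f)) x y p - Pp (Pp f) x y p * Py f x y p
         + Pp (Py f) x y p * Pp f x y p = 2 * k x y"
    unfolding k using f_partials[OF z] f_eq[OF z] branch[OF xy] pyB
    by (simp add: algebra_simps power2_eq_square)
  moreover have "- Pp (Py f) x y p + Dx f (Pp (Pp f)) x y p = 0"
    using f_partials[OF z] branch[OF xy] by simp
  ultimately show ?thesis
    unfolding I1_def using assms by (simp add: field_simps power2_eq_square)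
qed

end

section \<open>The commutator of the invariant derivations\<close>

context quadratic_ode
begin

text \<open>
  The coordinate that replaces \<open>a2\<close>: it equals \<open>a2 a4 / a1 + f_p / 2\<close>. It is constant along \<open>X1\<close>,
  and along \<open>X3\<close> it satisfies a Riccati equation with coefficient \<open>\<Psi>\<close> (see \<open>generator_rules\<close>).
\<close>

definition \<sigma> :: bundle_fun where
  "\<sigma> x y p a1 a2 a4 = a2 * a4 / a1 + (B x y + 2 * C x y * p) / 2"

text \<open>
  With the inverses of \<open>a1\<close> and \<open>a4\<close> as generators all derivatives of generators are polynomials.
\<close>

definition \<iota>1 :: bundle_fun where "\<iota>1 x y p a1 a2 a4 = 1 / a1"
definition \<iota>4 :: bundle_fun where "\<iota>4 x y p a1 a2 a4 = 1 / a4"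

text \<open>
  A class that contains \<open>I1\<close>, is closed under \<open>X1\<close> and \<open>X3\<close>, and on which identities between
  derivations can be checked on generators. The last clause admits the derivatives themselves,
  which agree with polynomials in the generators over \<open>U\<close> only.
\<close>

inductive generated :: "bundle_fun \<Rightarrow> bool" where
  coefficient: "analytic c \<Longrightarrow> generated (\<lambda>x y p a1 a2 a4. c x y)"
| jet_coordinate: "generated (\<lambda>x y p a1 a2 a4. p)"
| sigma: "generated \<sigma>"
| inverse_a1: "generated \<iota>1"
| inverse_a4: "generated \<iota>4"
| add: "generated F \<Longrightarrow> generated G \<Longrightarrow>
    generated (\<lambda>x y p a1 a2 a4. F x y p a1 a2 a4 + G x y p a1 a2 a4)"
| mult: "generated F \<Longrightarrow> generated G \<Longrightarrow>
    generated (\<lambda>x y p a1 a2 a4. F x y p a1 a2 a4 * G x y p a1 a2 a4)"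
| agree: "generated F \<Longrightarrow> bundle_eq U G F \<Longrightarrow> generated G"

context
  fixes x y p a1 a2 a4 :: complex
  assumes z: "(x, y, p) \<in> U" "a1 \<noteq> 0" "a4 \<noteq> 0"
begin

lemma sigma_partials:
  "((\<lambda>t. \<sigma> t y p a1 a2 a4) has_field_derivative (px B x y + 2 * px C x y * p) / 2) (at x)"
  "((\<lambda>t. \<sigma> x t p a1 a2 a4) has_field_derivative (py B x y + 2 * py C x y * p) / 2) (at y)"
  "((\<lambda>t. \<sigma> x y t a1 a2 a4) has_field_derivative C x y) (at p)"
  "((\<lambda>t. \<sigma> x y p t a2 a4) has_field_derivative - a2 * a4 / a1 ^ 2) (at a1)"
  "((\<lambda>t. \<sigma> x y p a1 t a4) has_field_derivative a4 / a1) (at a2)"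
  "((\<lambda>t. \<sigma> x y p a1 a2 t) has_field_derivative a2 / a1) (at a4)"
proof -
  note xy = U_W[OF z(1)]
  note Bd = analytic2_on_partials[OF analytic_ABC(2) xy] and Cd = analytic2_on_partials[OF analytic_ABC(3) xy]
  have "((\<lambda>t. a2 * a4 / a1 + (B t y + 2 * C t y * p) / 2) has_field_derivative
      0 + (px B x y + 2 * px C x y * p) / 2) (at x)"
    by (intro DERIV_add DERIV_cdivide DERIV_cmult_right DERIV_cmult DERIV_const Bd Cd)
  thus "((\<lambda>t. \<sigma> t y p a1 a2 a4) has_field_derivative (px B x y + 2 * px C x y * p) / 2) (at x)"
    by (simp add: \<sigma>_def)
  have "((\<lambda>t. a2 * a4 / a1 + (B x t + 2 * C x t * p) / 2) has_field_derivative
      0 + (py B x y + 2 * py C x y * p) / 2) (at y)"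
    by (intro DERIV_add DERIV_cdivide DERIV_cmult_right DERIV_cmult DERIV_const Bd Cd)
  thus "((\<lambda>t. \<sigma> x t p a1 a2 a4) has_field_derivative (py B x y + 2 * py C x y * p) / 2) (at y)"
    by (simp add: \<sigma>_def)
  show "((\<lambda>t. \<sigma> x y t a1 a2 a4) has_field_derivative C x y) (at p)"
    "((\<lambda>t. \<sigma> x y p t a2 a4) has_field_derivative - a2 * a4 / a1 ^ 2) (at a1)"
    "((\<lambda>t. \<sigma> x y p a1 t a4) has_field_derivative a4 / a1) (at a2)"
    "((\<lambda>t. \<sigma> x y p a1 a2 t) has_field_derivative a2 / a1) (at a4)"
    unfolding \<sigma>_def using z
    by (auto intro!: derivative_eq_intros simp: power2_eq_square)
qed

lemma generator_rules:
  "X1 f (\<lambda>x y p a1 a2 a4. c x y) x y p a1 a2 a4 = \<iota>1 x y p a1 a2 a4 * py c x y"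
  "X3 f (\<lambda>x y p a1 a2 a4. c x y) x y p a1 a2 a4 = \<iota>4 x y p a1 a2 a4 * (px c x y + p * py c x y)"
  "X5 (\<lambda>x y p a1 a2 a4. c x y) x y p a1 a2 a4 = 0"
  "X1 f (\<lambda>x y p a1 a2 a4. p) x y p a1 a2 a4 =
     \<iota>1 x y p a1 a2 a4 * (B x y / 2 + C x y * p - \<sigma> x y p a1 a2 a4)"
  "X3 f (\<lambda>x y p a1 a2 a4. p) x y p a1 a2 a4 =
     \<iota>4 x y p a1 a2 a4 * (A x y + B x y * p + C x y * (p * p))"
  "X5 (\<lambda>x y p a1 a2 a4. p) x y p a1 a2 a4 = 0"
  "X1 f \<iota>1 x y p a1 a2 a4 = \<iota>1 x y p a1 a2 a4 * \<iota>1 x y p a1 a2 a4 * C x y"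
  "X3 f \<iota>1 x y p a1 a2 a4 =
     \<iota>1 x y p a1 a2 a4 * \<iota>4 x y p a1 a2 a4 * (B x y / 2 + C x y * p - \<sigma> x y p a1 a2 a4)"
  "X5 \<iota>1 x y p a1 a2 a4 = 0"
  "X1 f \<iota>4 x y p a1 a2 a4 = 0"
  "X3 f \<iota>4 x y p a1 a2 a4 = \<iota>4 x y p a1 a2 a4 * \<iota>4 x y p a1 a2 a4 * (- 2 * \<sigma> x y p a1 a2 a4)"
  "X5 \<iota>4 x y p a1 a2 a4 = 0"
  "X1 f \<sigma> x y p a1 a2 a4 = 0"
  "X3 f \<sigma> x y p a1 a2 a4 = \<iota>4 x y p a1 a2 a4 * (\<sigma> x y p a1 a2 a4 * \<sigma> x y p a1 a2 a4 - \<Psi> x y)"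
  "X5 \<sigma> x y p a1 a2 a4 = a4"
proof -
  note d = sigma_partials[THEN DERIV_imp_deriv] and r = \<iota>1_def \<iota>4_def
  show "X1 f (\<lambda>x y p a1 a2 a4. c x y) x y p a1 a2 a4 = \<iota>1 x y p a1 a2 a4 * py c x y"
    "X3 f (\<lambda>x y p a1 a2 a4. c x y) x y p a1 a2 a4 = \<iota>4 x y p a1 a2 a4 * (px c x y + p * py c x y)"
    "X5 (\<lambda>x y p a1 a2 a4. c x y) x y p a1 a2 a4 = 0"
    "X5 (\<lambda>x y p a1 a2 a4. p) x y p a1 a2 a4 = 0"
    "X5 \<iota>1 x y p a1 a2 a4 = 0"
    "X5 \<iota>4 x y p a1 a2 a4 = 0"
    "X1 f \<iota>4 x y p a1 a2 a4 = 0"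
    by (simp_all add: X1_def X3_def X5_def px_def py_def r add_divide_distrib)
  show "X1 f (\<lambda>x y p a1 a2 a4. p) x y p a1 a2 a4 =
     \<iota>1 x y p a1 a2 a4 * (B x y / 2 + C x y * p - \<sigma> x y p a1 a2 a4)"
    "X3 f (\<lambda>x y p a1 a2 a4. p) x y p a1 a2 a4 =
     \<iota>4 x y p a1 a2 a4 * (A x y + B x y * p + C x y * (p * p))"
    using z by (simp_all add: X1_def X3_def \<sigma>_def r f_eq field_simps power2_eq_square)
  show "X1 f \<iota>1 x y p a1 a2 a4 = \<iota>1 x y p a1 a2 a4 * \<iota>1 x y p a1 a2 a4 * C x y"
    "X3 f \<iota>1 x y p a1 a2 a4 =
     \<iota>1 x y p a1 a2 a4 * \<iota>4 x y p a1 a2 a4 * (B x y / 2 + C x y * p - \<sigma> x y p a1 a2 a4)"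
    "X3 f \<iota>4 x y p a1 a2 a4 = \<iota>4 x y p a1 a2 a4 * \<iota>4 x y p a1 a2 a4 * (- 2 * \<sigma> x y p a1 a2 a4)"
    using z by (simp_all add: X1_def X3_def \<sigma>_def r f_partials[OF z(1)] field_simps power2_eq_square)
  show "X5 \<sigma> x y p a1 a2 a4 = a4"
    using z by (simp add: X5_def d)
  show "X1 f \<sigma> x y p a1 a2 a4 = 0"
    using z by (simp add: X1_def d f_partials[OF z(1)] field_simps power2_eq_square)
  show "X3 f \<sigma> x y p a1 a2 a4 = \<iota>4 x y p a1 a2 a4 * (\<sigma> x y p a1 a2 a4 * \<sigma> x y p a1 a2 a4 - \<Psi> x y)"
    unfolding X3_def d f_partials[OF z(1)] f_eq[OF z(1)] using z branch[OF U_W[OF z(1)]]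
    by (simp add: \<sigma>_def r \<Psi>_def field_simps power2_eq_square)
qed

lemma generated_partially_differentiable:
  "generated F \<Longrightarrow> partially_differentiable F x y p a1 a2 a4"
proof (induction rule: generated.induct)
  case (coefficient c)
  from analytic2_on_partials[OF this U_W[OF z(1)]] show ?case
    by (auto simp: partially_differentiable_def field_differentiable_def intro: DERIV_const)
next
  case sigma
  from sigma_partials show ?case
    by (auto simp: partially_differentiable_def field_differentiable_def)
next
  case (agree F G)
  thus ?case using bundle_eq_cong(4)[OF open_U agree(2) z] by blast
next
  case inverse_a1
  show ?case unfolding partially_differentiable_def \<iota>1_def \<iota>4_def using z
    by (auto intro!: derivative_intros)
next
  case inverse_a4
  show ?case unfolding partially_differentiable_def \<iota>1_def \<iota>4_def using z
    by (auto intro!: derivative_intros)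
qed (auto simp: partially_differentiable_def[of "\<lambda>x y p a1 a2 a4. p"]
  intro: partially_differentiable_add partially_differentiable_mult)

lemmas sum_product_rules =
  X1_diff[OF generated_partially_differentiable generated_partially_differentiable]
  X3_diff[OF generated_partially_differentiable generated_partially_differentiable]
  X5_diff[OF generated_partially_differentiable generated_partially_differentiable]
  X1_add[OF generated_partially_differentiable generated_partially_differentiable]
  X3_add[OF generated_partially_differentiable generated_partially_differentiable]
  X5_add[OF generated_partially_differentiable generated_partially_differentiable]
  X1_mult[OF generated_partially_differentiable generated_partially_differentiable]
  X3_mult[OF generated_partially_differentiable generated_partially_differentiable]
  X5_mult[OF generated_partially_differentiable generated_partially_differentiable]

end

lemma generated_diff:
  assumes "generated F" "generated G"
  shows "generated (\<lambda>x y p a1 a2 a4. F x y p a1 a2 a4 - G x y p a1 a2 a4)"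
  using generated.add[OF assms(1) generated.mult[OF generated.coefficient assms(2)], of "\<lambda>x y. - 1"]
  by simp

lemma generated_uminus: "generated F \<Longrightarrow> generated (\<lambda>x y p a1 a2 a4. - F x y p a1 a2 a4)"
  using generated_diff[OF generated.coefficient[OF analytic2_on_const[of 0 W]], of F] by simp

lemma uminus_rules:
  assumes "generated F" "(x, y, p) \<in> U" "a1 \<noteq> 0" "a4 \<noteq> 0"
  shows "X1 f (\<lambda>x y p a1 a2 a4. - F x y p a1 a2 a4) x y p a1 a2 a4 = - X1 f F x y p a1 a2 a4"
    and "X3 f (\<lambda>x y p a1 a2 a4. - F x y p a1 a2 a4) x y p a1 a2 a4 = - X3 f F x y p a1 a2 a4"
    and "X5 (\<lambda>x y p a1 a2 a4. - F x y p a1 a2 a4) x y p a1 a2 a4 = - X5 F x y p a1 a2 a4"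
  using sum_product_rules(1-3)[OF assms(2-4) generated.coefficient[OF analytic2_on_const[of 0 W]] assms(1)]
    generator_rules(1-3)[OF assms(2-4), of "\<lambda>x y. 0"] by simp_all

lemmas X_rules = uminus_rules sum_product_rules generator_rules
lemmas generated_rules = generated_uminus generated_diff generated.coefficient
  generated.jet_coordinate generated.sigma
  generated.inverse_a1 generated.inverse_a4 generated.add generated.mult

lemma generator_bundle_eq:
  shows "bundle_eq U (X1 f (\<lambda>x y p a1 a2 a4. c x y)) (\<lambda>x y p a1 a2 a4. \<iota>1 x y p a1 a2 a4 * py c x y)"
    and "bundle_eq U (X3 f (\<lambda>x y p a1 a2 a4. c x y)) (\<lambda>x y p a1 a2 a4.
      \<iota>4 x y p a1 a2 a4 * (px c x y + p * py c x y))"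
    and "bundle_eq U (X1 f (\<lambda>x y p a1 a2 a4. p)) (\<lambda>x y p a1 a2 a4. \<iota>1 x y p a1 a2 a4 * (B x y / 2 + C x y * p - \<sigma> x y p a1 a2 a4))"
    and "bundle_eq U (X3 f (\<lambda>x y p a1 a2 a4. p)) (\<lambda>x y p a1 a2 a4.
      \<iota>4 x y p a1 a2 a4 * (A x y + B x y * p + C x y * (p * p)))"
    and "bundle_eq U (X1 f \<iota>1) (\<lambda>x y p a1 a2 a4. \<iota>1 x y p a1 a2 a4 * \<iota>1 x y p a1 a2 a4 * C x y)"
    and "bundle_eq U (X3 f \<iota>1) (\<lambda>x y p a1 a2 a4.
      \<iota>1 x y p a1 a2 a4 * \<iota>4 x y p a1 a2 a4 * (B x y / 2 + C x y * p - \<sigma> x y p a1 a2 a4))"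
    and "bundle_eq U (X1 f \<iota>4) (\<lambda>x y p a1 a2 a4. 0)"
    and "bundle_eq U (X3 f \<iota>4) (\<lambda>x y p a1 a2 a4.
      \<iota>4 x y p a1 a2 a4 * \<iota>4 x y p a1 a2 a4 * (- 2 * \<sigma> x y p a1 a2 a4))"
    and "bundle_eq U (X1 f \<sigma>) (\<lambda>x y p a1 a2 a4. 0)"
    and "bundle_eq U (X3 f \<sigma>) (\<lambda>x y p a1 a2 a4.
      \<iota>4 x y p a1 a2 a4 * (\<sigma> x y p a1 a2 a4 * \<sigma> x y p a1 a2 a4 - \<Psi> x y))"
  by (simp_all add: bundle_eq_def generator_rules)

lemma generated_X:
  assumes "generated F"
  shows "generated (X1 f F) \<and> generated (X3 f F)"
  using assms
proof (induction rule: generated.induct)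
  case (coefficient c)
  show ?case
    by (intro conjI generated.agree[OF _ generator_bundle_eq(1)] generated.agree[OF _ generator_bundle_eq(2)]
      generated_rules) (simp_all add: coefficient)
next
  case jet_coordinate
  show ?case
    by (intro conjI generated.agree[OF _ generator_bundle_eq(3)] generated.agree[OF _ generator_bundle_eq(4)]
      generated_rules) (simp_all)
next
  case inverse_a1
  show ?case
    by (intro conjI generated.agree[OF _ generator_bundle_eq(5)] generated.agree[OF _ generator_bundle_eq(6)]
      generated_rules) (simp_all)
next
  case inverse_a4
  show ?case
    by (intro conjI generated.agree[OF _ generator_bundle_eq(7)] generated.agree[OF _ generator_bundle_eq(8)]
      generated_rules) (simp_all)
next
  case sigma
  show ?case
    by (intro conjI generated.agree[OF _ generator_bundle_eq(9)] generated.agree[OF _ generator_bundle_eq(10)]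
      generated_rules) (simp_all)
next
  case (add F G)
  have "bundle_eq U (X1 f (\<lambda>x y p a1 a2 a4. F x y p a1 a2 a4 + G x y p a1 a2 a4))
      (\<lambda>x y p a1 a2 a4. X1 f F x y p a1 a2 a4 + X1 f G x y p a1 a2 a4)"
    "bundle_eq U (X3 f (\<lambda>x y p a1 a2 a4. F x y p a1 a2 a4 + G x y p a1 a2 a4))
      (\<lambda>x y p a1 a2 a4. X3 f F x y p a1 a2 a4 + X3 f G x y p a1 a2 a4)"
    using add.hyps by (simp_all add: bundle_eq_def X_rules)
  note e = this
  show ?case
    by (intro conjI generated.agree[OF _ e(1)] generated.agree[OF _ e(2)] generated_rules)
      (use add.hyps add.IH in auto)
next
  case (mult F G)
  have "bundle_eq U (X1 f (\<lambda>x y p a1 a2 a4. F x y p a1 a2 a4 * G x y p a1 a2 a4))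
      (\<lambda>x y p a1 a2 a4. X1 f F x y p a1 a2 a4 * G x y p a1 a2 a4 + F x y p a1 a2 a4 * X1 f G x y p a1 a2 a4)"
    "bundle_eq U (X3 f (\<lambda>x y p a1 a2 a4. F x y p a1 a2 a4 * G x y p a1 a2 a4))
      (\<lambda>x y p a1 a2 a4. X3 f F x y p a1 a2 a4 * G x y p a1 a2 a4 + F x y p a1 a2 a4 * X3 f G x y p a1 a2 a4)"
    using mult.hyps by (simp_all add: bundle_eq_def X_rules)
  note e = this
  show ?case
    by (intro conjI generated.agree[OF _ e(1)] generated.agree[OF _ e(2)] generated_rules)
      (use mult.hyps mult.IH in auto)
next
  case (agree F G)
  have "bundle_eq U (X1 f G) (X1 f F)" "bundle_eq U (X3 f G) (X3 f F)"
    using bundle_eq_cong(1,2)[OF open_U agree.hyps(2)] unfolding bundle_eq_def by blast+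
  from this[THEN generated.agree[rotated]] show ?case using agree.IH by blast
qed

text \<open>
  The difference of the two sides is a derivation in \<open>F\<close>, so it suffices to compare them on the
  generators. The commutator is not zero on \<open>\<sigma>\<close> only: \<open>X1\<close> kills \<open>\<sigma>\<close>, while \<open>X3 \<sigma>\<close> contains \<open>\<Psi>\<close>,
  and \<open>\<Psi>_y = k\<close>.
\<close>

lemma X1_X3_commutator:
  assumes "generated F" and "(x, y, p) \<in> U" "a1 \<noteq> 0" "a4 \<noteq> 0"
  shows "X1 f (X3 f F) x y p a1 a2 a4 =
    X3 f (X1 f F) x y p a1 a2 a4 - k x y / (a1 * a4 ^ 2) * X5 F x y p a1 a2 a4"
  using assms
proof (induction arbitrary: x y p a1 a2 a4 rule: generated.induct)
  case (coefficient c)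
  note z = coefficient.prems and c = coefficient.hyps
  note e = bundle_eq_cong(1)[OF open_U generator_bundle_eq(2) z] bundle_eq_cong(2)[OF open_U generator_bundle_eq(1) z]
  show ?case unfolding e using z U_W[OF z(1)] branch[OF U_W[OF z(1)]] c py_px[of c x y]
    by (simp add: X_rules generated_rules partial_rules y_partials)
      (simp add: field_simps \<iota>1_def \<iota>4_def power2_eq_square)
next
  case jet_coordinate
  note z = this
  note e = bundle_eq_cong(1)[OF open_U generator_bundle_eq(4) z] bundle_eq_cong(2)[OF open_U generator_bundle_eq(3) z]
  show ?case unfolding e using z U_W[OF z(1)] branch[OF U_W[OF z(1)]]
    by (simp add: X_rules generated_rules partial_rules y_partials)
      (simp add: field_simps \<iota>1_def \<iota>4_def power2_eq_square)
next
  case inverse_a1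
  note z = this
  note e = bundle_eq_cong(1)[OF open_U generator_bundle_eq(6) z] bundle_eq_cong(2)[OF open_U generator_bundle_eq(5) z]
  show ?case unfolding e using z U_W[OF z(1)] branch[OF U_W[OF z(1)]]
    by (simp add: X_rules generated_rules partial_rules y_partials)
      (simp add: field_simps \<iota>1_def \<iota>4_def power2_eq_square)
next
  case inverse_a4
  note z = this
  note e = bundle_eq_cong(1)[OF open_U generator_bundle_eq(8) z] bundle_eq_cong(2)[OF open_U generator_bundle_eq(7) z]
  show ?case unfolding e using z U_W[OF z(1)] branch[OF U_W[OF z(1)]]
    by (simp add: X_rules generated_rules partial_rules y_partials)
next
  case sigma
  note z = this
  note e = bundle_eq_cong(1)[OF open_U generator_bundle_eq(10) z] bundle_eq_cong(2)[OF open_U generator_bundle_eq(9) z]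
  show ?case unfolding e using z U_W[OF z(1)] branch[OF U_W[OF z(1)]]
    by (simp add: X_rules generated_rules partial_rules y_partials)
      (simp add: field_simps \<iota>1_def \<iota>4_def power2_eq_square)
next
  case (add F G)
  have "bundle_eq U (X1 f (\<lambda>x y p a1 a2 a4. F x y p a1 a2 a4 + G x y p a1 a2 a4))
      (\<lambda>x y p a1 a2 a4. X1 f F x y p a1 a2 a4 + X1 f G x y p a1 a2 a4)"
    "bundle_eq U (X3 f (\<lambda>x y p a1 a2 a4. F x y p a1 a2 a4 + G x y p a1 a2 a4))
      (\<lambda>x y p a1 a2 a4. X3 f F x y p a1 a2 a4 + X3 f G x y p a1 a2 a4)"
    using add.hyps by (simp_all add: bundle_eq_def X_rules)
  note e = bundle_eq_cong(1)[OF open_U this(2) add.prems] bundle_eq_cong(2)[OF open_U this(1) add.prems]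
  show ?case unfolding e
    using add.hyps add.prems generated_X[OF add.hyps(1)] generated_X[OF add.hyps(2)]
    by (simp add: X_rules generated_rules add.IH[OF add.prems] diff_divide_distrib; simp add: field_simps)
next
  case (mult F G)
  have "bundle_eq U (X1 f (\<lambda>x y p a1 a2 a4. F x y p a1 a2 a4 * G x y p a1 a2 a4))
      (\<lambda>x y p a1 a2 a4. X1 f F x y p a1 a2 a4 * G x y p a1 a2 a4 + F x y p a1 a2 a4 * X1 f G x y p a1 a2 a4)"
    "bundle_eq U (X3 f (\<lambda>x y p a1 a2 a4. F x y p a1 a2 a4 * G x y p a1 a2 a4))
      (\<lambda>x y p a1 a2 a4. X3 f F x y p a1 a2 a4 * G x y p a1 a2 a4 + F x y p a1 a2 a4 * X3 f G x y p a1 a2 a4)"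
    using mult.hyps by (simp_all add: bundle_eq_def X_rules)
  note e = bundle_eq_cong(1)[OF open_U this(2) mult.prems] bundle_eq_cong(2)[OF open_U this(1) mult.prems]
  show ?case unfolding e
    using mult.hyps mult.prems generated_X[OF mult.hyps(1)] generated_X[OF mult.hyps(2)]
    by (simp add: X_rules generated_rules mult.IH[OF mult.prems] diff_divide_distrib; simp add: field_simps)
next
  case (agree F G)
  have "bundle_eq U (X1 f G) (X1 f F)" "bundle_eq U (X3 f G) (X3 f F)"
    using bundle_eq_cong(1,2)[OF open_U agree.hyps(2)] unfolding bundle_eq_def by blast+
  note e = bundle_eq_cong(1)[OF open_U this(2) agree.prems] bundle_eq_cong(2)[OF open_U this(1) agree.prems]
    bundle_eq_cong(3)[OF open_U agree.hyps(2) agree.prems]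
  show ?case unfolding e by (rule agree.IH[OF agree.prems])
qed

end

section \<open>The derived invariants\<close>

context quadratic_ode
begin

text \<open>
  The explicit invariants. The powers of \<open>1 / a1\<close> and \<open>1 / a4\<close> are their weights: \<open>X1\<close> adds a
  factor \<open>1 / a1\<close> and \<open>X3\<close> a factor \<open>1 / a4\<close>.
\<close>

lemma I1_bundle_eq: "bundle_eq U (I1 f)
    (\<lambda>x y p a1 a2 a4. k x y
      * (\<iota>1 x y p a1 a2 a4 * \<iota>4 x y p a1 a2 a4 * \<iota>4 x y p a1 a2 a4))"
  by (simp add: bundle_eq_def I1_eq \<iota>1_def \<iota>4_def power2_eq_square)

lemma I1_3_bundle_eq: "bundle_eq U (I1_3 f)
    (\<lambda>x y p a1 a2 a4. (\<kappa> x y + p * u x y - 5 * \<sigma> x y p a1 a2 a4 * k x y)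
      * (\<iota>1 x y p a1 a2 a4 * \<iota>4 x y p a1 a2 a4 * \<iota>4 x y p a1 a2 a4 * \<iota>4 x y p a1 a2 a4))"
  unfolding bundle_eq_def
proof (intro allI impI, goal_cases)
  case (1 x y p a1 a2 a4)
  from 1 U_W[OF 1(1)] show ?case
    unfolding I1_3_def bundle_eq_cong(2)[OF open_U I1_bundle_eq 1]
    by (simp add: X_rules generated_rules partial_rules;
        simp add: x_partials y_partials mixed_partials field_simps power2_eq_square)
qed

lemma X1_I1_bundle_eq: "bundle_eq U (X1 f (I1 f))
    (\<lambda>x y p a1 a2 a4. u x y
      * (\<iota>1 x y p a1 a2 a4 * \<iota>1 x y p a1 a2 a4 * \<iota>4 x y p a1 a2 a4 * \<iota>4 x y p a1 a2 a4))"
  unfolding bundle_eq_def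
proof (intro allI impI, goal_cases)
  case (1 x y p a1 a2 a4)
  from 1 U_W[OF 1(1)] show ?case
    unfolding bundle_eq_cong(1)[OF open_U I1_bundle_eq 1]
    by (simp add: X_rules generated_rules partial_rules;
        simp add: x_partials y_partials mixed_partials field_simps power2_eq_square)
qed

lemma X1_X1_I1_bundle_eq: "bundle_eq U (X1 f (X1 f (I1 f)))
    (\<lambda>x y p a1 a2 a4. v x y
      * (\<iota>1 x y p a1 a2 a4 * \<iota>1 x y p a1 a2 a4 * \<iota>1 x y p a1 a2 a4 * \<iota>4 x y p a1 a2 a4 * \<iota>4 x y p a1 a2 a4))"
  unfolding bundle_eq_def
proof (intro allI impI, goal_cases)
  case (1 x y p a1 a2 a4)
  from 1 U_W[OF 1(1)] show ?case
    unfolding bundle_eq_cong(1)[OF open_U X1_I1_bundle_eq 1]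
    by (simp add: X_rules generated_rules partial_rules;
        simp add: x_partials y_partials mixed_partials field_simps power2_eq_square)
qed

lemma I1_31_bundle_eq: "bundle_eq U (I1_31 f)
    (\<lambda>x y p a1 a2 a4. (\<mu> x y + p * v x y - 6 * \<sigma> x y p a1 a2 a4 * u x y)
      * (\<iota>1 x y p a1 a2 a4 * \<iota>1 x y p a1 a2 a4 * \<iota>4 x y p a1 a2 a4 * \<iota>4 x y p a1 a2 a4 * \<iota>4 x y p a1 a2 a4))"
  unfolding bundle_eq_def
proof (intro allI impI, goal_cases)
  case (1 x y p a1 a2 a4)
  from 1 U_W[OF 1(1)] show ?case
    unfolding I1_31_def bundle_eq_cong(1)[OF open_U I1_3_bundle_eq 1]
    by (simp add: X_rules generated_rules partial_rules;
        simp add: x_partials y_partials mixed_partials field_simps power2_eq_square)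
qed

lemma I1_33_bundle_eq: "bundle_eq U (I1_33 f)
    (\<lambda>x y p a1 a2 a4. (\<kappa>' x y + 2 * p * \<mu> x y + p * p * v x y + A x y * u x y + 5 * \<Psi> x y * k x y
      - 12 * \<sigma> x y p a1 a2 a4 * (\<kappa> x y + p * u x y) + 30 * \<sigma> x y p a1 a2 a4 * \<sigma> x y p a1 a2 a4 * k x y)
      * (\<iota>1 x y p a1 a2 a4 * \<iota>4 x y p a1 a2 a4 * \<iota>4 x y p a1 a2 a4 * \<iota>4 x y p a1 a2 a4 * \<iota>4 x y p a1 a2 a4))"
  unfolding bundle_eq_def
proof (intro allI impI, goal_cases)
  case (1 x y p a1 a2 a4)
  from 1 U_W[OF 1(1)] show ?case
    unfolding I1_33_def bundle_eq_cong(2)[OF open_U I1_3_bundle_eq 1]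
    by (simp add: X_rules generated_rules partial_rules;
        simp add: x_partials y_partials mixed_partials field_simps power2_eq_square)
qed

lemma I1_331_bundle_eq: "bundle_eq U (I1_331 f)
    (\<lambda>x y p a1 a2 a4. (\<mu>' x y + 2 * p * \<nu> x y + p * p * w x y + A x y * v x y + 6 * \<Psi> x y * u x y + 5 * k x y * k x y
      - 14 * \<sigma> x y p a1 a2 a4 * (\<mu> x y + p * v x y) + 42 * \<sigma> x y p a1 a2 a4 * \<sigma> x y p a1 a2 a4 * u x y)
      * (\<iota>1 x y p a1 a2 a4 * \<iota>1 x y p a1 a2 a4 * \<iota>4 x y p a1 a2 a4 * \<iota>4 x y p a1 a2 a4 * \<iota>4 x y p a1 a2 a4 * \<iota>4 x y p a1 a2 a4))"
  unfolding bundle_eq_def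
proof (intro allI impI, goal_cases)
  case (1 x y p a1 a2 a4)
  from 1 U_W[OF 1(1)] show ?case
    unfolding I1_331_def bundle_eq_cong(1)[OF open_U I1_33_bundle_eq 1]
    by (simp add: X_rules generated_rules partial_rules;
        simp add: x_partials y_partials mixed_partials field_simps power2_eq_square)
qed

end

context quadratic_ode
begin

lemma generated_invariants:
  "generated (I1 f)" "generated (X1 f (I1 f))" "generated (X1 f (X1 f (I1 f)))" "generated (I1_3 f)"
  "generated (I1_31 f)" "generated (I1_33 f)" "generated (I1_331 f)" "generated (I1_333 f)"
  "generated (X3 f (X1 f (X1 f (I1 f))))" "generated (X3 f (X3 f (X1 f (X1 f (I1 f)))))"
  "generated (X3 f (I1_31 f))" "generated (X3 f (I1_331 f))"
proof -
  show 1: "generated (I1 f)"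
    by (rule generated.agree[OF _ I1_bundle_eq]) (intro generated_rules; simp)
  show 2: "generated (X1 f (I1 f))" "generated (I1_3 f)"
    using generated_X[OF 1] by (simp_all add: I1_3_def)
  show 3: "generated (X1 f (X1 f (I1 f)))" "generated (I1_31 f)" "generated (I1_33 f)"
    using generated_X[OF 2(1)] generated_X[OF 2(2)] by (simp_all add: I1_31_def I1_33_def)
  show 4: "generated (I1_331 f)" "generated (I1_333 f)"
    using generated_X[OF 3(3)] by (simp_all add: I1_331_def I1_333_def)
  show 5: "generated (X3 f (X1 f (X1 f (I1 f))))" "generated (X3 f (I1_31 f))" "generated (X3 f (I1_331 f))"
    using generated_X[OF 3(1)] generated_X[OF 3(2)] generated_X[OF 4(1)] by simp_all
  show "generated (X3 f (X3 f (X1 f (X1 f (I1 f)))))"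
    using generated_X[OF 5(1)] by simp
qed

context
  fixes x y p a1 a2 a4 :: complex
  assumes z: "(x, y, p) \<in> U" "a1 \<noteq> 0" "a4 \<noteq> 0"
begin

text \<open>
  In the explicit invariants \<open>a2\<close> occurs only through \<open>\<sigma>\<close>, and \<open>X5 \<sigma> = a4\<close>.
\<close>

lemma X5_invariants:
  "X5 (I1 f) x y p a1 a2 a4 = 0"
  "X5 (X1 f (I1 f)) x y p a1 a2 a4 = 0"
  "X5 (I1_3 f) x y p a1 a2 a4 = - 5 * I1 f x y p a1 a2 a4"
  "X5 (I1_31 f) x y p a1 a2 a4 = - 6 * X1 f (I1 f) x y p a1 a2 a4"
  "X5 (I1_33 f) x y p a1 a2 a4 = - 12 * I1_3 f x y p a1 a2 a4"
  "X5 (I1_331 f) x y p a1 a2 a4 = - 14 * I1_31 f x y p a1 a2 a4"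
proof -
  note xy = U_W[OF z(1)]
  note e = I1_bundle_eq X1_I1_bundle_eq I1_3_bundle_eq I1_31_bundle_eq I1_33_bundle_eq I1_331_bundle_eq
  note v = e[unfolded bundle_eq_def, rule_format, OF z]
  have r: "a4 * \<iota>4 x y p a1 a2 a4 = 1" using z by (simp add: \<iota>4_def)
  show "X5 (I1 f) x y p a1 a2 a4 = 0"
    unfolding bundle_eq_cong(3)[OF open_U e(1) z] using z xy by (simp add: X_rules generated_rules)
  show "X5 (X1 f (I1 f)) x y p a1 a2 a4 = 0"
    unfolding bundle_eq_cong(3)[OF open_U e(2) z] using z xy by (simp add: X_rules generated_rules)
  show "X5 (I1_3 f) x y p a1 a2 a4 = - 5 * I1 f x y p a1 a2 a4"
    unfolding bundle_eq_cong(3)[OF open_U e(3) z] v using z xy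
    by (simp add: X_rules generated_rules; simp add: \<iota>4_def field_simps)
  show "X5 (I1_31 f) x y p a1 a2 a4 = - 6 * X1 f (I1 f) x y p a1 a2 a4"
    unfolding bundle_eq_cong(3)[OF open_U e(4) z] v using z xy
    by (simp add: X_rules generated_rules; simp add: \<iota>4_def field_simps)
  show "X5 (I1_33 f) x y p a1 a2 a4 = - 12 * I1_3 f x y p a1 a2 a4"
    unfolding bundle_eq_cong(3)[OF open_U e(5) z] v using z xy
    by (simp add: X_rules generated_rules; simp add: \<iota>4_def field_simps)
  show "X5 (I1_331 f) x y p a1 a2 a4 = - 14 * I1_31 f x y p a1 a2 a4"
    unfolding bundle_eq_cong(3)[OF open_U e(6) z] v using z xy
    by (simp add: X_rules generated_rules; simp add: \<iota>4_def field_simps)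
qed

lemma commutator: "generated F \<Longrightarrow> X1 f (X3 f F) x y p a1 a2 a4 =
    X3 f (X1 f F) x y p a1 a2 a4 - I1 f x y p a1 a2 a4 * X5 F x y p a1 a2 a4"
  using X1_X3_commutator[OF _ z] I1_eq[OF z] by simp

end

text \<open>
  The commutator moves \<open>X1\<close> past \<open>X3\<close> towards \<open>I1\<close>. What remains are powers of \<open>X3\<close> applied to
  \<open>X1 I1\<close> and \<open>X1 (X1 I1)\<close>. This replaces explicit numerators of \<open>I1_333\<close>, \<open>I1_3331\<close> and
  \<open>I1_33311\<close>.
\<close>

lemma invariants_by_X3:
  "bundle_eq U (I1_31 f) (X3 f (X1 f (I1 f)))"
  "bundle_eq U (X1 f (I1_31 f)) (X3 f (X1 f (X1 f (I1 f))))"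
  "bundle_eq U (I1_331 f) (\<lambda>x y p a1 a2 a4. X3 f (I1_31 f) x y p a1 a2 a4
     + 5 * (I1 f x y p a1 a2 a4 * I1 f x y p a1 a2 a4))"
  "bundle_eq U (X1 f (I1_331 f)) (\<lambda>x y p a1 a2 a4. X3 f (X3 f (X1 f (X1 f (I1 f)))) x y p a1 a2 a4
     + 16 * (I1 f x y p a1 a2 a4 * X1 f (I1 f) x y p a1 a2 a4))"
  "bundle_eq U (I1_3331 f) (\<lambda>x y p a1 a2 a4. X3 f (I1_331 f) x y p a1 a2 a4
     + 12 * (I1 f x y p a1 a2 a4 * I1_3 f x y p a1 a2 a4))"
  "bundle_eq U (I1_33311 f) (\<lambda>x y p a1 a2 a4. X3 f (X3 f (X3 f (X1 f (X1 f (I1 f))))) x y p a1 a2 a4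
     + 28 * X1 f (I1 f) x y p a1 a2 a4 * I1_3 f x y p a1 a2 a4
     + 42 * I1 f x y p a1 a2 a4 * I1_31 f x y p a1 a2 a4)"
proof -
  note g = generated_invariants and x5 = X5_invariants
  show 1: "bundle_eq U (I1_31 f) (X3 f (X1 f (I1 f)))"
    by (simp add: bundle_eq_def I1_31_def I1_3_def commutator g x5)
  show 2: "bundle_eq U (X1 f (I1_31 f)) (X3 f (X1 f (X1 f (I1 f))))"
    by (simp add: bundle_eq_def bundle_eq_cong(1)[OF open_U 1] commutator g x5)
  show 3: "bundle_eq U (I1_331 f) (\<lambda>x y p a1 a2 a4. X3 f (I1_31 f) x y p a1 a2 a4
     + 5 * (I1 f x y p a1 a2 a4 * I1 f x y p a1 a2 a4))"
    by (simp add: bundle_eq_def I1_331_def I1_33_def commutator g x5) (simp add: I1_31_def)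
  show 4: "bundle_eq U (X1 f (I1_331 f)) (\<lambda>x y p a1 a2 a4. X3 f (X3 f (X1 f (X1 f (I1 f)))) x y p a1 a2 a4
     + 16 * (I1 f x y p a1 a2 a4 * X1 f (I1 f) x y p a1 a2 a4))"
    by (simp add: bundle_eq_def bundle_eq_cong(1)[OF open_U 3] bundle_eq_cong(2)[OF open_U 2]
        X_rules generated_rules commutator g x5)
  show 5: "bundle_eq U (I1_3331 f) (\<lambda>x y p a1 a2 a4. X3 f (I1_331 f) x y p a1 a2 a4
     + 12 * (I1 f x y p a1 a2 a4 * I1_3 f x y p a1 a2 a4))"
    by (simp add: bundle_eq_def I1_3331_def I1_333_def commutator g x5) (simp add: I1_331_def)
  show "bundle_eq U (I1_33311 f) (\<lambda>x y p a1 a2 a4. X3 f (X3 f (X3 f (X1 f (X1 f (I1 f))))) x y p a1 a2 a4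
     + 28 * X1 f (I1 f) x y p a1 a2 a4 * I1_3 f x y p a1 a2 a4
     + 42 * I1 f x y p a1 a2 a4 * I1_31 f x y p a1 a2 a4)"
    unfolding bundle_eq_def
  proof (intro allI impI)
    fix x y p a1 a2 a4 :: complex assume z: "(x, y, p) \<in> U" "a1 \<noteq> 0" "a4 \<noteq> 0"
    have a: "X3 f (I1 f) = I1_3 f" "X1 f (I1_3 f) = I1_31 f" by (simp_all add: I1_3_def I1_31_def)
    have b: "X3 f (X1 f (I1 f)) x y p a1 a2 a4 = I1_31 f x y p a1 a2 a4"
      using 1 z by (simp add: bundle_eq_def)
    have "I1_33311 f x y p a1 a2 a4 = X1 f (X3 f (I1_331 f)) x y p a1 a2 a4
      + 12 * (X1 f (I1 f) x y p a1 a2 a4 * I1_3 f x y p a1 a2 a4 + I1 f x y p a1 a2 a4 * I1_31 f x y p a1 a2 a4)"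
      unfolding I1_33311_def bundle_eq_cong(1)[OF open_U 5 z] using z
      by (simp add: X_rules generated_rules g a)
    also have "X1 f (X3 f (I1_331 f)) x y p a1 a2 a4 = X3 f (X3 f (X3 f (X1 f (X1 f (I1 f))))) x y p a1 a2 a4
      + 16 * (I1_3 f x y p a1 a2 a4 * X1 f (I1 f) x y p a1 a2 a4 + I1 f x y p a1 a2 a4 * I1_31 f x y p a1 a2 a4)
      + 14 * I1 f x y p a1 a2 a4 * I1_31 f x y p a1 a2 a4"
      unfolding commutator[OF z g(7)] bundle_eq_cong(2)[OF open_U 4 z] using z
      by (simp add: X_rules generated_rules g x5 a b)
    finally show "I1_33311 f x y p a1 a2 a4 = X3 f (X3 f (X3 f (X1 f (X1 f (I1 f))))) x y p a1 a2 a4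
     + 28 * X1 f (I1 f) x y p a1 a2 a4 * I1_3 f x y p a1 a2 a4
     + 42 * I1 f x y p a1 a2 a4 * I1_31 f x y p a1 a2 a4"
      by (simp add: algebra_simps)
  qed
qed

text \<open>
  For \<open>U = X1 I1\<close> and \<open>V = X1 U\<close> the hypotheses say that \<open>6 U (X3 V) = 7 V (X3 U)\<close>, as if \<open>V\<close> were
  a constant multiple of \<open>U^(7/6)\<close>. Two further applications of \<open>X3\<close> express \<open>X3^3 V\<close> by \<open>X3^3 U\<close>
  at a point where \<open>X3 U = I1_31\<close> vanishes, and \<open>X3^3 U\<close> is \<open>I1_3331\<close> up to a multiple of
  \<open>I1 I1_3\<close>.
\<close>

lemma I1_33311_eq:
  assumes rel: "\<And>x y. (x, y) \<in> W \<Longrightarrow> 6 * u x y * w x y = 7 * v x y ^ 2"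
      "\<And>x y. (x, y) \<in> W \<Longrightarrow> 6 * u x y * \<nu> x y = 7 * \<mu> x y * v x y"
    and z: "(x, y, p) \<in> U" "a1 \<noteq> 0" "a4 \<noteq> 0" and u: "u x y \<noteq> 0"
    and I131: "I1_31 f x y p a1 a2 a4 = 0"
  shows "6 * u x y * a1 * I1_33311 f x y p a1 a2 a4 =
    7 * v x y * (I1_3331 f x y p a1 a2 a4 - 22 * I1 f x y p a1 a2 a4 * I1_3 f x y p a1 a2 a4)
    + 168 * u x y ^ 2 / (a1 * a4 ^ 2) * I1_3 f x y p a1 a2 a4"
proof -
  note g = generated_invariants
  let ?U = "X1 f (I1 f)" and ?V = "X1 f (X1 f (I1 f))" and ?Z = "I1_31 f"
  have XU: "X3 f ?U x y p a1 a2 a4 = ?Z x y p a1 a2 a4" if "(x, y, p) \<in> U" "a1 \<noteq> 0" "a4 \<noteq> 0" for x y p a1 a2 a4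
    using invariants_by_X3(1) that by (simp add: bundle_eq_def)
  have e0: "bundle_eq U (\<lambda>x y p a1 a2 a4. 6 * (?U x y p a1 a2 a4 * X3 f ?V x y p a1 a2 a4))
      (\<lambda>x y p a1 a2 a4. 7 * (?V x y p a1 a2 a4 * ?Z x y p a1 a2 a4))"
    unfolding bundle_eq_def
  proof (intro allI impI)
    fix x y p a1 a2 a4 :: complex assume z: "(x, y, p) \<in> U" "a1 \<noteq> 0" "a4 \<noteq> 0"
    note xy = U_W[OF z(1)]
    note val = X1_I1_bundle_eq[unfolded bundle_eq_def, rule_format, OF z]
      X1_X1_I1_bundle_eq[unfolded bundle_eq_def, rule_format, OF z]
      I1_31_bundle_eq[unfolded bundle_eq_def, rule_format, OF z]
    have "X3 f ?V x y p a1 a2 a4 = (\<nu> x y + p * w x y - 7 * \<sigma> x y p a1 a2 a4 * v x y) * (\<iota>1 x y p a1 a2 a4 *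
       \<iota>1 x y p a1 a2 a4 * \<iota>1 x y p a1 a2 a4 * \<iota>4 x y p a1 a2 a4 * \<iota>4 x y p a1 a2 a4 * \<iota>4 x y p a1 a2 a4)"
      unfolding bundle_eq_cong(2)[OF open_U X1_X1_I1_bundle_eq z] using z xy
      by (simp add: X_rules generated_rules partial_rules; simp add: x_partials y_partials field_simps)
    moreover have "6 * u x y * (\<nu> x y + p * w x y - 7 * s * v x y) = 7 * v x y * (\<mu> x y + p * v x y - 6 * s * u x y)" for s
      using rel[OF xy] by algebra
    from this[of "\<sigma> x y p a1 a2 a4"] calculation show "6 * (?U x y p a1 a2 a4 * X3 f ?V x y p a1 a2 a4) = 7 * (?V x y p a1 a2 a4 * ?Z x y p a1 a2 a4)"
      unfolding val by (simp add: mult.assoc)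
  qed
  have e1: "bundle_eq U (\<lambda>x y p a1 a2 a4. 6 * (?U x y p a1 a2 a4 * X3 f (X3 f ?V) x y p a1 a2 a4))
      (\<lambda>x y p a1 a2 a4. X3 f ?V x y p a1 a2 a4 * ?Z x y p a1 a2 a4 + 7 * (?V x y p a1 a2 a4 * X3 f ?Z x y p a1 a2 a4))"
    unfolding bundle_eq_def
  proof (intro allI impI)
    fix x y p a1 a2 a4 :: complex assume z: "(x, y, p) \<in> U" "a1 \<noteq> 0" "a4 \<noteq> 0"
    from bundle_eq_cong(2)[OF open_U e0 z, where f = f and ?a2.0 = a2] z
    show "6 * (?U x y p a1 a2 a4 * X3 f (X3 f ?V) x y p a1 a2 a4) =
      X3 f ?V x y p a1 a2 a4 * ?Z x y p a1 a2 a4 + 7 * (?V x y p a1 a2 a4 * X3 f ?Z x y p a1 a2 a4)"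
      by (simp add: X_rules generated_rules g XU; simp add: algebra_simps)
  qed
  note val = X1_I1_bundle_eq[unfolded bundle_eq_def, rule_format, OF z]
    X1_X1_I1_bundle_eq[unfolded bundle_eq_def, rule_format, OF z]
  have U0: "?U x y p a1 a2 a4 \<noteq> 0" unfolding val using u z by (simp add: \<iota>1_def \<iota>4_def)
  have V3: "X3 f ?V x y p a1 a2 a4 = 0"
    using e0[unfolded bundle_eq_def, rule_format, OF z, of a2] U0 I131 by simp
  have "6 * (?U x y p a1 a2 a4 * X3 f (X3 f (X3 f ?V)) x y p a1 a2 a4)
      = 7 * (?V x y p a1 a2 a4 * X3 f (X3 f ?Z) x y p a1 a2 a4)"
    using bundle_eq_cong(2)[OF open_U e1 z, where f = f and ?a2.0 = a2] z I131 V3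
    by (simp add: X_rules generated_rules g generated_X XU)
  moreover have "I1_33311 f x y p a1 a2 a4 = X3 f (X3 f (X3 f ?V)) x y p a1 a2 a4
      + 28 * ?U x y p a1 a2 a4 * I1_3 f x y p a1 a2 a4"
    using invariants_by_X3(6) z I131 by (simp add: bundle_eq_def)
  moreover have "X3 f (I1_331 f) x y p a1 a2 a4 = X3 f (X3 f ?Z) x y p a1 a2 a4
      + 10 * (I1 f x y p a1 a2 a4 * I1_3 f x y p a1 a2 a4)"
    unfolding bundle_eq_cong(2)[OF open_U invariants_by_X3(3) z] using z
    by (simp add: X_rules generated_rules g I1_3_def)
  hence "X3 f (X3 f ?Z) x y p a1 a2 a4 =
      I1_3331 f x y p a1 a2 a4 - 22 * (I1 f x y p a1 a2 a4 * I1_3 f x y p a1 a2 a4)"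
    using invariants_by_X3(5) z by (simp add: bundle_eq_def)
  ultimately have *: "6 * ?U x y p a1 a2 a4 * I1_33311 f x y p a1 a2 a4 =
    7 * ?V x y p a1 a2 a4 * (I1_3331 f x y p a1 a2 a4 - 22 * I1 f x y p a1 a2 a4 * I1_3 f x y p a1 a2 a4)
    + 168 * ?U x y p a1 a2 a4 ^ 2 * I1_3 f x y p a1 a2 a4"
    by (simp add: algebra_simps power2_eq_square)
  have vals: "?U x y p a1 a2 a4 = u x y / (a1 ^ 2 * a4 ^ 2)" "?V x y p a1 a2 a4 = v x y / (a1 ^ 3 * a4 ^ 2)"
    unfolding val by (simp_all add: \<iota>1_def \<iota>4_def power2_eq_square power3_eq_cube)
  from arg_cong[OF *, of "\<lambda>t. t * (a1 ^ 3 * a4 ^ 2)"] show ?thesis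
    unfolding vals using z
    by (simp add: divide_simps) algebra
qed

end

section \<open>The normalization\<close>

context quadratic_ode
begin

context
  fixes x y p :: complex
  assumes z: "(x, y, p) \<in> U"
begin

text \<open>
  If \<open>k\<close> and \<open>u\<close> are not zero, the equations can be solved one after the other: the last one gives
  \<open>\<sigma>\<close>, the second one \<open>a4\<close>, the first one \<open>a1\<close>, and \<open>\<sigma>\<close> then gives \<open>a2\<close>.
\<close>

lemma normalized_iff:
  "normalized f x y p (a1, a2, a4) \<longleftrightarrow> a1 \<noteq> 0 \<and> a4 \<noteq> 0 \<and> k x y = - 12 * a1 * a4 ^ 2 \<and>
     \<kappa> x y + p * u x y - 5 * \<sigma> x y p a1 a2 a4 * k x y = k x y * a4 \<and>
     \<mu> x y + p * v x y = 6 * \<sigma> x y p a1 a2 a4 * u x y"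
proof (cases "a1 = 0 \<or> a4 = 0")
  case False
  hence a: "a1 \<noteq> 0" "a4 \<noteq> 0" by auto
  note v = I1_eq[OF z a] I1_3_bundle_eq[unfolded bundle_eq_def, rule_format, OF z a]
    I1_31_bundle_eq[unfolded bundle_eq_def, rule_format, OF z a]
  have "I1 f x y p a1 a2 a4 = - 12 \<longleftrightarrow> k x y = - 12 * a1 * a4 ^ 2"
    unfolding v using a by (simp add: field_simps)
  moreover have "I1_31 f x y p a1 a2 a4 = 0 \<longleftrightarrow> \<mu> x y + p * v x y = 6 * \<sigma> x y p a1 a2 a4 * u x y"
    unfolding v using a by (simp add: \<iota>1_def \<iota>4_def)
  moreover have "I1_3 f x y p a1 a2 a4 = - 12 \<longleftrightarrow>
      \<kappa> x y + p * u x y - 5 * \<sigma> x y p a1 a2 a4 * k x y = k x y * a4" if "k x y = - 12 * a1 * a4 ^ 2"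
  proof -
    have "I1_3 f x y p a1 a2 a4 = - 12 \<longleftrightarrow>
        \<kappa> x y + p * u x y - 5 * \<sigma> x y p a1 a2 a4 * k x y = - 12 * a1 * a4 ^ 2 * a4"
      unfolding v using a by (simp add: \<iota>1_def \<iota>4_def divide_eq_eq power2_eq_square mult_ac)
    thus ?thesis by (simp only: that)
  qed
  ultimately show ?thesis unfolding normalized_def using a by auto
qed (auto simp: normalized_def)

context
  fixes a1 a2 a4
  assumes norm: "normalized f x y p (a1, a2, a4)"
begin

lemma normalized_k_nonzero: "k x y \<noteq> 0"
  using norm normalized_iff by auto

lemma normalized_values:
  "I1_33 f x y p a1 a2 a4 = - 12 * (\<kappa>' x y + 2 * p * \<mu> x y + p * p * v x y + A x y * u x y
     + 5 * \<Psi> x y * k x y - 12 * \<sigma> x y p a1 a2 a4 * (\<kappa> x y + p * u x y)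
     + 30 * \<sigma> x y p a1 a2 a4 * \<sigma> x y p a1 a2 a4 * k x y) / (k x y * a4 ^ 2)"
  "I1_331 f x y p a1 a2 a4 = 144 * (\<mu>' x y + 2 * p * \<nu> x y + p * p * w x y + A x y * v x y
     + 6 * \<Psi> x y * u x y + 5 * k x y * k x y - 14 * \<sigma> x y p a1 a2 a4 * (\<mu> x y + p * v x y)
     + 42 * \<sigma> x y p a1 a2 a4 * \<sigma> x y p a1 a2 a4 * u x y) / k x y ^ 2"
proof -
  have n: "a1 \<noteq> 0" "a4 \<noteq> 0" "k x y = - 12 * a1 * a4 ^ 2" using norm normalized_iff by auto
  note v = I1_33_bundle_eq[unfolded bundle_eq_def, rule_format, OF z n(1,2)]
    I1_331_bundle_eq[unfolded bundle_eq_def, rule_format, OF z n(1,2)]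
  have r: "\<iota>1 x y p a1 a2 a4 * \<iota>4 x y p a1 a2 a4 * \<iota>4 x y p a1 a2 a4 * \<iota>4 x y p a1 a2 a4 * \<iota>4 x y p a1 a2 a4
       = - 12 / (k x y * a4 ^ 2)"
    "\<iota>1 x y p a1 a2 a4 * \<iota>1 x y p a1 a2 a4 * \<iota>4 x y p a1 a2 a4 * \<iota>4 x y p a1 a2 a4 * \<iota>4 x y p a1 a2 a4 *
      \<iota>4 x y p a1 a2 a4 = 144 / k x y ^ 2"
    unfolding n(3) using n(1,2) by (simp_all add: \<iota>1_def \<iota>4_def field_simps power2_eq_square)
  show "I1_33 f x y p a1 a2 a4 = - 12 * (\<kappa>' x y + 2 * p * \<mu> x y + p * p * v x y + A x y * u x y
     + 5 * \<Psi> x y * k x y - 12 * \<sigma> x y p a1 a2 a4 * (\<kappa> x y + p * u x y)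
     + 30 * \<sigma> x y p a1 a2 a4 * \<sigma> x y p a1 a2 a4 * k x y) / (k x y * a4 ^ 2)"
    "I1_331 f x y p a1 a2 a4 = 144 * (\<mu>' x y + 2 * p * \<nu> x y + p * p * w x y + A x y * v x y
     + 6 * \<Psi> x y * u x y + 5 * k x y * k x y - 14 * \<sigma> x y p a1 a2 a4 * (\<mu> x y + p * v x y)
     + 42 * \<sigma> x y p a1 a2 a4 * \<sigma> x y p a1 a2 a4 * u x y) / k x y ^ 2"
    unfolding v r using n(2) normalized_k_nonzero by (simp_all add: field_simps)
qed

text \<open>
  If \<open>u\<close> vanished, the last normalization equation would not involve the parameters, and the other
  two would leave one of them free; the proof doubles \<open>a4\<close>.
\<close>

lemma unique_normalization_u_nonzero:
  assumes "\<exists>!a. normalized f x y p a"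
  shows "u x y \<noteq> 0"
proof
  assume u: "u x y = 0"
  have n: "a1 \<noteq> 0" "a4 \<noteq> 0" "k x y = - 12 * a1 * a4 ^ 2"
    "\<kappa> x y + p * u x y - 5 * \<sigma> x y p a1 a2 a4 * k x y = k x y * a4"
    "\<mu> x y + p * v x y = 6 * \<sigma> x y p a1 a2 a4 * u x y" using norm normalized_iff by auto
  define h where "h = (B x y + 2 * C x y * p) / 2"
  define b2 where "b2 = (\<sigma> x y p a1 a2 a4 - a4 / 5 - h) * (a1 / 4) / (2 * a4)"
  have s: "\<sigma> x y p (a1 / 4) b2 (2 * a4) = \<sigma> x y p a1 a2 a4 - a4 / 5"
    using n(1,2) by (simp add: \<sigma>_def[of _ _ _ "a1 / 4"] b2_def h_def[symmetric])
  have "\<kappa> x y + p * u x y - 5 * (\<sigma> x y p a1 a2 a4 - a4 / 5) * k x y = k x y * (2 * a4)"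
    using n(4) by (simp add: algebra_simps)
  moreover have "k x y = - 12 * (a1 / 4) * (2 * a4) ^ 2"
    using n(3) by (simp add: power2_eq_square)
  moreover have "\<mu> x y + p * v x y = 6 * (\<sigma> x y p a1 a2 a4 - a4 / 5) * u x y"
    using n(5) u by simp
  moreover have "a1 / 4 \<noteq> 0" "2 * a4 \<noteq> 0" using n by simp_all
  ultimately have "normalized f x y p (a1 / 4, b2, 2 * a4)"
    unfolding normalized_iff s by blast
  with norm assms have "2 * a4 = a4" by blast
  with n show False by simp
qed

end

end

end

section \<open>The transformation formulas as values of the normalized invariants\<close>

text \<open>
  The right-hand side lists the normalized invariants of the second Painleve equation itself at
  the point \<open>(X, Y, P)\<close>. Let \<open>M = 4032 - J3331\<close> and let \<open>D\<close> be the denominator that occurs for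
  \<open>\<alpha> \<noteq> 0\<close>. The formula for \<open>\<alpha>^2\<close> reads \<open>112 J33311 M^2 \<alpha>^2 = - D^2\<close>, since the long factor is a
  perfect square. The formulas thus prescribe \<open>J33311 M\<close>, \<open>J33311 M^2\<close>, \<open>D\<close> and \<open>J331\<close>, hence all
  four invariants.
\<close>

lemma pII_formulas_iff:
  fixes X Y P J33 J331 J3331 J33311 \<alpha> :: complex
  assumes Y: "Y \<noteq> 0" and P: "P \<noteq> 0"
  shows "(pII_alpha_formula \<alpha> J33 J331 J3331 J33311 \<and>
      (\<alpha> \<noteq> 0 \<longrightarrow> pII_formulas_nonzero \<alpha> X Y P J33 J331 J3331 J33311) \<and>
      (\<alpha> = 0 \<longrightarrow> pII_formulas_zero X Y P J331 J3331 J33311)) \<longleftrightarrow>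
    J33 = - Y * (384 * Y ^ 3 + 72 * X * Y + 12 * \<alpha>) / P ^ 2 \<and>
    J331 = 1152 + 72 * X / Y ^ 2 \<and> J3331 = 4032 + 72 / (Y * P) \<and> J33311 = - 4032 * P ^ 2 / Y ^ 4"
    (is "?L \<longleftrightarrow> ?R")
proof -
  define M where "M = 4032 - J3331"
  define D where "D = J33311 * J33 + 3096576 - 4032 * J331"
  have alpha: "pII_alpha_formula \<alpha> J33 J331 J3331 J33311 \<longleftrightarrow>
      112 * J33311 * M ^ 2 \<noteq> 0 \<and> \<alpha> ^ 2 * (112 * J33311 * M ^ 2) = - (D ^ 2)"
  proof -
    have M2: "16257024 - 8064 * J3331 + J3331 ^ 2 = M ^ 2"
      by (simp add: M_def power2_eq_square algebra_simps)
    have D2: "J33311 ^ 2 * J33 ^ 2 - 8064 * J33311 * J33 * J331 + 6193152 * J33311 * J33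
        + 9588782923776 - 24970788864 * J331 + 16257024 * J331 ^ 2 = D ^ 2"
      by (simp add: D_def power2_eq_square algebra_simps)
    show ?thesis unfolding pII_alpha_formula_def M2 D2
      by (auto simp: divide_simps)
  qed
  have nonzero: "pII_formulas_nonzero \<alpha> X Y P J33 J331 J3331 J33311 \<longleftrightarrow>
      D \<noteq> 0 \<and> 6 * P * D = J33311 * M * Y ^ 2 * \<alpha> \<and> X = - (16 - 1 / 72 * J331) * Y ^ 2 \<and>
      Y ^ 3 * D = 48384 * \<alpha>"
    unfolding pII_formulas_nonzero_def M_def[symmetric] D_def[symmetric]
    by (auto simp: divide_simps mult_ac)
  have zero: "pII_formulas_zero X Y P J331 J3331 J33311 \<longleftrightarrow>
      290304 * P = Y ^ 5 * J33311 * M \<and> X = - (1 / 72) * Y ^ 2 * (1152 - J331) \<and> J33311 * M ^ 2 \<noteq> 0 \<and>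
      Y ^ 6 * (J33311 * M ^ 2) = - 20901888"
    unfolding pII_formulas_zero_def M_def[symmetric] by (auto simp: divide_simps mult.commute[of P])
  have R: "?R \<longleftrightarrow> Y ^ 3 * D = 48384 * \<alpha> \<and> J331 = 1152 + 72 * X / Y ^ 2 \<and> M * (Y * P) = - 72 \<and>
      J33311 * Y ^ 4 = - 4032 * P ^ 2"
  proof -
    have 1: "J3331 = 4032 + 72 / (Y * P) \<longleftrightarrow> M * (Y * P) = - 72"
      using assms by (auto simp: M_def field_simps)
    have 2: "J33311 = - 4032 * P ^ 2 / Y ^ 4 \<longleftrightarrow> J33311 * Y ^ 4 = - 4032 * P ^ 2"
      using assms by (auto simp: field_simps)
    have 3: "J33 = - Y * (384 * Y ^ 3 + 72 * X * Y + 12 * \<alpha>) / P ^ 2 \<longleftrightarrow> Y ^ 3 * D = 48384 * \<alpha>"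
      if J: "J331 = 1152 + 72 * X / Y ^ 2" "J33311 * Y ^ 4 = - 4032 * P ^ 2"
    proof -
      have "Y * (Y ^ 3 * D) = (J33311 * Y ^ 4) * J33 + Y ^ 4 * 3096576 - Y ^ 4 * (4032 * J331)"
        by (simp add: D_def algebra_simps power_numeral_reduce)
      also have "\<dots> = - 4032 * P ^ 2 * J33 + Y ^ 4 * 3096576 - Y ^ 4 * (4032 * J331)"
        using J(2) by simp
      also have "Y ^ 4 * (4032 * J331) = 4644864 * Y ^ 4 + 290304 * X * Y ^ 2"
        unfolding J(1) using Y by (simp add: field_simps power_numeral_reduce)
      finally have "Y * (Y ^ 3 * D - 48384 * \<alpha>) = - 4032 * (P ^ 2 * J33 + Y * (384 * Y ^ 3 + 72 * X * Y + 12 * \<alpha>))"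
        by (simp add: algebra_simps power_numeral_reduce)
      hence "Y ^ 3 * D - 48384 * \<alpha> = 0 \<longleftrightarrow> P ^ 2 * J33 + Y * (384 * Y ^ 3 + 72 * X * Y + 12 * \<alpha>) = 0"
        using Y by (metis mult_eq_0_iff neg_equal_0_iff_equal zero_neq_numeral)
      also have "\<dots> \<longleftrightarrow> J33 = - (Y * (384 * Y ^ 3 + 72 * X * Y + 12 * \<alpha>)) / P ^ 2"
        using P unfolding eq_neg_iff_add_eq_0[symmetric] mult.commute[of "P ^ 2" J33]
        by (subst nonzero_eq_divide_eq) simp_all
      finally show ?thesis by simp
    qed
    show ?thesis using 1 2 3 by blast
  qed
  have X: "X = - (16 - 1 / 72 * J331) * Y ^ 2 \<longleftrightarrow> J331 = 1152 + 72 * X / Y ^ 2"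
    "X = - (1 / 72) * Y ^ 2 * (1152 - J331) \<longleftrightarrow> J331 = 1152 + 72 * X / Y ^ 2"
    using Y by (auto simp: field_simps)
  have NM: "M * (Y * P) = - 72 \<and> J33311 * Y ^ 4 = - 4032 * P ^ 2 \<longleftrightarrow>
      J33311 * M * Y ^ 5 = 290304 * P \<and> J33311 * M ^ 2 * Y ^ 6 = - 20901888"
  proof safe
    assume *: "M * (Y * P) = - 72" "J33311 * Y ^ 4 = - 4032 * P ^ 2"
    have "J33311 * M * Y ^ 5 * P = (J33311 * Y ^ 4) * (M * (Y * P))" by (simp add: power_numeral_reduce)
    also have "\<dots> = 290304 * P * P" using * by (simp add: power2_eq_square)
    finally show a: "J33311 * M * Y ^ 5 = 290304 * P" using P by simp
    have "J33311 * M ^ 2 * Y ^ 6 = (J33311 * M * Y ^ 5) * (M * Y)" by (simp add: power_numeral_reduce)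
    also have "\<dots> = 290304 * (M * (Y * P))" unfolding a by (simp add: mult_ac)
    finally show "J33311 * M ^ 2 * Y ^ 6 = - 20901888" unfolding *(1) by simp
  next
    assume *: "J33311 * M * Y ^ 5 = 290304 * P" "J33311 * M ^ 2 * Y ^ 6 = - 20901888"
    have "290304 * (M * (Y * P)) = (J33311 * M * Y ^ 5) * (M * Y)" unfolding *(1) by (simp add: mult_ac)
    also have "\<dots> = J33311 * M ^ 2 * Y ^ 6" by (simp add: power_numeral_reduce)
    finally show a: "M * (Y * P) = - 72" unfolding *(2) by (simp add: mult_ac)
    have "- 72 * (J33311 * Y ^ 4) = (J33311 * M * Y ^ 5) * P"
      unfolding a[symmetric] by (simp add: power_numeral_reduce)
    also have "\<dots> = - 72 * (- 4032 * P ^ 2)" unfolding *(1) by (simp add: power2_eq_square)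
    finally show "J33311 * Y ^ 4 = - 4032 * P ^ 2" by (simp only: mult_cancel_left) simp
  qed
  have ne: "J33311 * M ^ 2 \<noteq> 0" if "J33311 * M ^ 2 * Y ^ 6 = - 20901888" using that by auto
  show ?thesis
  proof (cases "\<alpha> = 0")
    case True
    have "Y ^ 3 * D = 48384 * \<alpha> \<longleftrightarrow> \<alpha> ^ 2 * (112 * J33311 * M ^ 2) = - (D ^ 2)" using True Y by simp
    thus ?thesis unfolding R alpha zero X NM using True ne by (auto simp: mult_ac)
  next
    case False
    show ?thesis
    proof (intro iffI)
      assume ?L
      hence *: "112 * J33311 * M ^ 2 \<noteq> 0" "\<alpha> ^ 2 * (112 * J33311 * M ^ 2) = - (D ^ 2)"
        "D \<noteq> 0" "6 * P * D = J33311 * M * Y ^ 2 * \<alpha>" "J331 = 1152 + 72 * X / Y ^ 2" "Y ^ 3 * D = 48384 * \<alpha>"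
        using False unfolding alpha nonzero X by simp_all
      have "\<alpha> * (J33311 * M * Y ^ 5) = (J33311 * M * Y ^ 2 * \<alpha>) * Y ^ 3" by (simp add: power_numeral_reduce)
      also have "\<dots> = 6 * P * (Y ^ 3 * D)" unfolding *(4)[symmetric] by simp
      also have "\<dots> = \<alpha> * (290304 * P)" unfolding *(6) by simp
      finally have a: "J33311 * M * Y ^ 5 = 290304 * P" using False by simp
      have "\<alpha> ^ 2 * (112 * (J33311 * M ^ 2 * Y ^ 6)) = - ((Y ^ 3 * D) ^ 2)"
        using arg_cong[OF *(2), of "\<lambda>t. t * Y ^ 6"] by (simp add: power_mult_distrib mult_ac flip: power_mult)
      hence "\<alpha> ^ 2 * (112 * (J33311 * M ^ 2 * Y ^ 6)) = \<alpha> ^ 2 * (112 * - 20901888)"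
        unfolding *(6) by (simp add: power_mult_distrib mult_ac)
      hence "112 * (J33311 * M ^ 2 * Y ^ 6) = 112 * - 20901888"
        using False by (simp only: mult_cancel_left power_eq_0_iff) simp
      hence "J33311 * M ^ 2 * Y ^ 6 = - 20901888" by (simp only: mult_cancel_left) simp
      with a show ?R unfolding R NM using * by simp
    next
      assume ?R
      hence *: "Y ^ 3 * D = 48384 * \<alpha>" "J331 = 1152 + 72 * X / Y ^ 2"
        "J33311 * M * Y ^ 5 = 290304 * P" "J33311 * M ^ 2 * Y ^ 6 = - 20901888"
        unfolding R NM by simp_all
      have "Y ^ 6 * (\<alpha> ^ 2 * (112 * J33311 * M ^ 2)) = \<alpha> ^ 2 * (112 * (J33311 * M ^ 2 * Y ^ 6))" by simp
      also have "\<dots> = - ((48384 * \<alpha>) ^ 2)" unfolding *(4) by (simp add: power_mult_distrib)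
      also have "\<dots> = Y ^ 6 * - (D ^ 2)" unfolding *(1)[symmetric] by (simp add: power_mult_distrib flip: power_mult)
      finally have a: "\<alpha> ^ 2 * (112 * J33311 * M ^ 2) = - (D ^ 2)" using Y by (simp only: mult_cancel_left power_eq_0_iff) simp
      have "Y ^ 3 * (6 * P * D) = 6 * P * (Y ^ 3 * D)" by simp
      also have "\<dots> = 290304 * P * \<alpha>" unfolding *(1) by simp
      also have "\<dots> = Y ^ 3 * (J33311 * M * Y ^ 2 * \<alpha>)" unfolding *(3)[symmetric] by (simp add: power_numeral_reduce)
      finally have "6 * P * D = J33311 * M * Y ^ 2 * \<alpha>" using Y by (simp only: mult_cancel_left power_eq_0_iff) simp
      moreover have "D \<noteq> 0" using *(1) False by auto
      ultimately show ?L unfolding alpha nonzero X using a * ne False by auto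
    qed
  qed
qed

section \<open>The equations equivalent to the second Painleve equation\<close>

text \<open>
  A fiber-preserving transformation. Its first component is carried as a function of two variables
  that is constant along \<open>y\<close>, in order that the same rules of differentiation apply to both
  components.
\<close>

locale plane_transformation = open_plane_set W for W +
  fixes X Y :: "complex \<Rightarrow> complex \<Rightarrow> complex" and \<alpha> :: complex
  assumes analytic_XY [simp, intro]: "analytic X" "analytic Y"
    and py_X: "(x, y) \<in> W \<Longrightarrow> py X x y = 0"
    and px_X: "(x, y) \<in> W \<Longrightarrow> px X x y \<noteq> 0"
    and py_Y: "(x, y) \<in> W \<Longrightarrow> py Y x y \<noteq> 0"
begin

definition "\<rho> = (\<lambda>x y. px (px X) x y / px X x y)"

text \<open>
  The law: \<open>y'' = A\<^sub>0 + B\<^sub>0 y' + C\<^sub>0 y'^2\<close> is the pull-back of the second Painleve equation.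
\<close>

definition "C\<^sub>0 = (\<lambda>x y. - py (py Y) x y / py Y x y)"
definition "B\<^sub>0 = (\<lambda>x y. \<rho> x y - 2 * px (py Y) x y / py Y x y)"
definition "A\<^sub>0 = (\<lambda>x y. (px X x y ^ 2 * (2 * Y x y ^ 3 + X x y * Y x y + \<alpha>)
   - px (px Y) x y + \<rho> x y * px Y x y) / py Y x y)"

lemma analytic_law [simp, intro]: "analytic \<rho>" "analytic A\<^sub>0" "analytic B\<^sub>0" "analytic C\<^sub>0"
proof -
  show \<rho>: "analytic \<rho>" unfolding \<rho>_def by (rule analytic2_on_divide) (auto simp: px_X)
  show "analytic A\<^sub>0" "analytic B\<^sub>0" "analytic C\<^sub>0"
    unfolding A\<^sub>0_def B\<^sub>0_def C\<^sub>0_def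
    by (rule analytic2_on_divide analytic2_on_diff; auto simp: py_Y \<rho> intro: analytic2_on_divide)+
qed

lemma transformation_partials:
  assumes xy: "(x, y) \<in> W"
  shows "px (px X) x y = \<rho> x y * px X x y"
    and "py (px X) x y = 0" and "py (px (px X)) x y = 0" and "py \<rho> x y = 0"
    and "py (px Y) x y = px (py Y) x y" and "py (px (px Y)) x y = px (px (py Y)) x y"
    and "py (px (py Y)) x y = px (py (py Y)) x y"
proof -
  show "px (px X) x y = \<rho> x y * px X x y" using px_X[OF xy] by (simp add: \<rho>_def)
  have 1: "py (px X) x y = 0" if "(x, y) \<in> W" for x y
  proof -
    have "py (px X) x y = px (py X) x y" by (rule py_px) (simp_all add: that)
    also have "\<dots> = px (\<lambda>x y. 0) x y" by (rule partials_cong[OF open_W that py_X])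
    finally show ?thesis by simp
  qed
  have 2: "py (px (px X)) x y = 0"
  proof -
    have "py (px (px X)) x y = px (py (px X)) x y" by (rule py_px) (simp_all add: xy)
    also have "\<dots> = px (\<lambda>x y. 0) x y" by (rule partials_cong[OF open_W xy 1])
    finally show ?thesis by simp
  qed
  show "py (px X) x y = 0" "py (px (px X)) x y = 0" by (rule 1[OF xy], rule 2)
  show "py \<rho> x y = 0" unfolding \<rho>_def
    using 1[OF xy] 2 xy px_X[OF xy] by (simp add: py_divide)
  have 3: "py (px Y) x y = px (py Y) x y" if "(x, y) \<in> W" for x y
    by (rule py_px) (simp_all add: that)
  show "py (px Y) x y = px (py Y) x y" by (rule 3[OF xy])
  have "py (px (px Y)) x y = px (py (px Y)) x y" by (rule py_px) (simp_all add: xy)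
  also have "\<dots> = px (px (py Y)) x y" by (rule partials_cong[OF open_W xy 3])
  finally show "py (px (px Y)) x y = px (px (py Y)) x y" .
  show "py (px (py Y)) x y = px (py (py Y)) x y" by (rule py_px) (simp_all add: xy)
qed

lemma law_branch:
  assumes xy: "(x, y) \<in> W"
  shows "py B\<^sub>0 x y = 2 * px C\<^sub>0 x y"
proof -
  let ?e = "py Y"
  have "py B\<^sub>0 x y = py \<rho> x y - py (\<lambda>x y. 2 * px ?e x y / ?e x y) x y"
    unfolding B\<^sub>0_def by (rule py_diff) (use xy py_Y in \<open>auto intro!: analytic2_on_divide\<close>)
  also have "py (\<lambda>x y. 2 * px ?e x y / ?e x y) x y =
      (2 * px (py ?e) x y * ?e x y - 2 * px ?e x y * py ?e x y) / (?e x y * ?e x y)"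
    using xy py_Y transformation_partials[OF xy] by (simp add: py_divide partial_rules)
  finally have 1: "py B\<^sub>0 x y = 0 - (2 * px (py ?e) x y * ?e x y - 2 * px ?e x y * py ?e x y) / (?e x y * ?e x y)"
    using transformation_partials[OF xy] by simp
  have "px C\<^sub>0 x y = px (\<lambda>x y. (- 1 * py ?e x y) / ?e x y) x y" by (simp add: C\<^sub>0_def)
  also have "\<dots> = (- 1 * px (py ?e) x y * ?e x y - (- 1 * py ?e x y) * px ?e x y) / (?e x y * ?e x y)"
    using xy py_Y px_divide[of "\<lambda>x y. - 1 * py ?e x y" ?e x y]
      px_mult[of "\<lambda>x y. - 1" "py ?e" x y] by simp
  finally have 2: "px C\<^sub>0 x y =
      (- 1 * px (py ?e) x y * ?e x y - (- 1 * py ?e x y) * px ?e x y) / (?e x y * ?e x y)" .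
  show ?thesis unfolding 1 2 using py_Y[OF xy] by (simp add: field_simps)
qed

end

locale candidate = quadratic_ode W U f A B C + plane_transformation W X Y \<alpha>
  for W U f A B C X Y \<alpha>
begin

definition "satisfies_law \<longleftrightarrow>
  (\<forall>(x, y)\<in>W. A x y = A\<^sub>0 x y \<and> B x y = B\<^sub>0 x y \<and> C x y = C\<^sub>0 x y)"

text \<open>
  For the second Painleve equation itself \<open>\<Psi>\<close> is \<open>6 Y^2 + X\<close>. Under the transformation it is
  multiplied by \<open>X'^2\<close> and changed by half the Schwarzian derivative \<open>\<rho>_x - \<rho>^2 / 2\<close> of \<open>X\<close>, which
  does not depend on \<open>y\<close> and therefore disappears in \<open>k = \<Psi>_y\<close>.
\<close>

lemma relative_invariants_of_law:
  assumes satisfies_law and xy: "(x, y) \<in> W"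
  shows "\<Psi> x y = px X x y ^ 2 * (6 * Y x y ^ 2 + X x y) - px \<rho> x y / 2 + \<rho> x y ^ 2 / 4"
    and "k x y = 12 * Y x y * px X x y ^ 2 * py Y x y"
    and "u x y = 12 * px X x y ^ 2 * py Y x y ^ 2"
    and "v x y = 0"
proof -
  have law: "\<And>x y. (x, y) \<in> W \<Longrightarrow> A x y = A\<^sub>0 x y" "\<And>x y. (x, y) \<in> W \<Longrightarrow> B x y = B\<^sub>0 x y"
    "\<And>x y. (x, y) \<in> W \<Longrightarrow> C x y = C\<^sub>0 x y"
    using assms(1) by (auto simp: satisfies_law_def)
  have \<Psi>: "\<Psi> x y = px X x y ^ 2 * (6 * Y x y ^ 2 + X x y) - px \<rho> x y / 2 + \<rho> x y ^ 2 / 4"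
    if xy: "(x, y) \<in> W" for x y
  proof -
    note t = transformation_partials[OF xy] py_X[OF xy]
    let ?N = "\<lambda>x y. px X x y ^ 2 * (2 * Y x y ^ 3 + X x y * Y x y + \<alpha>) - px (px Y) x y + \<rho> x y * px Y x y"
    have N: "py ?N x y = px X x y ^ 2 * (6 * Y x y ^ 2 + X x y) * py Y x y - px (px (py Y)) x y + \<rho> x y * px (py Y) x y"
      using xy t by (simp add: partial_rules algebra_simps power2_eq_square)
    have "py A x y = py A\<^sub>0 x y" by (rule partials_cong[OF open_W xy law(1)])
    also have "\<dots> = py (\<lambda>x y. ?N x y / py Y x y) x y" by (simp add: A\<^sub>0_def)
    also have "\<dots> = (py ?N x y * py Y x y - ?N x y * py (py Y) x y) / (py Y x y * py Y x y)"
      by (rule py_divide) (use xy py_Y in auto)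
    finally have Ay: "py A x y = (py ?N x y * py Y x y - ?N x y * py (py Y) x y) / (py Y x y * py Y x y)" .
    have A: "A x y = ?N x y / py Y x y" by (simp add: law(1)[OF xy] A\<^sub>0_def)
    have "px B x y = px B\<^sub>0 x y" by (rule partials_cong[OF open_W xy law(2)])
    also have "\<dots> = px \<rho> x y - px (\<lambda>x y. 2 * px (py Y) x y / py Y x y) x y"
      unfolding B\<^sub>0_def by (rule px_diff) (use xy py_Y in \<open>auto intro!: analytic2_on_divide\<close>)
    also have "px (\<lambda>x y. 2 * px (py Y) x y / py Y x y) x y =
        (2 * px (px (py Y)) x y * py Y x y - 2 * px (py Y) x y * px (py Y) x y) / (py Y x y * py Y x y)"
      using xy py_Y by (simp add: px_divide partial_rules)
    finally have Bx: "px B x y = px \<rho> x y -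
        (2 * px (px (py Y)) x y * py Y x y - 2 * px (py Y) x y * px (py Y) x y) / (py Y x y * py Y x y)" .
    define n where "n = ?N x y"
    show ?thesis
      unfolding \<Psi>_def Ay Bx A law(2,3)[OF xy] B\<^sub>0_def C\<^sub>0_def N n_def[symmetric] using py_Y[OF xy]
      by (simp add: field_simps power2_eq_square)
  qed
  show "\<Psi> x y = px X x y ^ 2 * (6 * Y x y ^ 2 + X x y) - px \<rho> x y / 2 + \<rho> x y ^ 2 / 4" by (rule \<Psi>[OF xy])
  have py\<rho>: "py (px \<rho>) x y = 0" if xy: "(x, y) \<in> W" for x y
  proof -
    have "py (px \<rho>) x y = px (py \<rho>) x y" by (rule py_px) (simp_all add: xy)
    also have "\<dots> = px (\<lambda>x y. 0) x y" by (rule partials_cong[OF open_W xy transformation_partials(4)])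
    finally show ?thesis by simp
  qed
  have k: "k x y = 12 * Y x y * px X x y ^ 2 * py Y x y" if xy: "(x, y) \<in> W" for x y
  proof -
    have "k x y = py (\<lambda>x y. px X x y ^ 2 * (6 * Y x y ^ 2 + X x y) - px \<rho> x y / 2 + \<rho> x y ^ 2 / 4) x y"
      unfolding k_def by (rule partials_cong[OF open_W xy \<Psi>])
    also have "\<dots> = 12 * Y x y * px X x y ^ 2 * py Y x y"
      using xy transformation_partials[OF xy] py_X[OF xy] py\<rho>[OF xy] by (simp add: partial_rules)
    finally show ?thesis .
  qed
  show "k x y = 12 * Y x y * px X x y ^ 2 * py Y x y" by (rule k[OF xy])
  have u: "u x y = 12 * px X x y ^ 2 * py Y x y ^ 2" if xy: "(x, y) \<in> W" for x y
  proof -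
    have "py k x y = py (\<lambda>x y. 12 * Y x y * px X x y ^ 2 * py Y x y) x y"
      by (rule partials_cong[OF open_W xy k])
    also have "\<dots> = 12 * px X x y ^ 2 * py Y x y ^ 2 + 12 * Y x y * px X x y ^ 2 * py (py Y) x y"
      using xy transformation_partials[OF xy] by (simp add: partial_rules power2_eq_square algebra_simps)
    finally show ?thesis
      unfolding u_def k[OF xy] law(3)[OF xy] C\<^sub>0_def using py_Y[OF xy] by (simp add: field_simps)
  qed
  show "u x y = 12 * px X x y ^ 2 * py Y x y ^ 2" by (rule u[OF xy])
  have "py u x y = py (\<lambda>x y. 12 * px X x y ^ 2 * py Y x y ^ 2) x y"
    by (rule partials_cong[OF open_W xy u])
  also have "\<dots> = 24 * px X x y ^ 2 * py Y x y * py (py Y) x y"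
    using xy transformation_partials[OF xy] by (simp add: partial_rules power2_eq_square algebra_simps)
  finally show "v x y = 0"
    unfolding v_def u[OF xy] law(3)[OF xy] C\<^sub>0_def using py_Y[OF xy]
    by (simp add: field_simps power2_eq_square)
qed

text \<open>
  These derivatives depend on \<open>k\<close>, \<open>u\<close> and \<open>B\<close> only. For that reason they are available also in
  the converse direction, where \<open>A\<close> is determined last.
\<close>

lemma x_relative_invariants_of_law:
  assumes "\<forall>(x, y)\<in>W. k x y = 12 * Y x y * px X x y ^ 2 * py Y x y"
    and "\<forall>(x, y)\<in>W. u x y = 12 * px X x y ^ 2 * py Y x y ^ 2"
    and "\<forall>(x, y)\<in>W. B x y = B\<^sub>0 x y"
    and xy: "(x, y) \<in> W"
  shows "\<mu> x y = 3 * \<rho> x y * u x y"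
    and "\<mu>' x y = (3 * px \<rho> x y + 9 * \<rho> x y ^ 2) * u x y"
    and "\<kappa> x y = 12 * px X x y ^ 2 * py Y x y * (px Y x y + 5 / 2 * \<rho> x y * Y x y)"
    and "\<kappa>' x y = 12 * px X x y ^ 2 * py Y x y *
      (px (px Y) x y + 5 * \<rho> x y * px Y x y + 5 / 2 * px \<rho> x y * Y x y + 25 / 4 * \<rho> x y ^ 2 * Y x y)"
proof -
  have k: "\<And>x y. (x, y) \<in> W \<Longrightarrow> k x y = 12 * Y x y * px X x y ^ 2 * py Y x y"
    and u: "\<And>x y. (x, y) \<in> W \<Longrightarrow> u x y = 12 * px X x y ^ 2 * py Y x y ^ 2"
    and B: "\<And>x y. (x, y) \<in> W \<Longrightarrow> B x y = B\<^sub>0 x y"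
    using assms by auto
  have \<mu>: "\<mu> x y = 3 * \<rho> x y * u x y" if xy: "(x, y) \<in> W" for x y
  proof -
    have "px u x y = px (\<lambda>x y. 12 * px X x y ^ 2 * py Y x y ^ 2) x y"
      by (rule partials_cong[OF open_W xy u])
    also have "\<dots> = 24 * px X x y ^ 2 * py Y x y * (\<rho> x y * py Y x y + px (py Y) x y)"
      using xy transformation_partials[OF xy] by (simp add: partial_rules power2_eq_square algebra_simps)
    finally show ?thesis
      unfolding \<mu>_def u[OF xy] B[OF xy] B\<^sub>0_def using py_Y[OF xy]
      by (simp add: field_simps power2_eq_square)
  qed
  show "\<mu> x y = 3 * \<rho> x y * u x y" by (rule \<mu>[OF xy])
  have "px \<mu> x y = px (\<lambda>x y. 3 * \<rho> x y * u x y) x y" by (rule partials_cong[OF open_W xy \<mu>])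
  also have "\<dots> = 3 * px \<rho> x y * u x y + 3 * \<rho> x y * px u x y"
    using xy by (simp add: partial_rules)
  finally show "\<mu>' x y = (3 * px \<rho> x y + 9 * \<rho> x y ^ 2) * u x y"
    unfolding \<mu>'_def x_partials(2) \<mu>[OF xy] by (simp add: power2_eq_square algebra_simps)
  have \<kappa>: "\<kappa> x y = 12 * px X x y ^ 2 * py Y x y * (px Y x y + 5 / 2 * \<rho> x y * Y x y)"
    if xy: "(x, y) \<in> W" for x y
  proof -
    have "px k x y = px (\<lambda>x y. 12 * Y x y * px X x y ^ 2 * py Y x y) x y"
      by (rule partials_cong[OF open_W xy k])
    also have "\<dots> = 12 * px X x y ^ 2 * (px Y x y * py Y x y + 2 * \<rho> x y * Y x y * py Y x y + Y x y * px (py Y) x y)"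
      using xy transformation_partials[OF xy] by (simp add: partial_rules power2_eq_square algebra_simps)
    finally show ?thesis
      unfolding \<kappa>_def k[OF xy] B[OF xy] B\<^sub>0_def using py_Y[OF xy]
      by (simp add: field_simps power2_eq_square)
  qed
  show "\<kappa> x y = 12 * px X x y ^ 2 * py Y x y * (px Y x y + 5 / 2 * \<rho> x y * Y x y)" by (rule \<kappa>[OF xy])
  have "px \<kappa> x y = px (\<lambda>x y. 12 * px X x y ^ 2 * py Y x y * (px Y x y + 5 / 2 * \<rho> x y * Y x y)) x y"
    by (rule partials_cong[OF open_W xy \<kappa>])
  also have "\<dots> = 12 * px X x y ^ 2 * ((2 * \<rho> x y * py Y x y + px (py Y) x y) * (px Y x y + 5 / 2 * \<rho> x y * Y x y)
      + py Y x y * (px (px Y) x y + 5 / 2 * px \<rho> x y * Y x y + 5 / 2 * \<rho> x y * px Y x y))"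
    using xy transformation_partials[OF xy] by (simp add: partial_rules; simp add: power2_eq_square field_simps)
  finally have \<kappa>x: "px \<kappa> x y = 12 * px X x y ^ 2 * ((2 * \<rho> x y * py Y x y + px (py Y) x y) * (px Y x y + 5 / 2 * \<rho> x y * Y x y)
      + py Y x y * (px (px Y) x y + 5 / 2 * px \<rho> x y * Y x y + 5 / 2 * \<rho> x y * px Y x y))" .
  show "\<kappa>' x y = 12 * px X x y ^ 2 * py Y x y *
      (px (px Y) x y + 5 * \<rho> x y * px Y x y + 5 / 2 * px \<rho> x y * Y x y + 25 / 4 * \<rho> x y ^ 2 * Y x y)"
    unfolding \<kappa>'_def \<kappa>x \<kappa>[OF xy] B[OF xy] B\<^sub>0_def using py_Y[OF xy]
    by (simp add: field_simps power2_eq_square)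
qed

end

section \<open>From the transformation law to the invariants\<close>

context quadratic_ode
begin

text \<open>
  The numerator of \<open>I1_331\<close> is \<open>T + R Q^2\<close>, where \<open>Q\<close> is the numerator of \<open>I1_31\<close>. At a point with
  \<open>Q = 0\<close> the square contributes nothing to \<open>X3 I1_331\<close>.
\<close>

lemma I1_3331_eq:
  assumes v0: "\<And>x y. (x, y) \<in> W \<Longrightarrow> v x y = 0"
    and T: "analytic T" and R: "analytic R"
    and TR: "\<And>x y. (x, y) \<in> W \<Longrightarrow> \<mu>' x y + 6 * \<Psi> x y * u x y + 5 * k x y ^ 2 = T x y + R x y * \<mu> x y ^ 2"
    and Ru: "\<And>x y. (x, y) \<in> W \<Longrightarrow> 6 * R x y * u x y = 7"
    and z: "(x, y, p) \<in> U" "a1 \<noteq> 0" "a4 \<noteq> 0" and I131: "I1_31 f x y p a1 a2 a4 = 0"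
  shows "I1_3331 f x y p a1 a2 a4 =
    (px T x y + p * py T x y + (B x y + 2 * C x y * p - 10 * \<sigma> x y p a1 a2 a4) * T x y) / (a1 ^ 2 * a4 ^ 5)
    + 12 * I1 f x y p a1 a2 a4 * I1_3 f x y p a1 a2 a4"
proof -
  have wv: "w x y = 0" "\<nu> x y = 0" if xy: "(x, y) \<in> W" for x y
    using partials_cong[OF open_W xy v0] v0[OF xy] by (simp_all add: w_def \<nu>_def)
  let ?Q = "\<lambda>x y p a1 a2 a4. \<mu> x y - 6 * \<sigma> x y p a1 a2 a4 * u x y"
  let ?r = "\<lambda>x y p a1 a2 a4. \<iota>1 x y p a1 a2 a4 * \<iota>1 x y p a1 a2 a4 * \<iota>4 x y p a1 a2 a4 * \<iota>4 x y p a1 a2 a4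
    * \<iota>4 x y p a1 a2 a4 * \<iota>4 x y p a1 a2 a4"
  have eq: "bundle_eq U (I1_331 f) (\<lambda>x y p a1 a2 a4. (T x y + R x y * (?Q x y p a1 a2 a4 * ?Q x y p a1 a2 a4)) * ?r x y p a1 a2 a4)"
    unfolding bundle_eq_def
  proof (intro allI impI)
    fix x y p a1 a2 a4 :: complex assume z: "(x, y, p) \<in> U" "a1 \<noteq> 0" "a4 \<noteq> 0"
    note xy = U_W[OF z(1)]
    define s where "s = \<sigma> x y p a1 a2 a4"
    have "\<mu>' x y + 2 * p * \<nu> x y + p * p * w x y + A x y * v x y + 6 * \<Psi> x y * u x y + 5 * k x y * k x y
      - 14 * s * (\<mu> x y + p * v x y) + 42 * s * s * u x y
      = T x y + R x y * ((\<mu> x y - 6 * s * u x y) * (\<mu> x y - 6 * s * u x y))"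
      using TR[OF xy] Ru[OF xy] v0[OF xy] wv[OF xy] by algebra
    thus "I1_331 f x y p a1 a2 a4 = (T x y + R x y * (?Q x y p a1 a2 a4 * ?Q x y p a1 a2 a4)) * ?r x y p a1 a2 a4"
      unfolding I1_331_bundle_eq[unfolded bundle_eq_def, rule_format, OF z] s_def by simp
  qed
  note xy = U_W[OF z(1)]
  have Q: "\<mu> x y = 6 * \<sigma> x y p a1 a2 a4 * u x y"
    using I131 I1_31_bundle_eq[unfolded bundle_eq_def, rule_format, OF z, of a2] z v0[OF xy]
    by (simp add: \<iota>1_def \<iota>4_def)
  have "X3 f (I1_331 f) x y p a1 a2 a4 =
    (px T x y + p * py T x y + (B x y + 2 * C x y * p - 10 * \<sigma> x y p a1 a2 a4) * T x y) *
      (?r x y p a1 a2 a4 * \<iota>4 x y p a1 a2 a4)"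
    unfolding bundle_eq_cong(2)[OF open_U eq z] using z xy T R
    by (simp add: X_rules generated_rules Q; simp add: field_simps)
  also have "?r x y p a1 a2 a4 * \<iota>4 x y p a1 a2 a4 = 1 / (a1 ^ 2 * a4 ^ 5)"
    by (simp add: \<iota>1_def \<iota>4_def power_numeral_reduce)
  finally show ?thesis
    using invariants_by_X3(5) z by (simp add: bundle_eq_def mult.assoc)
qed

end

context candidate
begin

definition "P = (\<lambda>x y p. (px Y x y + p * py Y x y) / px X x y)"

text \<open>
  With \<open>q = X' P\<close> the normalization is \<open>\<sigma> = \<rho> / 2\<close>, \<open>a4 = q / Y\<close>, \<open>a1 = - Y^3 X'^2 Y_y / q^2\<close>. The
  invariants are found by substitution; in each of them \<open>\<rho>\<close> and its derivative cancel.
\<close>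

proposition invariants_of_law:
  assumes "satisfies_law" and z: "(x, y, p) \<in> U" and Y0: "Y x y \<noteq> 0" and P0: "P x y p \<noteq> 0"
  shows "\<exists>!a. normalized f x y p a"
    and "normalized f x y p (a1, a2, a4) \<Longrightarrow>
      I1_33 f x y p a1 a2 a4 = - Y x y * (384 * Y x y ^ 3 + 72 * X x y * Y x y + 12 * \<alpha>) / P x y p ^ 2 \<and>
      I1_331 f x y p a1 a2 a4 = 1152 + 72 * X x y / Y x y ^ 2 \<and>
      I1_3331 f x y p a1 a2 a4 = 4032 + 72 / (Y x y * P x y p) \<and>
      I1_33311 f x y p a1 a2 a4 = - 4032 * P x y p ^ 2 / Y x y ^ 4"
proof -
  note xy = U_W[OF z]
  have law: "\<And>x y. (x, y) \<in> W \<Longrightarrow> A x y = A\<^sub>0 x y" "\<And>x y. (x, y) \<in> W \<Longrightarrow> B x y = B\<^sub>0 x y"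
    "\<And>x y. (x, y) \<in> W \<Longrightarrow> C x y = C\<^sub>0 x y"
    using assms(1) by (auto simp: satisfies_law_def)
  note rel = relative_invariants_of_law[OF assms(1)]
  have "\<forall>(x, y)\<in>W. k x y = 12 * Y x y * px X x y ^ 2 * py Y x y"
    "\<forall>(x, y)\<in>W. u x y = 12 * px X x y ^ 2 * py Y x y ^ 2" "\<forall>(x, y)\<in>W. B x y = B\<^sub>0 x y"
    using rel law by auto
  note xrel = x_relative_invariants_of_law[OF this]
  have nz: "px X x y \<noteq> 0" "py Y x y \<noteq> 0" using px_X[OF xy] py_Y[OF xy] by auto
  define q where "q = px Y x y + p * py Y x y"
  have Pq: "P x y p = q / px X x y" by (simp add: P_def q_def)
  have q0: "q \<noteq> 0" using P0 Pq by auto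
  define h where "h = (B x y + 2 * C x y * p) / 2"
  define b1 where "b1 = - (Y x y ^ 3 * px X x y ^ 2 * py Y x y) / q ^ 2"
  define b4 where "b4 = q / Y x y"
  define b2 where "b2 = (\<rho> x y / 2 - h) * b1 / b4"
  have b: "b1 \<noteq> 0" "b4 \<noteq> 0" using q0 Y0 nz by (auto simp: b1_def b4_def)
  have u0: "u x y \<noteq> 0" and k0: "k x y \<noteq> 0" using rel(2,3)[OF xy] nz Y0 by auto
  have norm: "normalized f x y p (a1, a2, a4) \<longleftrightarrow> (a1, a2, a4) = (b1, b2, b4)" for a1 a2 a4
  proof -
    define s where "s = \<sigma> x y p a1 a2 a4"
    have k_eq: "k x y = 12 * px X x y ^ 2 * py Y x y * Y x y" using rel(2)[OF xy] by simp
    have 1: "\<mu> x y + p * v x y = 6 * s * u x y \<longleftrightarrow> s = \<rho> x y / 2"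
      unfolding xrel(1)[OF xy] rel(4)[OF xy] using u0 by (auto simp: field_simps)
    have 2: "\<kappa> x y + p * u x y - 5 * s * k x y = k x y * a4 \<longleftrightarrow> a4 = b4" if "s = \<rho> x y / 2"
    proof -
      have "\<kappa> x y + p * u x y - 5 * s * k x y = 12 * px X x y ^ 2 * py Y x y * q"
        unfolding xrel(3)[OF xy] rel(3)[OF xy] k_eq that
        by (simp add: q_def algebra_simps power2_eq_square)
      thus ?thesis unfolding k_eq b4_def using nz Y0 by (auto simp: field_simps)
    qed
    have 3: "k x y = - 12 * a1 * b4 ^ 2 \<longleftrightarrow> a1 = b1"
      unfolding k_eq b4_def b1_def using nz Y0 q0
      by (auto simp: field_simps power2_eq_square power3_eq_cube)
    have 4: "s = \<rho> x y / 2 \<longleftrightarrow> a2 = b2" if "a1 = b1" "a4 = b4"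
      unfolding s_def \<sigma>_def that h_def[symmetric] b2_def using b by (auto simp: field_simps)
    show ?thesis
      unfolding normalized_iff[OF z] s_def[symmetric] using 1 2 3 4 b by auto
  qed
  show "\<exists>!a. normalized f x y p a"
  proof (rule ex1I)
    show "normalized f x y p (b1, b2, b4)" by (simp add: norm)
    show "a = (b1, b2, b4)" if "normalized f x y p a" for a
      using that norm by (cases a) auto
  qed
  assume "normalized f x y p (a1, a2, a4)"
  hence a: "a1 = b1" "a2 = b2" "a4 = b4" and n: "normalized f x y p (b1, b2, b4)"
    using norm by auto
  have ni: "I1 f x y p b1 b2 b4 = - 12" "I1_3 f x y p b1 b2 b4 = - 12" "I1_31 f x y p b1 b2 b4 = 0"
    using n by (simp_all add: normalized_def)
  have s: "\<sigma> x y p b1 b2 b4 = \<rho> x y / 2"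
    unfolding \<sigma>_def h_def[symmetric] b2_def using b by simp
  have wv: "w x y = 0" "\<nu> x y = 0"
    using partials_cong[OF open_W xy rel(4)] rel(4)[OF xy] by (simp_all add: w_def \<nu>_def)
  have J33: "I1_33 f x y p b1 b2 b4 = - Y x y * (384 * Y x y ^ 3 + 72 * X x y * Y x y + 12 * \<alpha>) / P x y p ^ 2"
  proof -
    have val: "\<kappa>' x y + 2 * p * \<mu> x y + p * p * v x y + A x y * u x y + 5 * \<Psi> x y * k x y
      - 12 * \<sigma> x y p b1 b2 b4 * (\<kappa> x y + p * u x y) + 30 * \<sigma> x y p b1 b2 b4 * \<sigma> x y p b1 b2 b4 * k x y
      = 12 * px X x y ^ 4 * py Y x y * (32 * Y x y ^ 3 + 6 * X x y * Y x y + \<alpha>)"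
      unfolding s xrel[OF xy] rel[OF xy] law(1)[OF xy] A\<^sub>0_def using nz
      by (simp add: field_simps power_numeral_reduce)
    show ?thesis
      unfolding normalized_values(1)[OF z n] val
      unfolding rel(2)[OF xy] Pq b4_def using nz Y0 q0
      by (simp add: field_simps power_numeral_reduce)
  qed
  have J331: "I1_331 f x y p b1 b2 b4 = 1152 + 72 * X x y / Y x y ^ 2"
  proof -
    have val: "\<mu>' x y + 2 * p * \<nu> x y + p * p * w x y + A x y * v x y + 6 * \<Psi> x y * u x y + 5 * k x y * k x y
      - 14 * \<sigma> x y p b1 b2 b4 * (\<mu> x y + p * v x y) + 42 * \<sigma> x y p b1 b2 b4 * \<sigma> x y p b1 b2 b4 * u x y
      = 72 * px X x y ^ 4 * py Y x y ^ 2 * (16 * Y x y ^ 2 + X x y)"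
      unfolding s wv xrel[OF xy] rel[OF xy]
      by (simp add: field_simps power_numeral_reduce)
    show ?thesis
      unfolding normalized_values(2)[OF z n] val
      unfolding rel(2)[OF xy] using nz Y0
      by (simp add: field_simps power_numeral_reduce)
  qed
  have J3331: "I1_3331 f x y p b1 b2 b4 = 4032 + 72 / (Y x y * P x y p)"
  proof -
    let ?T = "\<lambda>x y. 72 * px X x y ^ 4 * py Y x y ^ 2 * (16 * Y x y ^ 2 + X x y)"
    let ?R = "\<lambda>x y. 7 / (72 * px X x y ^ 2 * py Y x y ^ 2)"
    note t = transformation_partials[OF xy] py_X[OF xy]
    have "I1_3331 f x y p b1 b2 b4 =
      (px ?T x y + p * py ?T x y + (B x y + 2 * C x y * p - 10 * \<sigma> x y p b1 b2 b4) * ?T x y) / (b1 ^ 2 * b4 ^ 5)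
      + 12 * I1 f x y p b1 b2 b4 * I1_3 f x y p b1 b2 b4"
    proof (rule I1_3331_eq[OF rel(4) _ _ _ _ z b ni(3)])
      show "analytic ?R" using px_X py_Y by (intro analytic2_on_divide) auto
      show "6 * ?R x y * u x y = 7" if "(x, y) \<in> W" for x y
        using that px_X py_Y by (simp add: rel)
      show "\<mu>' x y + 6 * \<Psi> x y * u x y + 5 * k x y ^ 2 = ?T x y + ?R x y * \<mu> x y ^ 2" if "(x, y) \<in> W" for x y
        unfolding xrel[OF that] rel[OF that] using px_X[OF that] py_Y[OF that]
        by (simp add: field_simps power_numeral_reduce)
    qed auto
    also have "px ?T x y = 72 * px X x y ^ 4 * py Y x y * ((4 * \<rho> x y * py Y x y + 2 * px (py Y) x y) * (16 * Y x y ^ 2 + X x y)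
        + py Y x y * (32 * Y x y * px Y x y + px X x y))"
      using xy t by (simp add: partial_rules; simp add: algebra_simps power_numeral_reduce)
    also have "py ?T x y = 72 * px X x y ^ 4 * py Y x y * (2 * py (py Y) x y * (16 * Y x y ^ 2 + X x y)
        + 32 * Y x y * py Y x y ^ 2)"
      using xy t by (simp add: partial_rules; simp add: algebra_simps power_numeral_reduce)
    also have "72 * px X x y ^ 4 * py Y x y * ((4 * \<rho> x y * py Y x y + 2 * px (py Y) x y) * (16 * Y x y ^ 2 + X x y)
        + py Y x y * (32 * Y x y * px Y x y + px X x y))
      + p * (72 * px X x y ^ 4 * py Y x y * (2 * py (py Y) x y * (16 * Y x y ^ 2 + X x y)
        + 32 * Y x y * py Y x y ^ 2))
      + (B x y + 2 * C x y * p - 10 * \<sigma> x y p b1 b2 b4) * ?T x y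
      = 72 * px X x y ^ 4 * py Y x y ^ 2 * (32 * Y x y * q + px X x y)"
      unfolding s law(2,3)[OF xy] B\<^sub>0_def C\<^sub>0_def q_def using nz
      by (simp add: field_simps power_numeral_reduce)
    finally have val: "I1_3331 f x y p b1 b2 b4 =
      72 * px X x y ^ 4 * py Y x y ^ 2 * (32 * Y x y * q + px X x y) / (b1 ^ 2 * b4 ^ 5)
      + 12 * I1 f x y p b1 b2 b4 * I1_3 f x y p b1 b2 b4" .
    show ?thesis
      unfolding val ni unfolding b1_def b4_def Pq using nz Y0 q0
      by (simp add: field_simps power_numeral_reduce)
  qed
  have J33311: "I1_33311 f x y p b1 b2 b4 = - 4032 * P x y p ^ 2 / Y x y ^ 4"
  proof -
    have r: "6 * u x y * w x y = 7 * v x y ^ 2" "6 * u x y * \<nu> x y = 7 * \<mu> x y * v x y" if "(x, y) \<in> W" for x y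
      using partials_cong[OF open_W that rel(4)] rel(4)[OF that] by (simp_all add: w_def \<nu>_def)
    have val6: "6 * u x y * b1 * I1_33311 f x y p b1 b2 b4 = 168 * u x y ^ 2 / (b1 * b4 ^ 2) * - 12"
      by (subst I1_33311_eq[OF _ _ z b u0 ni(3)]) (use r rel(4)[OF xy] ni in auto)
    have "I1_33311 f x y p b1 b2 b4 = 6 * u x y * b1 * I1_33311 f x y p b1 b2 b4 / (6 * u x y * b1)"
      using u0 b by simp
    also have "\<dots> = - 336 * u x y / (b1 ^ 2 * b4 ^ 2)"
      unfolding val6 using u0 b by (simp add: field_simps power2_eq_square)
    finally have val: "I1_33311 f x y p b1 b2 b4 = - 336 * u x y / (b1 ^ 2 * b4 ^ 2)" .
    show ?thesis
      unfolding val unfolding rel(3)[OF xy] b1_def b4_def Pq using nz Y0 q0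
      by (simp add: field_simps power_numeral_reduce)
  qed
  show "I1_33 f x y p a1 a2 a4 = - Y x y * (384 * Y x y ^ 3 + 72 * X x y * Y x y + 12 * \<alpha>) / P x y p ^ 2 \<and>
      I1_331 f x y p a1 a2 a4 = 1152 + 72 * X x y / Y x y ^ 2 \<and>
      I1_3331 f x y p a1 a2 a4 = 4032 + 72 / (Y x y * P x y p) \<and>
      I1_33311 f x y p a1 a2 a4 = - 4032 * P x y p ^ 2 / Y x y ^ 4"
    unfolding a using J33 J331 J3331 J33311 by blast
qed

end

section \<open>From the invariants to the transformation law\<close>

lemma polynomial_coefficients_zero:
  fixes c0 c1 c2 c3 :: complex
  assumes "infinite S" "\<And>t. t \<in> S \<Longrightarrow> c0 + c1 * t + c2 * t ^ 2 + c3 * t ^ 3 = 0"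
  shows "c0 = 0" "c1 = 0" "c2 = 0" "c3 = 0"
proof -
  have "S \<subseteq> {t. poly [:c0, c1, c2, c3:] t = 0}"
    using assms(2) by (auto simp: algebra_simps power_numeral_reduce)
  hence "[:c0, c1, c2, c3:] = 0"
    using assms(1) poly_roots_finite finite_subset by blast
  thus "c0 = 0" "c1 = 0" "c2 = 0" "c3 = 0" by simp_all
qed

context candidate
begin

text \<open>
  The hypothesis \<open>cover\<close> makes the invariants available for infinitely many \<open>p\<close> over each
  \<open>(x, y)\<close>, so that polynomials in \<open>p\<close> can be compared coefficientwise; that \<open>X \<noteq> 0\<close> is used to
  cancel \<open>X\<close> in the relation obtained by differentiation along \<open>y\<close>.
\<close>

proposition law_of_invariants:
  assumes cover: "\<And>x y. (x, y) \<in> W \<Longrightarrow> \<exists>p0 r. r > 0 \<and> (\<forall>p\<in>ball p0 r. (x, y, p) \<in> U)"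
    and XY0: "\<And>x y. (x, y) \<in> W \<Longrightarrow> X x y \<noteq> 0 \<and> Y x y \<noteq> 0"
    and P0: "\<And>x y p. (x, y, p) \<in> U \<Longrightarrow> P x y p \<noteq> 0"
    and unique: "\<And>x y p. (x, y, p) \<in> U \<Longrightarrow> \<exists>!a. normalized f x y p a"
    and J: "\<And>x y p a1 a2 a4. (x, y, p) \<in> U \<Longrightarrow> normalized f x y p (a1, a2, a4) \<Longrightarrow>
      I1_33 f x y p a1 a2 a4 = - Y x y * (384 * Y x y ^ 3 + 72 * X x y * Y x y + 12 * \<alpha>) / P x y p ^ 2 \<and>
      I1_331 f x y p a1 a2 a4 = 1152 + 72 * X x y / Y x y ^ 2 \<and>
      I1_3331 f x y p a1 a2 a4 = 4032 + 72 / (Y x y * P x y p) \<and>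
      I1_33311 f x y p a1 a2 a4 = - 4032 * P x y p ^ 2 / Y x y ^ 4"
  shows satisfies_law
proof -
  have normal: "\<exists>a1 a2 a4. normalized f x y p (a1, a2, a4)" if "(x, y, p) \<in> U" for x y p
    using unique[OF that] by (metis prod_cases3)
  have ku0: "k x y \<noteq> 0" "u x y \<noteq> 0" if "(x, y) \<in> W" for x y
  proof -
    from cover[OF that] obtain p0 where p0: "(x, y, p0) \<in> U" using centre_in_ball by blast
    obtain a1 a2 a4 where n: "normalized f x y p0 (a1, a2, a4)" using normal[OF p0] by blast
    show "k x y \<noteq> 0" by (rule normalized_k_nonzero[OF p0 n])
    show "u x y \<noteq> 0" by (rule unique_normalization_u_nonzero[OF p0 n unique[OF p0]])
  qed
  have infinite_ball: "infinite (ball p0 r)" if "r > 0" for p0 :: complex and r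
    using uncountable_ball[OF that, of p0] countable_finite by blast

  \<comment> \<open>By the last normalization equation \<open>6 u \<sigma> = \<mu> + p v\<close>; elimination of \<open>\<sigma>\<close> from \<open>I1_331\<close>
    leaves a polynomial of degree two in \<open>p\<close>.\<close>
  have rel331:
    "6 * u x y * w x y = 7 * v x y ^ 2" "6 * u x y * \<nu> x y = 7 * \<mu> x y * v x y"
    "6 * u x y * (\<mu>' x y + A x y * v x y + 6 * \<Psi> x y * u x y + 5 * k x y ^ 2) - 7 * \<mu> x y ^ 2
       = 6 * u x y * k x y ^ 2 * (8 + X x y / (2 * Y x y ^ 2))"
    if xy: "(x, y) \<in> W" for x y
  proof -
    obtain p0 r where r: "r > 0" "\<And>p. p \<in> ball p0 r \<Longrightarrow> (x, y, p) \<in> U" using cover[OF xy] by blast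
    define c0 where "c0 = 6 * u x y * (\<mu>' x y + A x y * v x y + 6 * \<Psi> x y * u x y + 5 * k x y ^ 2)
      - 7 * \<mu> x y ^ 2 - 6 * u x y * k x y ^ 2 * (8 + X x y / (2 * Y x y ^ 2))"
    define c1 where "c1 = 12 * u x y * \<nu> x y - 14 * \<mu> x y * v x y"
    define c2 where "c2 = 6 * u x y * w x y - 7 * v x y ^ 2"
    have "c0 + c1 * p + c2 * p ^ 2 + 0 * p ^ 3 = 0" if p: "p \<in> ball p0 r" for p
    proof -
      note z = r(2)[OF p]
      obtain a1 a2 a4 where n: "normalized f x y p (a1, a2, a4)" using normal[OF z] by blast
      define s where "s = \<sigma> x y p a1 a2 a4"
      have s: "\<mu> x y + p * v x y = 6 * s * u x y" using n normalized_iff[OF z] unfolding s_def by blast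
      define Q where "Q = \<mu>' x y + 2 * p * \<nu> x y + p * p * w x y
        + A x y * v x y + 6 * \<Psi> x y * u x y + 5 * k x y * k x y - 14 * s * (\<mu> x y + p * v x y) + 42 * s * s * u x y"
      have e: "144 * Q / k x y ^ 2 = 1152 + 72 * X x y / Y x y ^ 2"
        using J[OF z n] normalized_values(2)[OF z n] by (simp add: Q_def s_def)
      have "Q = 144 * Q / k x y ^ 2 * (k x y ^ 2 / 144)" using ku0[OF xy] by simp
      also have "\<dots> = k x y ^ 2 * (8 + X x y / (2 * Y x y ^ 2))"
        unfolding e using XY0[OF xy] by (simp add: field_simps)
      finally have "6 * u x y * Q = 6 * u x y * k x y ^ 2 * (8 + X x y / (2 * Y x y ^ 2))" by simp
      moreover have "6 * u x y * Q = 6 * u x y * (\<mu>' x y + 2 * p * \<nu> x y + p * p * w x y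
        + A x y * v x y + 6 * \<Psi> x y * u x y + 5 * k x y * k x y) - 7 * (\<mu> x y + p * v x y) ^ 2"
        unfolding Q_def using s by algebra
      ultimately show ?thesis
        unfolding c0_def c1_def c2_def by (simp add: algebra_simps power2_eq_square)
    qed
    from polynomial_coefficients_zero[OF infinite_ball[OF r(1)] this]
    have "c0 = 0" "c1 = 0" "c2 = 0" by auto
    thus "6 * u x y * w x y = 7 * v x y ^ 2" "6 * u x y * \<nu> x y = 7 * \<mu> x y * v x y"
      "6 * u x y * (\<mu>' x y + A x y * v x y + 6 * \<Psi> x y * u x y + 5 * k x y ^ 2) - 7 * \<mu> x y ^ 2
       = 6 * u x y * k x y ^ 2 * (8 + X x y / (2 * Y x y ^ 2))"
      unfolding c0_def c1_def c2_def by (simp_all add: algebra_simps)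
  qed

  \<comment> \<open>Up to the factor \<open>6 u\<close>, \<open>G = n0 + n1 P\<close> is the numerator of \<open>I1_3\<close>. Elimination of \<open>a1\<close>
    turns the value of \<open>I1_33311\<close> into a cubic equation for \<open>P\<close> with coefficients \<open>c0\<close>, ..., \<open>c3\<close>.\<close>
  have rel33311: "v x y = 0" "12 * u x y ^ 3 * px X x y ^ 2 * Y x y ^ 4 = k x y ^ 4 * py Y x y ^ 2"
    "6 * u x y * \<kappa> x y - 5 * k x y * \<mu> x y = 6 * u x y ^ 2 * px Y x y / py Y x y"
    if xy: "(x, y) \<in> W" for x y
  proof -
    obtain p0 r where r: "r > 0" "\<And>p. p \<in> ball p0 r \<Longrightarrow> (x, y, p) \<in> U" using cover[OF xy] by blast
    note nz = px_X[OF xy] py_Y[OF xy] and k0 = ku0(1)[OF xy] and u0 = ku0(2)[OF xy]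
    have Y0: "Y x y \<noteq> 0" using XY0[OF xy] by simp
    define g0 where "g0 = 6 * u x y * \<kappa> x y - 5 * k x y * \<mu> x y"
    define g1 where "g1 = 6 * u x y ^ 2 - 5 * k x y * v x y"
    define n1 where "n1 = g1 * px X x y / py Y x y"
    define n0 where "n0 = g0 - g1 * px Y x y / py Y x y"
    define e where "e = 12 * k x y * v x y * Y x y + 48 * u x y ^ 2 * Y x y"
    define c0 where "c0 = n0 ^ 2 * k x y * v x y * Y x y ^ 4"
    define c1 where "c1 = Y x y ^ 4 * (2 * n0 * n1 * k x y * v x y + n0 ^ 2 * e)"
    define c2 where "c2 = Y x y ^ 4 * (n1 ^ 2 * k x y * v x y + 2 * n0 * n1 * e)"
    define c3 where "c3 = Y x y ^ 4 * n1 ^ 2 * e - 144 * u x y ^ 3 * k x y ^ 4 * Y x y"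
    have "c0 + c1 * t + c2 * t ^ 2 + c3 * t ^ 3 = 0" if t: "t \<in> P x y ` ball p0 r" for t
    proof -
      obtain p where p: "p \<in> ball p0 r" and t: "t = P x y p" using t by blast
      note z = r(2)[OF p]
      have t0: "t \<noteq> 0" using P0[OF z] t by simp
      obtain a1 a2 a4 where n: "normalized f x y p (a1, a2, a4)" using normal[OF z] by blast
      define s where "s = \<sigma> x y p a1 a2 a4"
      have ni: "a1 \<noteq> 0" "a4 \<noteq> 0" "k x y = - 12 * a1 * a4 ^ 2"
        "\<kappa> x y + p * u x y - 5 * s * k x y = k x y * a4" "\<mu> x y + p * v x y = 6 * s * u x y"
        using n normalized_iff[OF z] unfolding s_def by blast+
      have nI: "I1 f x y p a1 a2 a4 = - 12" "I1_3 f x y p a1 a2 a4 = - 12" "I1_31 f x y p a1 a2 a4 = 0"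
        using n by (simp_all add: normalized_def)
      define G where "G = n0 + n1 * t"
      have G: "G = 6 * u x y * (k x y * a4)"
      proof -
        have "G = g0 + g1 * p" unfolding G_def n0_def n1_def t P_def using nz by (simp add: field_simps)
        also have "\<dots> = 6 * u x y * (k x y * a4)"
          unfolding g0_def g1_def ni(4)[symmetric] using ni(5) by algebra
        finally show ?thesis .
      qed
      have "6 * u x y * a1 * I1_33311 f x y p a1 a2 a4 =
        7 * v x y * (I1_3331 f x y p a1 a2 a4 - 22 * I1 f x y p a1 a2 a4 * I1_3 f x y p a1 a2 a4)
        + 168 * u x y ^ 2 / (a1 * a4 ^ 2) * I1_3 f x y p a1 a2 a4"
        by (rule I1_33311_eq[OF rel331(1,2) z ni(1,2) u0 nI(3)])
      hence E: "6 * u x y * a1 * (- 4032 * t ^ 2 / Y x y ^ 4) = 7 * v x y * (864 + 72 / (Y x y * t))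
        - 2016 * u x y ^ 2 / (a1 * a4 ^ 2)"
        using J[OF z n] unfolding nI t by (simp add: algebra_simps)
      have a14: "1 / (a1 * a4 ^ 2) = - 12 / k x y" using ni by (simp add: field_simps)
      have "2016 * u x y ^ 2 / (a1 * a4 ^ 2) = 2016 * u x y ^ 2 * (1 / (a1 * a4 ^ 2))" by simp
      also have "\<dots> = - 24192 * u x y ^ 2 / k x y" unfolding a14 by simp
      finally have a14': "2016 * u x y ^ 2 / (a1 * a4 ^ 2) = - 24192 * u x y ^ 2 / k x y" .
      \<comment> \<open>From \<open>k = - 12 a1 a4^2\<close> and \<open>G = 6 u k a4\<close>.\<close>
      have a1: "a1 = - 3 * u x y ^ 2 * k x y ^ 3 / G ^ 2"
        unfolding G using ni(1,2) k0 u0 unfolding ni(3) by (simp add: field_simps power_numeral_reduce)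
      have G0: "G \<noteq> 0" unfolding G using ni(2) k0 u0 by simp
      have E': "6 * u x y * (- 3 * u x y ^ 2 * k x y ^ 3 / G ^ 2) * (- 4032 * t ^ 2 / Y x y ^ 4)
        = 7 * v x y * (864 + 72 / (Y x y * t)) + 24192 * u x y ^ 2 / k x y"
        using E unfolding a1[symmetric] a14' by simp
      have "144 * u x y ^ 3 * k x y ^ 4 * Y x y * t ^ 3 =
          6 * u x y * (- 3 * u x y ^ 2 * k x y ^ 3 / G ^ 2) * (- 4032 * t ^ 2 / Y x y ^ 4) *
          (G ^ 2 * Y x y ^ 5 * t * k x y / 504)"
        using Y0 G0 by (simp add: field_simps power_numeral_reduce)
      also have "\<dots> = G ^ 2 * Y x y ^ 4 * (e * t + k x y * v x y)"
        unfolding E' e_def using k0 Y0 t0 by (simp add: field_simps power_numeral_reduce)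
      finally have "144 * u x y ^ 3 * k x y ^ 4 * Y x y * t ^ 3 = G ^ 2 * Y x y ^ 4 * (e * t + k x y * v x y)" .
      thus ?thesis unfolding c0_def c1_def c2_def c3_def G_def
        by (simp add: algebra_simps power_numeral_reduce)
    qed
    moreover have "infinite (P x y ` ball p0 r)"
    proof -
      have "inj_on (P x y) (ball p0 r)" using nz by (auto simp: inj_on_def P_def)
      thus ?thesis using infinite_ball[OF r(1)] finite_image_iff by blast
    qed
    ultimately have c: "c0 = 0" "c1 = 0" "c2 = 0" "c3 = 0"
      using polynomial_coefficients_zero[of "P x y ` ball p0 r" c0 c1 c2 c3] by blast+
    have c3: "Y x y ^ 4 * n1 ^ 2 * e = 144 * u x y ^ 3 * k x y ^ 4 * Y x y" using c(4) by (simp add: c3_def)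
    hence ne: "n1 \<noteq> 0" "e \<noteq> 0" using k0 u0 Y0 by auto
    have "n0 = 0"
    proof (cases "v x y = 0")
      case True
      thus ?thesis using c(2) ne Y0 by (simp add: c1_def)
    next
      case False
      thus ?thesis using c(1) k0 Y0 by (simp add: c0_def)
    qed
    thus v0: "v x y = 0" using c(3) ne Y0 k0 by (simp add: c2_def)
    have g: "g1 = 6 * u x y ^ 2" "g0 = g1 * px Y x y / py Y x y"
      using v0 \<open>n0 = 0\<close> by (simp_all add: g1_def n0_def)
    show "6 * u x y * \<kappa> x y - 5 * k x y * \<mu> x y = 6 * u x y ^ 2 * px Y x y / py Y x y"
      using g by (simp add: g0_def)
    have "144 * u x y ^ 2 * Y x y * (12 * u x y ^ 3 * px X x y ^ 2 * Y x y ^ 4)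
        = 144 * u x y ^ 2 * Y x y * (k x y ^ 4 * py Y x y ^ 2)"
      using c3 v0 nz u0 unfolding e_def n1_def g(1) by (simp add: field_simps power_numeral_reduce)
    thus "12 * u x y ^ 3 * px X x y ^ 2 * Y x y ^ 4 = k x y ^ 4 * py Y x y ^ 2"
      using u0 Y0 unfolding mult_cancel_left by simp
  qed

  have v0: "v x y = 0" if "(x, y) \<in> W" for x y using rel33311(1)[OF that] .
  have \<mu>y: "py \<mu> x y = - 2 * C x y * \<mu> x y" if xy: "(x, y) \<in> W" for x y
    using mixed_partials(2)[OF xy] v0[OF xy] partials_cong[OF open_W xy v0] by (simp add: \<nu>_def)
  have \<mu>'y: "py \<mu>' x y = - 2 * C x y * \<mu>' x y" if xy: "(x, y) \<in> W" for x y
  proof -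
    have "py (px \<mu>) x y = px (py \<mu>) x y" by (rule py_px) (simp_all add: xy)
    also have "\<dots> = px (\<lambda>x y. - 2 * C x y * \<mu> x y) x y" by (rule partials_cong[OF open_W xy \<mu>y])
    also have "\<dots> = - 2 * px C x y * \<mu> x y - 2 * C x y * px \<mu> x y" using xy by (simp add: partial_rules)
    finally have "py (px \<mu>) x y = - 2 * px C x y * \<mu> x y - 2 * C x y * px \<mu> x y" .
    with xy show ?thesis
      unfolding \<mu>'_def by (simp add: partial_rules \<mu>y branch; simp add: algebra_simps)
  qed
  have uk: "k x y * py Y x y = u x y * Y x y" if xy: "(x, y) \<in> W" for x y
  proof -
    \<comment> \<open>Along \<open>y\<close>, \<open>?H\<close> scales with weight 4: all its terms are products of factors whose
      covariant derivatives vanish, except for \<open>\<Psi>\<close> and \<open>k\<close>, whose contributions cancel.\<close>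
    let ?H = "\<lambda>x y. 6 * u x y * \<mu>' x y + 36 * \<Psi> x y * u x y ^ 2 - 18 * u x y * k x y ^ 2 - 7 * \<mu> x y ^ 2"
    have H: "?H x y * Y x y ^ 2 = 3 * u x y * k x y ^ 2 * X x y" if xy: "(x, y) \<in> W" for x y
    proof -
      have "?H x y = (6 * u x y * (\<mu>' x y + A x y * v x y + 6 * \<Psi> x y * u x y + 5 * k x y ^ 2)
          - 7 * \<mu> x y ^ 2) - 48 * u x y * k x y ^ 2"
        using v0[OF xy] by (simp add: algebra_simps power2_eq_square)
      also have "\<dots> = 3 * u x y * k x y ^ 2 * X x y / Y x y ^ 2"
        unfolding rel331(3)[OF xy] using XY0[OF xy] by (simp add: field_simps)
      finally have "?H x y = 3 * u x y * k x y ^ 2 * X x y / Y x y ^ 2" .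
      thus ?thesis using XY0[OF xy] by simp
    qed
    have Hy: "py ?H x y = - 4 * C x y * ?H x y"
      using xy v0[OF xy] \<mu>y[OF xy] \<mu>'y[OF xy]
      by (simp add: partial_rules y_partials; simp add: algebra_simps power2_eq_square)
    have e1: "py (\<lambda>x y. ?H x y * Y x y ^ 2) x y = py (\<lambda>x y. 3 * u x y * k x y ^ 2 * X x y) x y"
      by (rule partials_cong[OF open_W xy H])
    have e2: "py (\<lambda>x y. ?H x y * Y x y ^ 2) x y = py ?H x y * Y x y ^ 2 + ?H x y * (2 * Y x y * py Y x y)"
      using xy py_mult[of ?H "\<lambda>x y. Y x y ^ 2" x y] by (simp add: py_power)
    have e3: "py (\<lambda>x y. 3 * u x y * k x y ^ 2 * X x y) x y =
        6 * X x y * u x y ^ 2 * k x y - 4 * C x y * (3 * u x y * k x y ^ 2 * X x y)"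
      using xy v0[OF xy] py_X[OF xy]
      by (simp add: partial_rules y_partials; simp add: algebra_simps power2_eq_square)
    define h where "h = ?H x y"
    have h: "h * Y x y ^ 2 = 3 * u x y * k x y ^ 2 * X x y" using H[OF xy] by (simp add: h_def)
    have "- 4 * C x y * h * Y x y ^ 2 + h * (2 * Y x y * py Y x y)
        = 6 * X x y * u x y ^ 2 * k x y - 4 * C x y * (3 * u x y * k x y ^ 2 * X x y)"
      using trans[OF sym[OF e2] trans[OF e1 e3]] unfolding Hy h_def .
    hence "h * Y x y ^ 2 * (2 * py Y x y) = 6 * X x y * u x y ^ 2 * k x y * Y x y"
      using h by algebra
    hence "(6 * u x y * k x y * X x y) * (k x y * py Y x y) = (6 * u x y * k x y * X x y) * (u x y * Y x y)"
      unfolding h by (simp add: power2_eq_square algebra_simps)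
    thus ?thesis using ku0[OF xy] XY0[OF xy] by simp
  qed
  have u_eq: "u x y = 12 * px X x y ^ 2 * py Y x y ^ 2" if xy: "(x, y) \<in> W" for x y
  proof -
    have "(u x y ^ 3 * Y x y ^ 4) * (12 * px X x y ^ 2 * py Y x y ^ 2) = (k x y * py Y x y) ^ 4"
      using rel33311(2)[OF xy] by algebra
    also have "\<dots> = (u x y ^ 3 * Y x y ^ 4) * u x y"
      unfolding uk[OF xy] by (simp add: power_mult_distrib power_numeral_reduce)
    finally show ?thesis using ku0[OF xy] XY0[OF xy] by simp
  qed
  have k_eq: "k x y = 12 * Y x y * px X x y ^ 2 * py Y x y" if xy: "(x, y) \<in> W" for x y
    using uk[OF xy] u_eq[OF xy] py_Y[OF xy] by (simp add: power2_eq_square)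
  have C: "C x y = C\<^sub>0 x y" if xy: "(x, y) \<in> W" for x y
  proof -
    have "py u x y = py (\<lambda>x y. 12 * px X x y ^ 2 * py Y x y ^ 2) x y" by (rule partials_cong[OF open_W xy u_eq])
    also have "\<dots> = 24 * px X x y ^ 2 * py Y x y * py (py Y) x y"
      using xy transformation_partials[OF xy] by (simp add: partial_rules power2_eq_square algebra_simps)
    finally have uy: "py u x y = 24 * px X x y ^ 2 * py Y x y * py (py Y) x y" .
    have "2 * u x y * C x y = - py u x y" using y_partials(3)[of x y] v0[OF xy] by simp
    hence uC: "2 * u x y * C x y = - (24 * px X x y ^ 2 * py Y x y * py (py Y) x y)" unfolding uy .
    have "C x y = 2 * u x y * C x y / (2 * u x y)" using ku0[OF xy] by simp
    also have "\<dots> = - (24 * px X x y ^ 2 * py Y x y * py (py Y) x y) / (2 * u x y)" unfolding uC ..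
    also have "\<dots> = C\<^sub>0 x y"
      unfolding u_eq[OF xy] C\<^sub>0_def using px_X[OF xy] py_Y[OF xy]
      by (simp add: field_simps power2_eq_square)
    finally show ?thesis .
  qed
  have B: "B x y = B\<^sub>0 x y" if xy: "(x, y) \<in> W" for x y
  proof -
    have ux: "px u x y = 24 * px X x y ^ 2 * py Y x y * (\<rho> x y * py Y x y + px (py Y) x y)"
    proof -
      have "px u x y = px (\<lambda>x y. 12 * px X x y ^ 2 * py Y x y ^ 2) x y" by (rule partials_cong[OF open_W xy u_eq])
      thus ?thesis using xy transformation_partials[OF xy] by (simp add: partial_rules power2_eq_square algebra_simps)
    qed
    have kx: "px k x y = 12 * px X x y ^ 2 * (px Y x y * py Y x y + 2 * \<rho> x y * Y x y * py Y x y + Y x y * px (py Y) x y)"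
    proof -
      have "px k x y = px (\<lambda>x y. 12 * Y x y * px X x y ^ 2 * py Y x y) x y" by (rule partials_cong[OF open_W xy k_eq])
      thus ?thesis using xy transformation_partials[OF xy] by (simp add: partial_rules power2_eq_square algebra_simps)
    qed
    have ukB: "2 * u x y * k x y * B x y = 6 * u x y * px k x y - 5 * k x y * px u x y - 6 * u x y ^ 2 * px Y x y / py Y x y"
      using rel33311(3)[OF xy] unfolding \<kappa>_def \<mu>_def by (simp add: algebra_simps)
    have "B x y = 2 * u x y * k x y * B x y / (2 * u x y * k x y)" using ku0[OF xy] by simp
    also have "\<dots> = (6 * u x y * px k x y - 5 * k x y * px u x y - 6 * u x y ^ 2 * px Y x y / py Y x y) / (2 * u x y * k x y)"
      unfolding ukB ..
    also have "\<dots> = B\<^sub>0 x y"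
      unfolding ux kx B\<^sub>0_def unfolding u_eq[OF xy] k_eq[OF xy] using px_X[OF xy] py_Y[OF xy] XY0[OF xy]
      by (simp add: field_simps power_numeral_reduce)
    finally show ?thesis .
  qed
  have "\<forall>(x, y)\<in>W. k x y = 12 * Y x y * px X x y ^ 2 * py Y x y"
    "\<forall>(x, y)\<in>W. u x y = 12 * px X x y ^ 2 * py Y x y ^ 2" "\<forall>(x, y)\<in>W. B x y = B\<^sub>0 x y"
    using k_eq u_eq B by auto
  note xrel = x_relative_invariants_of_law[OF this]
  \<comment> \<open>The constant coefficient of \<open>I1_331\<close> gives \<open>\<Psi>\<close>; \<open>I1_33\<close> is then linear in \<open>A\<close>.\<close>
  have A: "A x y = A\<^sub>0 x y" if xy: "(x, y) \<in> W" for x y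
  proof -
    note nz = px_X[OF xy] py_Y[OF xy] and Y0 = XY0[OF xy, THEN conjunct2]
    have u\<Psi>: "36 * u x y ^ 2 * \<Psi> x y = 6 * u x y * k x y ^ 2 * (8 + X x y / (2 * Y x y ^ 2)) + 7 * \<mu> x y ^ 2
        - 6 * u x y * (\<mu>' x y + 5 * k x y ^ 2)"
      using rel331(3)[OF xy] v0[OF xy] by (simp add: algebra_simps power2_eq_square)
    have "\<Psi> x y = 36 * u x y ^ 2 * \<Psi> x y / (36 * u x y ^ 2)" using ku0[OF xy] by simp
    also have "\<dots> = (6 * u x y * k x y ^ 2 * (8 + X x y / (2 * Y x y ^ 2)) + 7 * \<mu> x y ^ 2
        - 6 * u x y * (\<mu>' x y + 5 * k x y ^ 2)) / (36 * u x y ^ 2)" unfolding u\<Psi> ..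
    also have "\<dots> = px X x y ^ 2 * (6 * Y x y ^ 2 + X x y) - px \<rho> x y / 2 + \<rho> x y ^ 2 / 4"
      unfolding xrel[OF xy] u_eq[OF xy] k_eq[OF xy] using nz Y0
      by (simp add: field_simps power_numeral_reduce)
    finally have \<Psi>: "\<Psi> x y = px X x y ^ 2 * (6 * Y x y ^ 2 + X x y) - px \<rho> x y / 2 + \<rho> x y ^ 2 / 4" .
    from cover[OF xy] obtain p where z: "(x, y, p) \<in> U" using centre_in_ball by blast
    obtain a1 a2 a4 where n: "normalized f x y p (a1, a2, a4)" using normal[OF z] by blast
    define s where "s = \<sigma> x y p a1 a2 a4"
    have ni: "\<kappa> x y + p * u x y - 5 * s * k x y = k x y * a4" "\<mu> x y + p * v x y = 6 * s * u x y"
      using n normalized_iff[OF z] unfolding s_def by blast+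
    have "u x y * (6 * s - 3 * \<rho> x y) = 0"
      using ni(2) unfolding xrel(1)[OF xy] v0[OF xy] by algebra
    hence s: "s = \<rho> x y / 2"
      using ku0[OF xy] by (simp add: field_simps)
    define q where "q = px Y x y + p * py Y x y"
    have Pq: "P x y p = q / px X x y" by (simp add: P_def q_def)
    have q0: "q \<noteq> 0" using P0[OF z] Pq by auto
    have "12 * px X x y ^ 2 * py Y x y * (Y x y * a4) = k x y * a4"
      by (simp add: k_eq[OF xy])
    also have "k x y * a4 = 12 * px X x y ^ 2 * py Y x y * q"
      unfolding ni(1)[symmetric] unfolding s xrel(3)[OF xy] u_eq[OF xy] k_eq[OF xy] q_def
      by (simp add: field_simps power2_eq_square)
    finally have "Y x y * a4 = q" using nz by simp
    hence a4: "a4 = q / Y x y" using Y0 by (simp add: field_simps)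
    define Q where "Q = \<kappa>' x y + 2 * p * \<mu> x y + p * p * v x y + A x y * u x y
      + 5 * \<Psi> x y * k x y - 12 * s * (\<kappa> x y + p * u x y) + 30 * s * s * k x y"
    have e: "- 12 * Q / (k x y * a4 ^ 2) =
        - Y x y * (384 * Y x y ^ 3 + 72 * X x y * Y x y + 12 * \<alpha>) / P x y p ^ 2"
      using J[OF z n] normalized_values(1)[OF z n] by (simp add: Q_def s_def)
    have "Q = - 12 * Q / (k x y * a4 ^ 2) * (k x y * a4 ^ 2 / - 12)"
      using ku0[OF xy] a4 q0 Y0 by simp
    also have "\<dots> = 12 * px X x y ^ 4 * py Y x y * (32 * Y x y ^ 3 + 6 * X x y * Y x y + \<alpha>)"
      unfolding e unfolding k_eq[OF xy] a4 Pq using nz Y0 q0 by (simp add: field_simps power_numeral_reduce)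
    finally have "A x y * u x y = 12 * px X x y ^ 4 * py Y x y * (32 * Y x y ^ 3 + 6 * X x y * Y x y + \<alpha>)
      - (\<kappa>' x y + 2 * p * \<mu> x y + p * p * v x y
      + 5 * \<Psi> x y * k x y - 12 * s * (\<kappa> x y + p * u x y) + 30 * s * s * k x y)"
      unfolding Q_def by (simp add: algebra_simps)
    also have "\<dots> = A\<^sub>0 x y * u x y"
      unfolding s xrel[OF xy] \<Psi> v0[OF xy] k_eq[OF xy] u_eq[OF xy] A\<^sub>0_def using nz
      by (simp add: field_simps power_numeral_reduce)
    finally show ?thesis using ku0[OF xy] by simp
  qed
  show ?thesis using A B C by (auto simp: satisfies_law_def)
qed

end

section \<open>The transformation law and the coframes\<close>

lemma structure_matrix_mult_vector:
  "structure_matrix a1 a2 a3 a4 *v vector [r, s, t] = vector [a1 * r, a2 * r + a3 * s, a4 * t]"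
  by (simp add: structure_matrix_def vec_eq_iff forall_3 matrix_vector_mult_def sum_3)

lemma invertible_structure_matrix:
  "invertible (structure_matrix a1 a2 a3 a4) \<longleftrightarrow> a1 \<noteq> 0 \<and> a3 \<noteq> 0 \<and> a4 \<noteq> 0"
  by (simp add: invertible_det_nz det_3 structure_matrix_def)

context plane_transformation
begin

text \<open>
  For a prolonged transformation the first and the third row of the matrix condition always hold,
  with \<open>a1 = Y_y\<close> and \<open>a4 = X'\<close>. The second row relates the forms \<open>dP - g dX\<close> and \<open>dp - f dx\<close> and
  can be satisfied if and only if \<open>dP - g dX\<close> vanishes on the direction \<open>(1, p, f)\<close> of the
  solution curves, which is the equation for the total derivative of \<open>P\<close>.
\<close>

lemma maps_ode_iff_law:
  assumes X: "X = (\<lambda>x y. xb x)" and U: "\<And>x y p. (x, y, p) \<in> U \<Longrightarrow> (x, y) \<in> W"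
  shows "maps_ode xb Y U f (painleve2 \<alpha>) \<longleftrightarrow>
    (\<forall>(x, y, p)\<in>U. f x y p = A\<^sub>0 x y + B\<^sub>0 x y * p + C\<^sub>0 x y * p ^ 2)"
proof -
  define F0 where "F0 = (\<lambda>x y. px Y x y / px X x y)"
  define F1 where "F1 = (\<lambda>x y. py Y x y / px X x y)"
  have an: "analytic F0" "analytic F1"
    unfolding F0_def F1_def by (rule analytic2_on_divide; simp add: px_X)+
  have X': "deriv xb x = px X x y" for x y by (simp add: X px_def)
  have pbar: "pbar xb Y x y p = F0 x y + p * F1 x y" for x y p
    unfolding pbar_def X'[of x y] F0_def F1_def by (simp add: px_def py_def add_divide_distrib)
  define Fx where "Fx = (\<lambda>x y p. px F0 x y + p * px F1 x y)"
  define Fy where "Fy = (\<lambda>x y p. py F0 x y + p * py F1 x y)"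
  have der: "frechet_derivative (prolong xb Y) (at (x, y, p)) (a, b, c) =
      (px X x y * a, px Y x y * a + py Y x y * b, Fx x y p * a + Fy x y p * b + F1 x y * c)"
    if z: "(x, y, p) \<in> U" for x y p a b c
  proof -
    note xy = U[OF z]
    have pr: "((\<lambda>(x, y, p). (x, y)) has_derivative (\<lambda>(a, b, c). (a, b))) (at (x, y, p))"
      unfolding case_prod_unfold by (auto intro!: derivative_eq_intros)
    have d: "((\<lambda>z. g (fst z) (fst (snd z))) has_derivative
        (\<lambda>v. px g x y * fst v + py g x y * fst (snd v))) (at (x, y, p))"
      if "analytic g" for g
    proof -
      have "((\<lambda>(x, y). g x y) has_derivative (\<lambda>(u, v). px g x y * u + py g x y * v))
          (at ((\<lambda>(x, y, p). (x, y)) (x, y, p)))"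
        using analytic2_on_partials(3)[OF that xy] by simp
      from has_derivative_compose[OF pr this] show ?thesis by (simp add: case_prod_unfold)
    qed
    have sn: "((\<lambda>z. snd (snd z)) has_derivative (\<lambda>v. snd (snd v))) (at (x, y, p))"
      by (auto intro!: derivative_eq_intros)
    have dX: "((\<lambda>z. xb (fst z)) has_derivative (\<lambda>v. px X x y * fst v)) (at (x, y, p))"
      using d[OF analytic_XY(1)] py_X[OF xy] by (simp add: X)
    have "((\<lambda>z. F0 (fst z) (fst (snd z)) + snd (snd z) * F1 (fst z) (fst (snd z))) has_derivative
      (\<lambda>v. px F0 x y * fst v + py F0 x y * fst (snd v) +
        (p * (px F1 x y * fst v + py F1 x y * fst (snd v)) + snd (snd v) * F1 x y))) (at (x, y, p))"
      using has_derivative_add[OF d[OF an(1)] has_derivative_mult[OF sn d[OF an(2)]]] by simp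
    hence dP: "((\<lambda>z. pbar xb Y (fst z) (fst (snd z)) (snd (snd z))) has_derivative
      (\<lambda>v. Fx x y p * fst v + Fy x y p * fst (snd v) + F1 x y * snd (snd v))) (at (x, y, p))"
      unfolding pbar Fx_def Fy_def by (simp add: algebra_simps)
    have "(prolong xb Y has_derivative (\<lambda>v. (px X x y * fst v, px Y x y * fst v + py Y x y * fst (snd v),
        Fx x y p * fst v + Fy x y p * fst (snd v) + F1 x y * snd (snd v)))) (at (x, y, p))"
      using has_derivative_Pair[OF dX has_derivative_Pair[OF d[OF analytic_XY(2)] dP]]
      unfolding prolong_def case_prod_unfold .
    from frechet_derivative_at[OF this, symmetric] show ?thesis by simp
  qed
  have law: "Fx x y p + p * Fy x y p + f x y p * F1 x y = painleve2 \<alpha> (xb x) (Y x y) (pbar xb Y x y p) * px X x y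
      \<longleftrightarrow> f x y p = A\<^sub>0 x y + B\<^sub>0 x y * p + C\<^sub>0 x y * p ^ 2" if z: "(x, y, p) \<in> U" for x y p
  proof -
    note xy = U[OF z] note nz = px_X[OF xy] py_Y[OF xy] and t = transformation_partials[OF xy]
    have F0: "px F0 x y = (px (px Y) x y - \<rho> x y * px Y x y) / px X x y"
      "py F0 x y = px (py Y) x y / px X x y"
      unfolding F0_def using xy nz t by (simp_all add: px_divide py_divide field_simps)
    have F1: "px F1 x y = (px (py Y) x y - \<rho> x y * py Y x y) / px X x y"
      "py F1 x y = py (py Y) x y / px X x y"
      unfolding F1_def using xy nz t by (simp_all add: px_divide py_divide field_simps)
    have F1v: "F1 x y = py Y x y / px X x y" by (simp add: F1_def)
    have Xx: "xb x = X x y" by (simp add: X)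
    have "Fx x y p + p * Fy x y p + f x y p * F1 x y - painleve2 \<alpha> (xb x) (Y x y) (pbar xb Y x y p) * px X x y
      = (f x y p - (A\<^sub>0 x y + B\<^sub>0 x y * p + C\<^sub>0 x y * p ^ 2)) * F1 x y"
      unfolding Fx_def Fy_def F0 F1 A\<^sub>0_def B\<^sub>0_def C\<^sub>0_def painleve2_def Xx F1v using nz
      by (simp add: field_simps power2_eq_square)
    moreover have "F1 x y \<noteq> 0" using nz by (simp add: F1_def)
    ultimately show ?thesis by (metis eq_iff_diff_eq_0 mult_eq_0_iff)
  qed
  show ?thesis
  proof
    assume "maps_ode xb Y U f (painleve2 \<alpha>)"
    then obtain a1 a2 a3 a4 where a: "\<And>z v. z \<in> U \<Longrightarrow>
      coframe (painleve2 \<alpha>) (prolong xb Y z) (frechet_derivative (prolong xb Y) (at z) v) =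
          structure_matrix (a1 z) (a2 z) (a3 z) (a4 z) *v coframe f z v"
      unfolding maps_ode_def by blast
    show "\<forall>(x, y, p)\<in>U. f x y p = A\<^sub>0 x y + B\<^sub>0 x y * p + C\<^sub>0 x y * p ^ 2"
    proof safe
      fix x y p assume z: "(x, y, p) \<in> U"
      from a[OF z, of "(1, p, f x y p)"]
      have "(vector [px Y x y * 1 + py Y x y * p - pbar xb Y x y p * (px X x y * 1),
          Fx x y p * 1 + Fy x y p * p + F1 x y * f x y p
            - painleve2 \<alpha> (xb x) (Y x y) (pbar xb Y x y p) * (px X x y * 1), px X x y * 1] :: complex ^ 3)
        = structure_matrix (a1 (x, y, p)) (a2 (x, y, p)) (a3 (x, y, p)) (a4 (x, y, p)) *v
          vector [p - p * 1, f x y p - f x y p * 1, 1]"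
        unfolding der[OF z] by (simp add: coframe_def prolong_def)
      hence "Fx x y p + p * Fy x y p + f x y p * F1 x y =
          painleve2 \<alpha> (xb x) (Y x y) (pbar xb Y x y p) * px X x y"
        unfolding structure_matrix_mult_vector by (simp add: vec_eq_iff forall_3 mult_ac)
      thus "f x y p = A\<^sub>0 x y + B\<^sub>0 x y * p + C\<^sub>0 x y * p ^ 2" using law[OF z] by simp
    qed
  next
    assume eq: "\<forall>(x, y, p)\<in>U. f x y p = A\<^sub>0 x y + B\<^sub>0 x y * p + C\<^sub>0 x y * p ^ 2"
    show "maps_ode xb Y U f (painleve2 \<alpha>)"
      unfolding maps_ode_def
    proof (intro exI ballI conjI allI)
      fix z assume "z \<in> U"
      moreover obtain x y p where z_eq: "z = (x, y, p)" by (metis prod_cases3)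
      ultimately have z: "(x, y, p) \<in> U" by simp
      note xy = U[OF z] note nz = px_X[OF xy] py_Y[OF xy]
      show "invertible (structure_matrix ((\<lambda>(x, y, p). py Y x y) z) ((\<lambda>(x, y, p). Fy x y p) z)
          ((\<lambda>(x, y, p). F1 x y) z) ((\<lambda>(x, y, p). px X x y) z))"
        using nz by (simp add: invertible_structure_matrix z_eq F1_def)
      fix v :: "complex \<times> complex \<times> complex"
      obtain a b c where v: "v = (a, b, c)" by (metis prod_cases3)
      have e: "Fx x y p + p * Fy x y p + f x y p * F1 x y = painleve2 \<alpha> (xb x) (Y x y) (pbar xb Y x y p) * px X x y"
        using law[OF z] eq z by auto
      have 1: "px Y x y * a + py Y x y * b - pbar xb Y x y p * (px X x y * a) = py Y x y * (b - p * a)"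
        unfolding pbar F0_def F1_def using nz by (simp add: field_simps)
      have 2: "Fx x y p * a + Fy x y p * b + F1 x y * c - painleve2 \<alpha> (xb x) (Y x y) (pbar xb Y x y p) * (px X x y * a)
          = Fy x y p * (b - p * a) + F1 x y * (c - f x y p * a)"
        unfolding mult.assoc[symmetric] e[symmetric] by (simp add: algebra_simps)
      show "coframe (painleve2 \<alpha>) (prolong xb Y z) (frechet_derivative (prolong xb Y) (at z) v) =
          structure_matrix ((\<lambda>(x, y, p). py Y x y) z) ((\<lambda>(x, y, p). Fy x y p) z)
          ((\<lambda>(x, y, p). F1 x y) z) ((\<lambda>(x, y, p). px X x y) z) *v coframe f z v"
        unfolding z_eq v der[OF z] using 1 2
        by (simp add: coframe_def prolong_def structure_matrix_mult_vector)
    qed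
  qed
qed

end

section \<open>The local form of the equation\<close>

lemma analytic3_on_slices:
  assumes "analytic3_on f U" "(x, y, p) \<in> U"
  shows "(\<lambda>t. f t y p) field_differentiable at x" "(\<lambda>t. f x t p) field_differentiable at y"
    "f x y field_differentiable at p"
    "\<exists>A B. ((\<lambda>(x, y). f x y p) has_derivative (\<lambda>(u, v). A * u + B * v)) (at (x, y))"
proof -
  obtain A B C where d: "((\<lambda>(x, y, p). f x y p) has_derivative (\<lambda>(u, v, w). A * u + B * v + C * w)) (at (x, y, p))"
    using assms unfolding analytic3_on_def by blast
  have s: "((\<lambda>t. (t, y, p)) has_derivative (\<lambda>u. (u, 0, 0))) (at x)"
    "((\<lambda>t. (x, t, p)) has_derivative (\<lambda>u. (0, u, 0))) (at y)"
    "((\<lambda>t. (x, y, t)) has_derivative (\<lambda>u. (0, 0, u))) (at p)"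
    "((\<lambda>z. (fst z, snd z, p)) has_derivative (\<lambda>u. (fst u, snd u, 0))) (at (x, y))"
    by (intro has_derivative_Pair has_derivative_ident has_derivative_const has_derivative_fst has_derivative_snd)+
  have d': "((\<lambda>(x, y, p). f x y p) has_derivative (\<lambda>(u, v, w). A * u + B * v + C * w))
      (at (fst (x, y), snd (x, y), p))"
    using d by simp
  have "((\<lambda>t. f t y p) has_derivative (\<lambda>u. A * u)) (at x)"
    using has_derivative_compose[OF s(1) d] by simp
  moreover have "((\<lambda>t. f x t p) has_derivative (\<lambda>u. B * u)) (at y)"
    using has_derivative_compose[OF s(2) d] by simp
  moreover have "(f x y has_derivative (\<lambda>u. C * u)) (at p)"
    using has_derivative_compose[OF s(3) d] by simp
  moreover have "((\<lambda>z. f (fst z) (snd z) p) has_derivative (\<lambda>u. A * fst u + B * snd u)) (at (x, y))"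
    using has_derivative_compose[OF s(4) d'] by simp
  ultimately
  show "(\<lambda>t. f t y p) field_differentiable at x" "(\<lambda>t. f x t p) field_differentiable at y"
    "f x y field_differentiable at p"
    "\<exists>A B. ((\<lambda>(x, y). f x y p) has_derivative (\<lambda>(u, v). A * u + B * v)) (at (x, y))"
    by (auto simp: field_differentiable_def has_field_derivative_def case_prod_unfold)
qed

lemma antiderivative_unique_on_ball:
  fixes g G :: "complex \<Rightarrow> complex"
  assumes "g holomorphic_on ball p0 r"
    and "\<And>p. p \<in> ball p0 r \<Longrightarrow> (G has_field_derivative deriv g p) (at p)"
  shows "\<exists>c. \<forall>p\<in>ball p0 r. g p = c + G p"
proof -
  have "\<exists>c. \<forall>p\<in>ball p0 r. g p - G p = c"
  proof (rule has_field_derivative_zero_constant)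
    fix p assume p: "p \<in> ball p0 r"
    have "(g has_field_derivative deriv g p) (at p)"
      using assms(1) p by (simp add: holomorphic_derivI)
    from DERIV_diff[OF this assms(2)[OF p]]
    show "((\<lambda>p. g p - G p) has_field_derivative 0) (at p within ball p0 r)"
      by (simp add: has_field_derivative_at_within)
  qed simp
  thus ?thesis by (metis diff_add_cancel)
qed

lemma third_derivative_zero_imp_quadratic:
  assumes g: "g holomorphic_on ball p0 r"
    and 3: "\<And>p. p \<in> ball p0 r \<Longrightarrow> deriv (deriv (deriv g)) p = 0"
  shows "\<exists>c0 c1 c2. \<forall>p\<in>ball p0 r. g p = c0 + c1 * p + c2 * p ^ 2"
proof -
  have g': "deriv g holomorphic_on ball p0 r" by (rule holomorphic_deriv[OF g]) simp
  have g'': "deriv (deriv g) holomorphic_on ball p0 r" by (rule holomorphic_deriv[OF g']) simp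
  have "\<exists>c. \<forall>p\<in>ball p0 r. deriv (deriv g) p = c + 0"
    by (rule antiderivative_unique_on_ball[OF g'']) (simp add: 3)
  then obtain c2 where c2: "\<And>p. p \<in> ball p0 r \<Longrightarrow> deriv (deriv g) p = c2" by auto
  have "\<exists>c. \<forall>p\<in>ball p0 r. deriv g p = c + c2 * p"
    by (rule antiderivative_unique_on_ball[OF g']) (auto simp: c2 intro!: derivative_eq_intros)
  then obtain c1 where c1: "\<And>p. p \<in> ball p0 r \<Longrightarrow> deriv g p = c1 + c2 * p" by auto
  have "\<exists>c. \<forall>p\<in>ball p0 r. g p = c + (c1 * p + c2 / 2 * p ^ 2)"
    by (rule antiderivative_unique_on_ball[OF g]) (auto simp: c1 intro!: derivative_eq_intros)
  thus ?thesis by (metis add.assoc)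
qed

text \<open>
  Interpolation at three values of \<open>p\<close> expresses the coefficients by \<open>f\<close> on slices \<open>p = const\<close>.
  Thus they inherit analyticity in \<open>(x, y)\<close> from \<open>f\<close>.
\<close>

lemma painleve_branch_imp_quadratic_ode:
  assumes f: "analytic3_on f (ball x0 r \<times> ball y0 r \<times> ball p0 r)" and r: "r > 0"
    and branch: "painleve_branch f (ball x0 r \<times> ball y0 r \<times> ball p0 r)"
  shows "\<exists>A B C. quadratic_ode (ball x0 r \<times> ball y0 r) (ball x0 r \<times> ball y0 r \<times> ball p0 r) f A B C"
proof -
  let ?W = "ball x0 r \<times> ball y0 r" and ?U = "ball x0 r \<times> ball y0 r \<times> ball p0 r"
  have slice: "analytic2_on (\<lambda>x y. f x y q) ?W" if "q \<in> ball p0 r" for q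
    unfolding analytic2_on_def using analytic3_on_slices(4)[OF f] that by auto
  define t where "t = complex_of_real (r / 2)"
  have t: "t \<noteq> 0" "p0 + t \<in> ball p0 r" "p0 - t \<in> ball p0 r" "p0 \<in> ball p0 r"
    using r by (auto simp: t_def dist_norm)
  define C where "C = (\<lambda>x y. (f x y (p0 + t) + f x y (p0 - t) - 2 * f x y p0) / (2 * t ^ 2))"
  define B where "B = (\<lambda>x y. (f x y (p0 + t) - f x y (p0 - t)) / (2 * t) - 2 * C x y * p0)"
  define A where "A = (\<lambda>x y. f x y p0 - B x y * p0 - C x y * p0 ^ 2)"
  have an: "analytic2_on C ?W" "analytic2_on B ?W" "analytic2_on A ?W"
  proof -
    show C: "analytic2_on C ?W" unfolding C_def using t slice by simp
    show B: "analytic2_on B ?W" unfolding B_def using t slice C by simp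
    show "analytic2_on A ?W" unfolding A_def using t slice C B by simp
  qed
  have eq: "f x y p = A x y + B x y * p + C x y * p ^ 2" if z: "(x, y, p) \<in> ?U" for x y p
  proof -
    have "f x y holomorphic_on ball p0 r"
      unfolding holomorphic_on_def
      using analytic3_on_slices(3)[OF f] z by (auto intro: field_differentiable_at_within)
    moreover have "deriv (deriv (deriv (f x y))) q = 0" if "q \<in> ball p0 r" for q
    proof -
      have "(x, y, q) \<in> ?U" using z that by auto
      hence "I3 f x y q 1 0 1 = 0" using branch unfolding painleve_branch_def by (auto dest!: bspec)
      thus ?thesis by (simp add: I3_def Pp_def[abs_def])
    qed
    ultimately obtain c0 c1 c2 where c: "\<And>p. p \<in> ball p0 r \<Longrightarrow> f x y p = c0 + c1 * p + c2 * p ^ 2"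
      using third_derivative_zero_imp_quadratic by blast
    have "C x y = c2" unfolding C_def using c t by (simp add: field_simps power2_eq_square)
    moreover have "B x y = c1"
      unfolding B_def \<open>C x y = c2\<close> using c t by (simp add: field_simps power2_eq_square)
    moreover have "A x y = c0" unfolding A_def \<open>C x y = c2\<close> \<open>B x y = c1\<close> using c t by simp
    ultimately show ?thesis using c z by simp
  qed
  interpret quadratic_in_p ?W ?U f A B C
    by unfold_locales (use an eq in \<open>auto intro!: open_Times\<close>)
  have "quadratic_ode ?W ?U f A B C"
  proof (unfold_locales)
    fix x y assume "(x, y) \<in> ?W"
    hence z: "(x, y, p0) \<in> ?U" using r by auto
    hence "I2 f x y p0 1 0 1 = 0" using branch unfolding painleve_branch_def by (auto dest!: bspec)
    thus "py B x y = 2 * px C x y" by (simp add: I2_def f_partials[OF z])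
  qed
  thus ?thesis by blast
qed

text \<open>
  If \<open>h\<close> vanishes at \<open>t0\<close>, this zero is isolated because the derivative does not vanish there, and
  \<open>g\<close> is zero on a punctured neighbourhood.
\<close>

lemma zero_by_continuity:
  fixes g h :: "complex \<Rightarrow> complex"
  assumes g: "isCont g t0" and h: "(h has_field_derivative h') (at t0)" "h' \<noteq> 0"
    and ev: "\<forall>\<^sub>F t in at t0. h t \<noteq> 0 \<longrightarrow> g t = 0" and t0: "h t0 \<noteq> 0 \<Longrightarrow> g t0 = 0"
  shows "g t0 = 0"
proof (cases "h t0 = 0")
  case True
  have "((\<lambda>t. (h t - h t0) / (t - t0)) \<longlongrightarrow> h') (at t0)"
    using h(1) unfolding has_field_derivative_iff .
  hence "\<forall>\<^sub>F t in at t0. (h t - h t0) / (t - t0) \<noteq> 0"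
    by (rule tendsto_imp_eventually_ne) (rule h(2))
  hence "\<forall>\<^sub>F t in at t0. h t \<noteq> 0" by (rule eventually_mono) (use True in auto)
  hence "\<forall>\<^sub>F t in at t0. g t = 0" using ev by eventually_elim auto
  hence "(g \<longlongrightarrow> 0) (at t0)" by (rule tendsto_eventually)
  with g show ?thesis unfolding isCont_def using tendsto_unique[OF trivial_limit_at] by blast
qed (use t0 in auto)

section \<open>The equivalence theorem\<close>

lemma open_xy_projection:
  fixes U :: "(complex \<times> complex \<times> complex) set"
  assumes "open U"
  shows "open ((\<lambda>(x, y, p). (x, y)) ` U)"
proof (subst open_subopen, safe)
  fix x y p assume z: "(x, y, p) \<in> U"
  let ?T = "(\<lambda>w. (fst w, snd w, p)) -` U"
  have "open ?T" using assms by (intro open_vimage continuous_intros)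
  moreover have "?T \<subseteq> (\<lambda>(x, y, p). (x, y)) ` U" by force
  moreover have "(x, y) \<in> ?T" using z by simp
  ultimately show "\<exists>T. open T \<and> (x, y) \<in> T \<and> T \<subseteq> (\<lambda>(x, y, p). (x, y)) ` U" by blast
qed

lemma fiber_preserving_plane_transformation:
  assumes W: "open W" and fp: "fiber_preserving xb yb W"
  shows "plane_transformation W (\<lambda>x y. xb x) yb"
proof
  have dX: "(xb has_field_derivative deriv xb x) (at x)" if "(x, y) \<in> W" for x y
  proof -
    have "xb analytic_on fst ` W" "x \<in> fst ` W" using fp that by (force simp: fiber_preserving_def)+
    thus ?thesis using analytic_on_imp_differentiable_at field_differentiable_derivI by blast
  qed
  show "analytic2_on (\<lambda>x y. xb x) W"
    by (rule analytic2_onI_partials[OF W dX]) (auto intro!: derivative_eq_intros)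
qed (use assms in \<open>auto simp: fiber_preserving_def px_def py_def\<close>)

theorem theorem2:
  fixes f :: "complex \<Rightarrow> complex \<Rightarrow> complex \<Rightarrow> complex"
    and U :: "(complex \<times> complex \<times> complex) set"
    and xb :: "complex \<Rightarrow> complex"
    and yb :: "complex \<Rightarrow> complex \<Rightarrow> complex"
    and \<alpha> :: complex
  assumes "open U"
    and "analytic3_on f U"
    and "fiber_preserving xb yb ((\<lambda>(x, y, p). (x, y)) ` U)"
  shows "maps_ode xb yb U f (painleve2 \<alpha>) \<longleftrightarrow>
    painleve_branch f U \<and>
    (\<forall>(x, y, p)\<in>U. yb x y \<noteq> 0 \<longrightarrow> pbar xb yb x y p \<noteq> 0 \<longrightarrow>
       given_by_pII_formulas \<alpha> xb yb f x y p)"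
proof -
  define W where "W = (\<lambda>(x, y, p). (x, y)) ` U"
  define X where "X = (\<lambda>(x::complex) (y::complex). xb x)"
  have W: "open W" unfolding W_def by (rule open_xy_projection[OF assms(1)])
  have UW: "(x, y) \<in> W" if "(x, y, p) \<in> U" for x y p
    using that unfolding W_def by force
  interpret plane_transformation W X yb \<alpha>
    using fiber_preserving_plane_transformation[OF W, of xb yb] assms(3) by (simp add: W_def X_def)
  have pbar_eq: "pbar xb yb x y p = (px yb x y + p * py yb x y) / px X x y" for x y p
    unfolding pbar_def by (simp add: px_def py_def X_def)
  have given_iff: "given_by_pII_formulas \<alpha> xb yb f x y p \<longleftrightarrow>
      (\<exists>!a. normalized f x y p a) \<and> (\<forall>a1 a2 a4. normalized f x y p (a1, a2, a4) \<longrightarrow>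
        I1_33 f x y p a1 a2 a4 = - yb x y * (384 * yb x y ^ 3 + 72 * X x y * yb x y + 12 * \<alpha>) / pbar xb yb x y p ^ 2 \<and>
        I1_331 f x y p a1 a2 a4 = 1152 + 72 * X x y / yb x y ^ 2 \<and>
        I1_3331 f x y p a1 a2 a4 = 4032 + 72 / (yb x y * pbar xb yb x y p) \<and>
        I1_33311 f x y p a1 a2 a4 = - 4032 * pbar xb yb x y p ^ 2 / yb x y ^ 4)"
    if "yb x y \<noteq> 0" "pbar xb yb x y p \<noteq> 0" for x y p
    unfolding given_by_pII_formulas_def pII_formulas_iff[OF that, symmetric] by (simp add: X_def)
  have maps: "maps_ode xb yb U f (painleve2 \<alpha>) \<longleftrightarrow>
    (\<forall>(x, y, p)\<in>U. f x y p = A\<^sub>0 x y + B\<^sub>0 x y * p + C\<^sub>0 x y * p ^ 2)"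
    by (rule maps_ode_iff_law[OF X_def UW])
  show ?thesis
  proof
    assume "maps_ode xb yb U f (painleve2 \<alpha>)"
    hence eq: "\<And>x y p. (x, y, p) \<in> U \<Longrightarrow> f x y p = A\<^sub>0 x y + B\<^sub>0 x y * p + C\<^sub>0 x y * p ^ 2"
      unfolding maps by auto
    interpret candidate W U f A\<^sub>0 B\<^sub>0 C\<^sub>0 X yb \<alpha>
      by unfold_locales (use assms(1) UW eq law_branch in auto)
    have law: satisfies_law by (simp add: satisfies_law_def)
    have P: "pbar xb yb x y p = P x y p" for x y p by (simp add: pbar_eq P_def)
    show "painleve_branch f U \<and>
      (\<forall>(x, y, p)\<in>U. yb x y \<noteq> 0 \<longrightarrow> pbar xb yb x y p \<noteq> 0 \<longrightarrow> given_by_pII_formulas \<alpha> xb yb f x y p)"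
    proof (intro conjI painleve_branch_f, clarify)
      fix x y p assume z: "(x, y, p) \<in> U" and nz: "yb x y \<noteq> 0" "pbar xb yb x y p \<noteq> 0"
      note inv = invariants_of_law[OF law z nz(1) nz(2)[unfolded P]]
      show "given_by_pII_formulas \<alpha> xb yb f x y p"
        unfolding given_iff[OF nz] unfolding P using inv by blast
    qed
  next
    assume *: "painleve_branch f U \<and>
      (\<forall>(x, y, p)\<in>U. yb x y \<noteq> 0 \<longrightarrow> pbar xb yb x y p \<noteq> 0 \<longrightarrow> given_by_pII_formulas \<alpha> xb yb f x y p)"
    define g where "g = (\<lambda>x y p. f x y p - (A\<^sub>0 x y + B\<^sub>0 x y * p + C\<^sub>0 x y * p ^ 2))"
    define U' where "U' = {(x, y, p) \<in> U. X x y \<noteq> 0 \<and> yb x y \<noteq> 0 \<and> pbar xb yb x y p \<noteq> 0}"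
    have U': "open U'"
    proof -
      let ?\<pi> = "\<lambda>z::complex \<times> complex \<times> complex. (fst z, fst (snd z))"
      have co: "continuous_on U (\<lambda>z. h (fst z) (fst (snd z)))" if "analytic h" for h
      proof -
        have "continuous_on U (\<lambda>z. (\<lambda>(x, y). h x y) (?\<pi> z))"
          by (rule continuous_on_compose2[OF analytic2_on_continuous[OF that]])
            (use UW in \<open>auto intro!: continuous_intros\<close>)
        thus ?thesis by simp
      qed
      have "continuous_on U (\<lambda>z. X (fst z) (fst (snd z)) * yb (fst z) (fst (snd z)) *
          pbar xb yb (fst z) (fst (snd z)) (snd (snd z)))"
        unfolding pbar_eq by (intro continuous_intros co) (use px_X UW in auto)
      hence "open (U \<inter> (\<lambda>z. X (fst z) (fst (snd z)) * yb (fst z) (fst (snd z)) *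
          pbar xb yb (fst z) (fst (snd z)) (snd (snd z))) -` (- {0}))"
        by (rule continuous_open_preimage) (use assms(1) in auto)
      also have "U \<inter> (\<lambda>z. X (fst z) (fst (snd z)) * yb (fst z) (fst (snd z)) *
          pbar xb yb (fst z) (fst (snd z)) (snd (snd z))) -` (- {0}) = U'"
        unfolding U'_def by auto
      finally show ?thesis .
    qed
    have on_U': "g x y p = 0" if z: "(x, y, p) \<in> U'" for x y p
    proof -
      obtain r where r: "r > 0" "ball x r \<times> ball y r \<times> ball p r \<subseteq> U'"
      proof -
        obtain D E where DE: "open D" "open E" "x \<in> D" "(y, p) \<in> E" "D \<times> E \<subseteq> U'"
          using U' z by (rule open_prod_elim) auto
        obtain r1 where r1: "r1 > 0" "cball y r1 \<times> cball p r1 \<subseteq> E" by (rule open_contains_polydisc[OF DE(2,4)])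
        obtain r2 where r2: "r2 > 0" "ball x r2 \<subseteq> D" using DE(1,3) by (rule openE)
        have "ball x (min r1 r2) \<times> ball y (min r1 r2) \<times> ball p (min r1 r2) \<subseteq> ball x r2 \<times> cball y r1 \<times> cball p r1"
          by (auto simp: subset_iff)
        also have "\<dots> \<subseteq> D \<times> E" using r1 r2 by blast
        finally show thesis using that[of "min r1 r2"] r1 r2 DE(5) by auto
      qed
      let ?W = "ball x r \<times> ball y r" and ?U = "ball x r \<times> ball y r \<times> ball p r"
      have sub: "?U \<subseteq> U" using r(2) by (auto simp: U'_def)
      have subW: "?W \<subseteq> W"
      proof clarify
        fix a b assume "a \<in> ball x r" "b \<in> ball y r"
        hence "(a, b, p) \<in> ?U" using r(1) by simp
        thus "(a, b) \<in> W" using sub UW by blast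
      qed
      have "analytic3_on f ?U" using assms(2) sub unfolding analytic3_on_def by blast
      moreover have "painleve_branch f ?U" using * sub unfolding painleve_branch_def by blast
      ultimately obtain A B C where ABC: "quadratic_ode ?W ?U f A B C"
        using painleve_branch_imp_quadratic_ode[OF _ r(1)] by blast
      interpret L: quadratic_ode ?W ?U f A B C by (rule ABC)
      have "analytic2_on X ?W" "analytic2_on yb ?W"
        using analytic_XY subW unfolding analytic2_on_def by blast+
      then interpret L: candidate ?W ?U f A B C X yb \<alpha>
        by unfold_locales
          (use py_X[OF subsetD[OF subW]] px_X[OF subsetD[OF subW]] py_Y[OF subsetD[OF subW]] in blast)+
      have P: "pbar xb yb x y p = L.P x y p" for x y p by (simp add: pbar_eq L.P_def)
      have nz: "X a b \<noteq> 0" "yb a b \<noteq> 0" "pbar xb yb a b c \<noteq> 0" "(a, b, c) \<in> U" if "(a, b, c) \<in> ?U" for a b c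
        using subsetD[OF r(2) that] by (simp_all add: U'_def)
      have given: "given_by_pII_formulas \<alpha> xb yb f a b c" if "(a, b, c) \<in> ?U" for a b c
        using * nz[OF that] by blast
      have L.satisfies_law
      proof (rule L.law_of_invariants)
        show "\<exists>p0 s. 0 < s \<and> (\<forall>p\<in>ball p0 s. (a, b, p) \<in> ?U)" if "(a, b) \<in> ?W" for a b
          using r(1) that by (intro exI[of _ p] exI[of _ r]) auto
        show "X a b \<noteq> 0 \<and> yb a b \<noteq> 0" if "(a, b) \<in> ?W" for a b
          using nz[of a b p] that r(1) by auto
        show "L.P a b c \<noteq> 0" if "(a, b, c) \<in> ?U" for a b c using nz(3)[OF that] unfolding P .
        show "\<exists>!z. normalized f a b c z" if "(a, b, c) \<in> ?U" for a b c
          using given[OF that] unfolding given_iff[OF nz(2,3)[OF that]] by blast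
        show "I1_33 f a b c a1 a2 a4 = - yb a b * (384 * yb a b ^ 3 + 72 * X a b * yb a b + 12 * \<alpha>) / L.P a b c ^ 2 \<and>
            I1_331 f a b c a1 a2 a4 = 1152 + 72 * X a b / yb a b ^ 2 \<and>
            I1_3331 f a b c a1 a2 a4 = 4032 + 72 / (yb a b * L.P a b c) \<and>
            I1_33311 f a b c a1 a2 a4 = - 4032 * L.P a b c ^ 2 / yb a b ^ 4"
          if "(a, b, c) \<in> ?U" "normalized f a b c (a1, a2, a4)" for a b c a1 a2 a4
          using given[OF that(1)] that(2) unfolding given_iff[OF nz(2,3)[OF that(1)]] P by blast
      qed
      moreover have "(x, y, p) \<in> ?U" using r(1) by simp
      ultimately show "g x y p = 0"
        using L.f_eq[of x y p] r(1) by (auto simp: L.satisfies_law_def g_def)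
    qed
    have dP: "(pbar xb yb x y has_field_derivative py yb x y / px X x y) (at p)" for x y p
      unfolding pbar_eq[abs_def] by (rule DERIV_cdivide) (auto intro!: derivative_eq_intros)
    have cont: "isCont (\<lambda>t. g t y p) x" "isCont (\<lambda>t. g x t p) y" "isCont (\<lambda>t. g x y t) p" if z: "(x, y, p) \<in> U" for x y p
    proof -
      note f = analytic3_on_slices(1-3)[OF assms(2) z, THEN field_differentiable_imp_continuous_at]
      have c: "isCont (\<lambda>t. h t y) x" "isCont (\<lambda>t. h x t) y" if "analytic h" for h
        using analytic2_on_partials(1,2)[OF that UW[OF z]] by (auto intro: DERIV_isCont)
      show "isCont (\<lambda>t. g t y p) x" "isCont (\<lambda>t. g x t p) y" "isCont (\<lambda>t. g x y t) p"
        unfolding g_def by (intro continuous_intros f c; simp)+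
    qed
    note slices = eventually_slices3[OF assms(1)]
    \<comment> \<open>The zero sets of \<open>P\<close>, \<open>Y\<close> and \<open>X\<close> are crossed in the directions \<open>p\<close>, \<open>y\<close> and \<open>x\<close>.\<close>
    have step1: "g x y p = 0" if z: "(x, y, p) \<in> U" and nz: "X x y \<noteq> 0" "yb x y \<noteq> 0" for x y p
    proof (rule zero_by_continuity[OF cont(3)[OF z] dP])
      show "py yb x y / px X x y \<noteq> 0" using py_Y[OF UW[OF z]] px_X[OF UW[OF z]] by simp
      show "\<forall>\<^sub>F t in at p. pbar xb yb x y t \<noteq> 0 \<longrightarrow> g x y t = 0"
        using eventually_nhds_conv_at[THEN iffD1, OF slices(3)[OF z], THEN conjunct1]
        by eventually_elim (use nz in \<open>auto intro!: on_U' simp: U'_def\<close>)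
      show "pbar xb yb x y p \<noteq> 0 \<Longrightarrow> g x y p = 0" using z nz by (auto intro!: on_U' simp: U'_def)
    qed
    have step2: "g x y p = 0" if z: "(x, y, p) \<in> U" and nz: "X x y \<noteq> 0" for x y p
    proof (rule zero_by_continuity[OF cont(2)[OF z] analytic2_on_partials(2)[OF analytic_XY(2) UW[OF z]] py_Y[OF UW[OF z]]])
      show "\<forall>\<^sub>F t in at y. yb x t \<noteq> 0 \<longrightarrow> g x t p = 0"
        using eventually_nhds_conv_at[THEN iffD1, OF slices(2)[OF z], THEN conjunct1]
        by eventually_elim (use nz in \<open>auto intro!: step1 simp: X_def\<close>)
      show "yb x y \<noteq> 0 \<Longrightarrow> g x y p = 0" using z nz by (auto intro!: step1)
    qed
    have step3: "g x y p = 0" if z: "(x, y, p) \<in> U" for x y p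
    proof (rule zero_by_continuity[OF cont(1)[OF z] analytic2_on_partials(1)[OF analytic_XY(1) UW[OF z]] px_X[OF UW[OF z]]])
      show "\<forall>\<^sub>F t in at x. X t y \<noteq> 0 \<longrightarrow> g t y p = 0"
        using eventually_nhds_conv_at[THEN iffD1, OF slices(1)[OF z], THEN conjunct1]
        by eventually_elim (auto intro!: step2)
      show "X x y \<noteq> 0 \<Longrightarrow> g x y p = 0" using z by (auto intro!: step2)
    qed
    show "maps_ode xb yb U f (painleve2 \<alpha>)"
      unfolding maps using step3 by (auto simp: g_def)
  qed
qed

end
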